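(* Let $n\ge4$ and let $u\in W^{2,2}(\mathbb{H}^n)$ be a radial function. Suppose $u(x)=v(V_g(B_g(0,\rho(x))))$ for some function $v$ on $[0,\infty)$, and define the function $u_e$ on $\mathbb{R}^n$ by $u_e(y)=v(\sigma_n|y|^n)$. Then $$\int_{\mathbb{H}^n}(\Delta_gu)^2\,dV_g-\frac{(n-1)^4}{16}\int_{\mathbb{H}^n}u^2\,dV_g\ \ge\ \int_{\mathbb{R}^n}(\Delta u_e)^2\,dy .$$
   Context: $\mathbb{H}^n$ is the hyperbolic space in the Poincaré ball model: the open unit ball $\{x\in\mathbb{R}^n:|x|<1\}$ with the metric $g(x)=\left(\frac{2}{1-|x|^2}\right)^2\sum_{i=1}^n dx_i^2$. Its volume element is $dV_g=\left(\frac{2}{1-|x|^2}\right)^n dx$, and its Laplace–Beltrami operator is $\Delta_g=\left(\frac{1-|x|^2}{2}\right)^2\Delta+(n-2)\frac{1-|x|^2}{2}\langle x,\nabla\rangle$, where $\Delta$, $\nabla$, $\langle\cdot,\cdot\rangle$ are the Euclidean Laplacian, gradient and scalar product. $\rho(x)=\ln\frac{1+|x|}{1-|x|}$ is the geodesic distance from $0$ to $x$. $B_g(0,r)$ is the geodesic ball centered at $0$ with radius $r$, and $V_g(B_g(0,r))=n\sigma_n\int_0^r\sinh^{n-1}(s)\,ds$ is its volume, where $\sigma_n$ is the volume of the unit ball in $\mathbb{R}^n$. $W^{2,2}(\mathbb{H}^n)$ is the completion of $C_0^\infty(\mathbb{H}^n)$ (smooth compactly supported real-valued functions) under the norm $\left(\int_{\mathbb{H}^n}|\Delta_gu|^2dV_g\right)^{1/2}$;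 it embeds in $L^2(\mathbb{H}^n)$ by the Poincaré inequality. A function on $\mathbb{H}^n$ is radial if it depends only on $\rho(x)$. *)

theory Defs
  imports "HOL-Analysis.Analysis"
begin

text \<open>The dimension \<open>n\<close> is \<open>DIM('a)\<close> for an arbitrary Euclidean space \<open>'a\<close>. A function on hyperbolic
  space is represented by a function on \<open>'a\<close> of which only the values on \<open>ball 0 1\<close> matter.\<close>

section \<open>Smooth functions and Euclidean differential operators\<close>

definition partial_deriv :: "'a::euclidean_space \<Rightarrow> ('a \<Rightarrow> real) \<Rightarrow> 'a \<Rightarrow> real" where
  "partial_deriv b f = (\<lambda>x. frechet_derivative f (at x) b)"

primrec C_diff :: "nat \<Rightarrow> ('a::euclidean_space \<Rightarrow> real) \<Rightarrow> bool" where
  "C_diff 0 f \<longleftrightarrow> continuous_on UNIV f"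
| "C_diff (Suc k) f \<longleftrightarrow>
     (\<forall>x. f differentiable (at x)) \<and> (\<forall>b\<in>Basis. C_diff k (partial_deriv b f))"

definition smooth :: "('a::euclidean_space \<Rightarrow> real) \<Rightarrow> bool" where
  "smooth f \<longleftrightarrow> (\<forall>k. C_diff k f)"

text \<open>\<open>C\<^sub>0\<^sup>\<infinity>(S)\<close> for open \<open>S\<close>, its elements being extended by zero outside \<open>S\<close>.\<close>

definition test_functions :: "'a::euclidean_space set \<Rightarrow> ('a \<Rightarrow> real) set" where
  "test_functions S =
     {f. smooth f \<and> compact (closure {x. f x \<noteq> 0}) \<and> closure {x. f x \<noteq> 0} \<subseteq> S}"

definition laplacian :: "('a::euclidean_space \<Rightarrow> real) \<Rightarrow> 'a \<Rightarrow> real" where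
  "laplacian f x = (\<Sum>b\<in>Basis. partial_deriv b (partial_deriv b f) x)"

definition gradient :: "('a::euclidean_space \<Rightarrow> real) \<Rightarrow> 'a \<Rightarrow> 'a" where
  "gradient f x = (\<Sum>b\<in>Basis. partial_deriv b f x *\<^sub>R b)"

section \<open>Square-integrable functions and weak Laplacians\<close>

definition L2 :: "'a measure \<Rightarrow> ('a \<Rightarrow> real) set" where
  "L2 M = {f \<in> borel_measurable M. integrable M (\<lambda>x. (f x)\<^sup>2)}"

definition L2_tendsto :: "'a measure \<Rightarrow> (nat \<Rightarrow> 'a \<Rightarrow> real) \<Rightarrow> ('a \<Rightarrow> real) \<Rightarrow> bool" where
  "L2_tendsto M f l \<longleftrightarrow> (\<forall>k. f k \<in> L2 M) \<and> l \<in> L2 M \<and>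
     ((\<lambda>k. \<integral>\<^sup>+x. ennreal ((f k x - l x)\<^sup>2) \<partial>M) \<longlonglongrightarrow> 0)"

definition locally_integrable :: "('a::euclidean_space \<Rightarrow> real) \<Rightarrow> bool" where
  "locally_integrable f \<longleftrightarrow> (\<forall>K. compact K \<longrightarrow> set_integrable lebesgue K f)"

definition has_weak_laplacian ::
    "('a::euclidean_space \<Rightarrow> real) \<Rightarrow> ('a \<Rightarrow> real) \<Rightarrow> bool" where
  "has_weak_laplacian f h \<longleftrightarrow> locally_integrable f \<and> locally_integrable h \<and>
     (\<forall>\<phi>\<in>test_functions UNIV.
        (\<integral>x. f x * laplacian \<phi> x \<partial>lebesgue) = (\<integral>x. h x * \<phi> x \<partial>lebesgue))"

section \<open>Hyperbolic space in the Poincare ball model\<close>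

definition hyp_measure :: "'a::euclidean_space measure" where
  "hyp_measure = density (lebesgue_on (ball 0 1))
     (\<lambda>x. ennreal ((2 / (1 - (norm x)\<^sup>2)) ^ DIM('a)))"

definition hyp_laplacian :: "('a::euclidean_space \<Rightarrow> real) \<Rightarrow> 'a \<Rightarrow> real" where
  "hyp_laplacian f x =
     ((1 - (norm x)\<^sup>2) / 2)\<^sup>2 * laplacian f x
     + (real DIM('a) - 2) * ((1 - (norm x)\<^sup>2) / 2) * (x \<bullet> gradient f x)"

definition hyp_dist0 :: "'a::euclidean_space \<Rightarrow> real" where
  "hyp_dist0 x = ln ((1 + norm x) / (1 - norm x))"

definition hyp_ball0 :: "real \<Rightarrow> 'a::euclidean_space set" where
  "hyp_ball0 r = {x \<in> ball 0 1. hyp_dist0 x < r}"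

text \<open>The completion of the test functions \<open>\<phi>\<close> under the \<open>L\<^sup>2\<close> norm of \<open>hyp_laplacian \<phi>\<close> is realised
  inside \<open>L\<^sup>2\<close>: by the Poincare inequality, a sequence of test functions that is Cauchy for this norm
  converges in \<open>L\<^sup>2\<close>, and its limit \<open>u\<close> represents the corresponding element of the completion. The
  hyperbolic Laplacian of \<open>u\<close> is the \<open>L\<^sup>2\<close> limit \<open>w\<close> of the Laplacians of the sequence; it is unique
  almost everywhere.\<close>

definition has_hyp_laplacian ::
    "('a::euclidean_space \<Rightarrow> real) \<Rightarrow> ('a \<Rightarrow> real) \<Rightarrow> bool" where
  "has_hyp_laplacian u w \<longleftrightarrow>
     (\<exists>\<phi>. (\<forall>k. \<phi> k \<in> test_functions (ball 0 1)) \<and>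
          L2_tendsto hyp_measure \<phi> u \<and>
          L2_tendsto hyp_measure (\<lambda>k. hyp_laplacian (\<phi> k)) w)"

definition hyp_W22 :: "('a::euclidean_space \<Rightarrow> real) set" where
  "hyp_W22 = {u. \<exists>w. has_hyp_laplacian u w}"

text \<open>Radiality is required almost everywhere only, since elements of \<open>hyp_W22\<close> stand for their
  almost-everywhere classes.\<close>

definition hyp_radial :: "('a::euclidean_space \<Rightarrow> real) \<Rightarrow> bool" where
  "hyp_radial u \<longleftrightarrow> (\<exists>f. AE x in hyp_measure. u x = f (hyp_dist0 x))"

end

theory Submission
  imports Defs
begin

text \<open>Take the enclosed volume \<open>t\<close> as the radial variable on both spaces. Both \<open>L\<^sup>2\<close> norms become the one
  of \<open>L\<^sup>2(0, \<infinity>)\<close>, the hyperbolic Laplacian of \<open>v\<close> becomes \<open>f = (A v')'\<close> and the Euclidean one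
  \<open>h = (k A v')' = (k F)'\<close>, where \<open>F = A v'\<close> and \<open>k \<le> 1\<close> is the ratio of the two weights. Integrating
  \<open>2 k k' f F\<close> by parts and using the Hardy inequality for \<open>F\<close> with weight \<open>1 - k\<^sup>2\<close> and for \<open>v\<close>, the claim
  reduces to the pointwise inequality \<open>key_inequality\<close>. It follows from two-sided rational bounds of
  the volume \<open>t\<close> in terms of the hyperbolic sine of the radius, and uses \<open>n \<ge> 4\<close>.

  A general radial \<open>u\<close> is reached by duality. The approximating test functions need not be radial,
  but they can be paired with radial solutions \<open>P\<close> of \<open>(A P')' = f\<close> for \<open>f\<close> continuous with compact
  support in \<open>(0, \<infinity>)\<close>. By the Riesz representation, the radial part of the Laplacian \<open>w\<close> of \<open>u\<close> is an
  \<open>L\<^sup>2\<close> limit of such \<open>f\<close>; the one-dimensional inequality makes the corresponding solutions and their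
  Euclidean Laplacians converge, and the former converge to \<open>u\<close>.\<close>

section \<open>The space of square-integrable functions\<close>

text \<open>The constant \<open>\<kappa>\<close> multiplies two Hardy constants 1/4 by the square of
  \<open>(n - 1)\<^sup>2\<close>, the rate in \<open>A t \<ge> (n - 1)\<^sup>2 t\<^sup>2\<close>:
  one Hardy inequality compares \<open>f = F'\<close> with \<open>F / t\<close>, the other
  \<open>v\<close> with \<open>t v'\<close>. Used one after the other with weight 1 they spend the
  whole integral of \<open>f\<^sup>2\<close> and leave nothing for the Euclidean term. That term
  claims the share \<open>k\<^sup>2\<close> of \<open>f\<^sup>2\<close>, so both inequalities and
  the integration by parts have to be merged into one pointwise estimate, in which the derivatives
  of \<open>k\<close> and the slack in the bound of \<open>A\<close> pay for the lost weight. In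
  substance \<open>n \<ge> 4\<close> enters twice, as \<open>2 (n - 1) \<ge> n + 2\<close> and as
  \<open>(n - 1) (n + 2) \<ge> 16\<close>. The obstacle in the general case is regularity:
  \<open>v\<close> is an arbitrary representative that can neither be differentiated nor be taken to
  be measurable. Pairing with solutions moves all derivatives to functions that have them, and
  averaging over rotations is avoided. For the same reason null sets are carried between the two
  spaces by a differentiable map, not by image measures.\<close>

lemma L2_measurable [measurable_dest]: "f \<in> L2 M \<Longrightarrow> f \<in> borel_measurable M"
  by (simp add: L2_def)

lemma L2_integrable_square: "f \<in> L2 M \<Longrightarrow> integrable M (\<lambda>x. (f x)\<^sup>2)"
  by (simp add: L2_def)

lemma L2I: "f \<in> borel_measurable M \<Longrightarrow> integrable M (\<lambda>x. (f x)\<^sup>2) \<Longrightarrow> f \<in> L2 M"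
  by (simp add: L2_def)

lemma L2_nn_integral:
  assumes "f \<in> borel_measurable M" "(\<integral>\<^sup>+x. ennreal ((f x)\<^sup>2) \<partial>M) < \<infinity>"
  shows "f \<in> L2 M"
  using assms by (auto intro!: L2I integrableI_bounded)

lemma L2_cmult: "f \<in> L2 M \<Longrightarrow> (\<lambda>x. c * f x) \<in> L2 M"
  by (auto simp: L2_def power_mult_distrib)

lemma L2_add:
  assumes "f \<in> L2 M" "g \<in> L2 M"
  shows "(\<lambda>x. f x + g x) \<in> L2 M"
proof (rule L2I)
  show "integrable M (\<lambda>x. (f x + g x)\<^sup>2)"
  proof (rule Bochner_Integration.integrable_bound)
    show "integrable M (\<lambda>x. 2 * (f x)\<^sup>2 + 2 * (g x)\<^sup>2)"
      using assms by (auto simp: L2_def)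
    have "(a + b)\<^sup>2 \<le> 2 * a\<^sup>2 + 2 * b\<^sup>2" for a b :: real
      using zero_le_power2[of "a - b"] by (simp add: power2_eq_square algebra_simps)
    then show "AE x in M. norm ((f x + g x)\<^sup>2) \<le> norm (2 * (f x)\<^sup>2 + 2 * (g x)\<^sup>2)" by simp
  qed (use assms in measurable)
qed (use assms in measurable)

lemma L2_diff: "f \<in> L2 M \<Longrightarrow> g \<in> L2 M \<Longrightarrow> (\<lambda>x. f x - g x) \<in> L2 M"
  using L2_add[of f M "\<lambda>x. (-1) * g x"] L2_cmult[of g M "-1"] by simp

lemma L2_integrable_mult:
  assumes "f \<in> L2 M" "g \<in> L2 M"
  shows "integrable M (\<lambda>x. f x * g x)"
proof (rule Bochner_Integration.integrable_bound)
  show "integrable M (\<lambda>x. (f x)\<^sup>2 + (g x)\<^sup>2)"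
    using assms by (auto simp: L2_def)
  have "\<bar>a * b\<bar> \<le> a\<^sup>2 + b\<^sup>2" for a b :: real
  proof -
    have "2 * \<bar>a\<bar> * \<bar>b\<bar> \<le> a\<^sup>2 + b\<^sup>2" using sum_squares_bound[of "\<bar>a\<bar>" "\<bar>b\<bar>"] by simp
    moreover have "0 \<le> \<bar>a\<bar> * \<bar>b\<bar>" by simp
    ultimately show ?thesis unfolding abs_mult by linarith
  qed
  then show "AE x in M. norm (f x * g x) \<le> norm ((f x)\<^sup>2 + (g x)\<^sup>2)" by simp
qed (use assms in measurable)

lemma L2_AE_cong:
  assumes "f \<in> L2 M" "g \<in> borel_measurable M" "AE x in M. f x = g x"
  shows "g \<in> L2 M"
proof (rule L2I)
  have "integrable M (\<lambda>x. (f x)\<^sup>2) \<longleftrightarrow> integrable M (\<lambda>x. (g x)\<^sup>2)"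
    by (intro integrable_cong_AE) (use assms in \<open>auto simp: L2_def\<close>)
  then show "integrable M (\<lambda>x. (g x)\<^sup>2)"
    using assms(1) by (simp add: L2_def)
qed fact

lemma L2_nn_integral_eq:
  assumes "f \<in> L2 M"
  shows "(\<integral>\<^sup>+x. ennreal ((f x)\<^sup>2) \<partial>M) = ennreal (\<integral>x. (f x)\<^sup>2 \<partial>M)"
  using assms by (intro nn_integral_eq_integral) (auto simp: L2_def)

lemma L2_tendsto_iff:
  "L2_tendsto M f l \<longleftrightarrow> (\<forall>k. f k \<in> L2 M) \<and> l \<in> L2 M \<and> (\<lambda>k. \<integral>x. (f k x - l x)\<^sup>2 \<partial>M) \<longlonglongrightarrow> 0"
proof -
  have "((\<lambda>k. \<integral>\<^sup>+x. ennreal ((f k x - l x)\<^sup>2) \<partial>M) \<longlonglongrightarrow> 0) \<longleftrightarrow>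
        ((\<lambda>k. \<integral>x. (f k x - l x)\<^sup>2 \<partial>M) \<longlonglongrightarrow> 0)"
    if "\<forall>k. f k \<in> L2 M" "l \<in> L2 M"
  proof -
    have "(\<integral>\<^sup>+x. ennreal ((f k x - l x)\<^sup>2) \<partial>M) = ennreal (\<integral>x. (f k x - l x)\<^sup>2 \<partial>M)" for k
      by (rule L2_nn_integral_eq) (use that L2_diff in blast)
    moreover have "((\<lambda>k. ennreal (a k)) \<longlonglongrightarrow> 0) \<longleftrightarrow> (a \<longlonglongrightarrow> 0)" if "\<And>k. a k \<ge> 0" for a :: "nat \<Rightarrow> real"
      using tendsto_ennreal_iff[of a sequentially 0] that by simp
    ultimately show ?thesis by simp
  qed
  then show ?thesis unfolding L2_tendsto_def by blast
qed

text \<open>Serves Cauchy-Schwarz and, in \<open>L2_Riesz\<close>, the passage from near-minimality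
  to near-stationarity, where \<open>a\<close> is the distance from the minimum. In both uses
  \<open>c\<close> is a squared norm and may vanish.\<close>

lemma quadratic_nonneg_discriminant:
  fixes a b c :: real
  assumes "\<And>s. 0 \<le> a - 2 * s * b + s\<^sup>2 * c" "c \<ge> 0"
  shows "b\<^sup>2 \<le> a * c"
proof (cases "c = 0")
  case True
  have "b = 0"
  proof (rule ccontr)
    assume "b \<noteq> 0"
    \<comment> \<open>At this \<open>s\<close> the quadratic takes the value -1.\<close>
    with assms(1)[of "(a + 1) / (2 * b)"] True show False by simp
  qed
  then show ?thesis using True by simp
next
  case False
  then have "c > 0" using assms(2) by simp
  have "0 \<le> a - 2 * (b / c) * b + (b / c)\<^sup>2 * c" by (rule assms(1))
  also have "\<dots> = (a * c - b\<^sup>2) / c" using \<open>c > 0\<close> by (simp add: field_simps power2_eq_square)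
  finally show ?thesis using \<open>c > 0\<close> by (simp add: zero_le_divide_iff)
qed

lemma L2_square_expand:
  assumes "f \<in> L2 M" "g \<in> L2 M"
  shows "(\<integral>x. (f x - s * g x)\<^sup>2 \<partial>M) =
    (\<integral>x. (f x)\<^sup>2 \<partial>M) - 2 * s * (\<integral>x. f x * g x \<partial>M) + s\<^sup>2 * (\<integral>x. (g x)\<^sup>2 \<partial>M)"
proof -
  have "(\<integral>x. (f x - s * g x)\<^sup>2 \<partial>M) =
      (\<integral>x. (f x)\<^sup>2 - 2 * s * (f x * g x) + s\<^sup>2 * (g x)\<^sup>2 \<partial>M)"
    by (intro Bochner_Integration.integral_cong) (auto simp: power2_eq_square algebra_simps)
  also have "\<dots> = (\<integral>x. (f x)\<^sup>2 \<partial>M) - 2 * s * (\<integral>x. f x * g x \<partial>M) + s\<^sup>2 * (\<integral>x. (g x)\<^sup>2 \<partial>M)"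
    using assms by (simp add: L2_integrable_square L2_integrable_mult)
  finally show ?thesis .
qed

lemma L2_Cauchy_Schwarz:
  assumes "f \<in> L2 M" "g \<in> L2 M"
  shows "(\<integral>x. f x * g x \<partial>M)\<^sup>2 \<le> (\<integral>x. (f x)\<^sup>2 \<partial>M) * (\<integral>x. (g x)\<^sup>2 \<partial>M)"
  by (rule quadratic_nonneg_discriminant)
     (auto simp: L2_square_expand[OF assms, symmetric])

lemma null_sequence_dominated:
  fixes a b :: "nat \<Rightarrow> real"
  assumes "\<And>k. 0 \<le> a k" "\<And>k. a k \<le> b k" "b \<longlonglongrightarrow> 0"
  shows "a \<longlonglongrightarrow> 0"
  by (rule tendsto_sandwich[of "\<lambda>_. 0" a sequentially b]) (use assms in auto)

lemma L2_tendsto_inner: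
  assumes "L2_tendsto M f l" "g \<in> L2 M"
  shows "(\<lambda>k. \<integral>x. f k x * g x \<partial>M) \<longlonglongrightarrow> (\<integral>x. l x * g x \<partial>M)"
proof -
  have f: "f k \<in> L2 M" and l: "l \<in> L2 M" for k
    using assms(1) by (auto simp: L2_tendsto_iff)
  have lim: "(\<lambda>k. \<integral>x. (f k x - l x)\<^sup>2 \<partial>M) \<longlonglongrightarrow> 0"
    using assms(1) by (auto simp: L2_tendsto_iff)
  have "(\<lambda>k. (\<integral>x. (f k x - l x)\<^sup>2 \<partial>M) * (\<integral>x. (g x)\<^sup>2 \<partial>M)) \<longlonglongrightarrow> 0"
    using tendsto_mult_left_zero[OF lim] by simp
  moreover have "(\<integral>x. (f k x - l x) * g x \<partial>M)\<^sup>2 \<le>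
      (\<integral>x. (f k x - l x)\<^sup>2 \<partial>M) * (\<integral>x. (g x)\<^sup>2 \<partial>M)" for k
    by (intro L2_Cauchy_Schwarz L2_diff f l assms(2))
  ultimately have "(\<lambda>k. (\<integral>x. (f k x - l x) * g x \<partial>M)\<^sup>2) \<longlonglongrightarrow> 0"
    by (intro null_sequence_dominated[of "\<lambda>k. (\<integral>x. (f k x - l x) * g x \<partial>M)\<^sup>2"]) auto
  then have "(\<lambda>k. (\<integral>x. (f k x - l x) * g x \<partial>M)) \<longlonglongrightarrow> 0" by simp
  moreover have "(\<integral>x. (f k x - l x) * g x \<partial>M) = (\<integral>x. f k x * g x \<partial>M) - (\<integral>x. l x * g x \<partial>M)" for k
    using f l assms(2) by (simp add: left_diff_distrib L2_integrable_mult)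
  ultimately show ?thesis by (simp add: LIM_zero_iff)
qed

lemma L2_tendsto_norm:
  assumes "L2_tendsto M f l"
  shows "(\<lambda>k. \<integral>x. (f k x)\<^sup>2 \<partial>M) \<longlonglongrightarrow> (\<integral>x. (l x)\<^sup>2 \<partial>M)"
proof -
  have f: "f k \<in> L2 M" and l: "l \<in> L2 M" for k
    using assms(1) by (auto simp: L2_tendsto_iff)
  have lim: "(\<lambda>k. \<integral>x. (f k x - l x)\<^sup>2 \<partial>M) \<longlonglongrightarrow> 0"
    using assms(1) by (auto simp: L2_tendsto_iff)
  have "(\<integral>x. (f k x)\<^sup>2 \<partial>M) =
      (\<integral>x. (f k x - l x)\<^sup>2 \<partial>M) + 2 * (\<integral>x. f k x * l x \<partial>M) - (\<integral>x. (l x)\<^sup>2 \<partial>M)" for k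
    using L2_square_expand[OF f l, of k 1] by simp
  moreover have "(\<lambda>k. (\<integral>x. (f k x - l x)\<^sup>2 \<partial>M) + 2 * (\<integral>x. f k x * l x \<partial>M) - (\<integral>x. (l x)\<^sup>2 \<partial>M))
     \<longlonglongrightarrow> 0 + 2 * (\<integral>x. l x * l x \<partial>M) - (\<integral>x. (l x)\<^sup>2 \<partial>M)"
    by (intro tendsto_intros lim L2_tendsto_inner[OF assms l])
  ultimately show ?thesis by (simp add: power2_eq_square)
qed

section \<open>Completeness of the square-integrable functions\<close>

lemma summable_diff_imp_convergent:
  fixes X :: "nat \<Rightarrow> real"
  assumes "summable (\<lambda>n. X (Suc n) - X n)"
  shows "convergent X"
proof -
  have "convergent (\<lambda>n. \<Sum>i<n. X (Suc i) - X i)"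
    using assms by (simp add: summable_iff_convergent)
  then have "convergent (\<lambda>n. X n - X 0)" by (simp add: sum_lessThan_telescope)
  then have "convergent (\<lambda>n. (X n - X 0) + X 0)" by (intro convergent_add convergent_const)
  then show ?thesis by simp
qed

text \<open>The squared increments are weighted by \<open>2 ^ k\<close>. Their integrals are then at
  most \<open>(1/2) ^ k\<close> and still summable, while at a point where the weighted sum is
  finite the increments themselves are \<open>O((1 / sqrt 2) ^ k)\<close>, hence summable.\<close>

lemma AE_convergent_of_fast_L2_Cauchy:
  fixes f :: "nat \<Rightarrow> 'a \<Rightarrow> real"
  assumes f: "\<And>k. f k \<in> L2 M" and d: "\<And>k. (\<integral>x. (f (Suc k) x - f k x)\<^sup>2 \<partial>M) \<le> (1/4) ^ k"
  shows "AE x in M. convergent (\<lambda>k. f k x)"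
proof -
  have [measurable]: "f k \<in> borel_measurable M" for k using f by (simp add: L2_def)
  define D where "D k x = (f (Suc k) x - f k x)\<^sup>2" for k x
  have [measurable]: "D k \<in> borel_measurable M" for k unfolding D_def by measurable
  have "(\<integral>\<^sup>+x. ennreal (2 ^ k * D k x) \<partial>M) \<le> ennreal ((1/2) ^ k)" for k
  proof -
    have "(\<integral>\<^sup>+x. ennreal (2 ^ k * D k x) \<partial>M) = (\<integral>\<^sup>+x. ennreal (2 ^ k) * ennreal (D k x) \<partial>M)"
      by (simp add: ennreal_mult D_def)
    also have "\<dots> = ennreal (2 ^ k) * (\<integral>\<^sup>+x. ennreal (D k x) \<partial>M)"
      by (simp add: nn_integral_cmult)
    also have "(\<integral>\<^sup>+x. ennreal (D k x) \<partial>M) = ennreal (\<integral>x. D k x \<partial>M)"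
      unfolding D_def by (intro L2_nn_integral_eq L2_diff f)
    also have "ennreal (2 ^ k) * \<dots> \<le> ennreal (2 ^ k) * ennreal ((1/4) ^ k)"
      using d[of k] by (intro mult_left_mono ennreal_leI) (auto simp: D_def)
    also have "\<dots> = ennreal (2 ^ k * (1/4) ^ k)" by (simp add: ennreal_mult)
    also have "(2::real) ^ k * (1/4) ^ k = (1/2) ^ k"
      by (simp flip: power_mult_distrib)
    finally show ?thesis .
  qed
  then have "(\<Sum>k. \<integral>\<^sup>+x. ennreal (2 ^ k * D k x) \<partial>M) \<le> (\<Sum>k. ennreal ((1/2) ^ k))"
    by (intro suminf_le) auto
  also have "\<dots> = ennreal (\<Sum>k. (1/2) ^ k)"
    by (intro suminf_ennreal2) auto
  also have "\<dots> < \<infinity>" by simp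
  finally have "(\<integral>\<^sup>+x. (\<Sum>k. ennreal (2 ^ k * D k x)) \<partial>M) < \<infinity>"
    by (subst nn_integral_suminf) auto
  then have "AE x in M. (\<Sum>k. ennreal (2 ^ k * D k x)) \<noteq> \<infinity>"
    by (intro nn_integral_PInf_AE) auto
  then show ?thesis
  proof (rule AE_mp, intro AE_I2 impI)
    fix x assume "(\<Sum>k. ennreal (2 ^ k * D k x)) \<noteq> \<infinity>"
    then have "summable (\<lambda>k. 2 ^ k * D k x)"
      by (intro summable_suminf_not_top) (auto simp: D_def)
    then have "Bseq (\<lambda>k. 2 ^ k * D k x)"
      by (intro convergent_imp_Bseq convergentI[of _ 0] summable_LIMSEQ_zero)
    then obtain K where K: "K > 0" "\<And>k. norm (2 ^ k * D k x) \<le> K" by (auto elim: BseqE)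
    have "norm (f (Suc k) x - f k x) \<le> sqrt K * (1 / sqrt 2) ^ k" for k
    proof -
      have "D k x \<le> K / 2 ^ k" using K(2)[of k] by (auto simp: field_simps D_def)
      then have "sqrt (D k x) \<le> sqrt (K / 2 ^ k)" by simp
      also have "\<dots> = sqrt K * (1 / sqrt 2) ^ k"
        by (simp add: real_sqrt_divide real_sqrt_power power_one_over)
      finally show ?thesis by (simp add: D_def)
    qed
    note bound = this
    have "summable (\<lambda>k. sqrt K * (1 / sqrt 2) ^ k)"
      by (intro summable_mult summable_geometric) simp
    then have "summable (\<lambda>k. f (Suc k) x - f k x)"
      by (rule summable_comparison_test'[where N = 0]) (rule bound)
    then show "convergent (\<lambda>k. f k x)" by (rule summable_diff_imp_convergent)
  qed
qed

text \<open>The argument of Riesz and Fischer: the limit is built pointwise along a fast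
  subsequence, and Fatou's lemma then estimates the distance of the full sequence from it.\<close>

lemma L2_complete:
  fixes f :: "nat \<Rightarrow> 'a \<Rightarrow> real"
  assumes f: "\<And>k. f k \<in> L2 M"
    and Cau: "\<And>e. e > 0 \<Longrightarrow> \<exists>N. \<forall>i\<ge>N. \<forall>j\<ge>N. (\<integral>x. (f i x - f j x)\<^sup>2 \<partial>M) \<le> e"
  obtains l where "L2_tendsto M f l"
proof -
  have [measurable]: "f k \<in> borel_measurable M" for k using f by (simp add: L2_def)
  have "\<forall>k. \<exists>N. \<forall>i\<ge>N. \<forall>j\<ge>N. (\<integral>x. (f i x - f j x)\<^sup>2 \<partial>M) \<le> (1/4) ^ k"
    by (intro allI Cau) simp
  from choice[OF this] obtain N
    where N: "\<And>k i j. i \<ge> N k \<Longrightarrow> j \<ge> N k \<Longrightarrow> (\<integral>x. (f i x - f j x)\<^sup>2 \<partial>M) \<le> (1/4) ^ k"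
    by blast
  \<comment> \<open>The sum gives monotonicity and \<open>r k \<ge> N k\<close>; the summand
    \<open>k\<close> gives \<open>r k \<ge> k\<close>, which the Fatou step uses.\<close>
  define r where "r k = k + (\<Sum>i\<le>k. N i)" for k
  have r: "r k \<ge> N k" "r (Suc k) \<ge> r k" "r k \<ge> k" for k
    using member_le_sum[of k "{..k}" N] by (auto simp: r_def)
  have fast: "(\<integral>x. (f (r (Suc k)) x - f (r k) x)\<^sup>2 \<partial>M) \<le> (1/4) ^ k" for k
    by (rule N) (use r(1,2)[of k] in linarith)+
  have "AE x in M. convergent (\<lambda>k. f (r k) x)"
    by (rule AE_convergent_of_fast_L2_Cauchy[of "\<lambda>k. f (r k)", OF f fast])
  define l where "l x = lim (\<lambda>k. f (r k) x)" for x
  have [measurable]: "l \<in> borel_measurable M" unfolding l_def by measurable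
  have lim: "AE x in M. (\<lambda>k. f (r k) x) \<longlonglongrightarrow> l x"
    using \<open>AE x in M. convergent _\<close> by (auto simp: l_def convergent_LIMSEQ_iff)
  have tail: "\<exists>N. \<forall>i\<ge>N. (\<integral>\<^sup>+x. ennreal ((f i x - l x)\<^sup>2) \<partial>M) \<le> ennreal e" if "e > 0" for e
  proof -
    obtain N where N: "\<And>i j. i \<ge> N \<Longrightarrow> j \<ge> N \<Longrightarrow> (\<integral>x. (f i x - f j x)\<^sup>2 \<partial>M) \<le> e"
      using Cau[OF \<open>e > 0\<close>] by blast
    have "(\<integral>\<^sup>+x. ennreal ((f i x - l x)\<^sup>2) \<partial>M) \<le> ennreal e" if "i \<ge> N" for i
    proof -
      have "(\<integral>\<^sup>+x. ennreal ((f i x - l x)\<^sup>2) \<partial>M) =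
          (\<integral>\<^sup>+x. liminf (\<lambda>k. ennreal ((f i x - f (r k) x)\<^sup>2)) \<partial>M)"
      proof (rule nn_integral_cong_AE)
        show "AE x in M. ennreal ((f i x - l x)\<^sup>2) = liminf (\<lambda>k. ennreal ((f i x - f (r k) x)\<^sup>2))"
          using lim
        proof eventually_elim
          case (elim x)
          have "(\<lambda>k. ennreal ((f i x - f (r k) x)\<^sup>2)) \<longlonglongrightarrow> ennreal ((f i x - l x)\<^sup>2)"
            by (intro tendsto_intros elim tendsto_ennrealI)
          then show ?case by (rule lim_imp_Liminf[OF trivial_limit_sequentially, symmetric])
        qed
      qed
      also have "\<dots> \<le> liminf (\<lambda>k. \<integral>\<^sup>+x. ennreal ((f i x - f (r k) x)\<^sup>2) \<partial>M)"
        by (intro nn_integral_liminf) measurable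
      also have "\<dots> \<le> liminf (\<lambda>k. ennreal e)"
      proof (rule Liminf_mono, rule eventually_sequentiallyI)
        fix k assume "k \<ge> N"
        then show "(\<integral>\<^sup>+x. ennreal ((f i x - f (r k) x)\<^sup>2) \<partial>M) \<le> ennreal e"
          using N[of i "r k"] r(3)[of k] \<open>i \<ge> N\<close>
          by (subst L2_nn_integral_eq) (auto intro!: L2_diff f ennreal_leI)
      qed
      finally show ?thesis by (simp add: Liminf_const)
    qed
    then show ?thesis by blast
  qed
  obtain i where i: "(\<integral>\<^sup>+x. ennreal ((f i x - l x)\<^sup>2) \<partial>M) \<le> ennreal 1"
    using tail[of 1] by auto
  have "(\<lambda>x. f i x - l x) \<in> L2 M"
    by (rule L2_nn_integral) (use i in \<open>auto intro: le_less_trans\<close>)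
  from L2_diff[OF f[of i] this] have "l \<in> L2 M" by simp
  moreover have "(\<lambda>k. \<integral>x. (f k x - l x)\<^sup>2 \<partial>M) \<longlonglongrightarrow> 0"
  proof (rule LIMSEQ_I)
    fix e :: real assume "e > 0"
    then obtain N where N: "\<And>i. i \<ge> N \<Longrightarrow> (\<integral>\<^sup>+x. ennreal ((f i x - l x)\<^sup>2) \<partial>M) \<le> ennreal (e/2)"
      using tail[of "e/2"] by auto
    have "norm ((\<integral>x. (f i x - l x)\<^sup>2 \<partial>M) - 0) < e" if "i \<ge> N" for i
    proof -
      have "ennreal (\<integral>x. (f i x - l x)\<^sup>2 \<partial>M) \<le> ennreal (e/2)"
        using N[OF that] L2_nn_integral_eq[OF L2_diff[OF f \<open>l \<in> L2 M\<close>], of i] by simp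
      then show ?thesis using \<open>e > 0\<close> by (simp add: ennreal_le_iff)
    qed
    then show "\<exists>no. \<forall>n\<ge>no. norm ((\<integral>x. (f n x - l x)\<^sup>2 \<partial>M) - 0) < e" by blast
  qed
  ultimately show ?thesis using that f by (auto simp: L2_tendsto_iff)
qed

lemma L2_tendsto_Cauchy:
  assumes "L2_tendsto M f l" "e > 0"
  shows "\<exists>N. \<forall>i\<ge>N. \<forall>j\<ge>N. (\<integral>x. (f i x - f j x)\<^sup>2 \<partial>M) \<le> e"
proof -
  have f: "f k \<in> L2 M" and l: "l \<in> L2 M" and lim: "(\<lambda>k. \<integral>x. (f k x - l x)\<^sup>2 \<partial>M) \<longlonglongrightarrow> 0" for k
    using assms(1) by (auto simp: L2_tendsto_iff)
  obtain N where N: "\<And>i. i \<ge> N \<Longrightarrow> norm ((\<integral>x. (f i x - l x)\<^sup>2 \<partial>M) - 0) < e / 4"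
    using LIMSEQ_D[OF lim, of "e / 4"] \<open>e > 0\<close> by auto
  have "(\<integral>x. (f i x - f j x)\<^sup>2 \<partial>M) \<le> e" if "i \<ge> N" "j \<ge> N" for i j
  proof -
    have "(\<integral>x. (f i x - f j x)\<^sup>2 \<partial>M) \<le>
        (\<integral>x. 2 * (f i x - l x)\<^sup>2 + 2 * (f j x - l x)\<^sup>2 \<partial>M)"
    proof (rule integral_mono)
      show "integrable M (\<lambda>x. (f i x - f j x)\<^sup>2)"
        by (intro L2_integrable_square L2_diff f)
      show "integrable M (\<lambda>x. 2 * (f i x - l x)\<^sup>2 + 2 * (f j x - l x)\<^sup>2)"
        by (auto intro!: L2_integrable_square L2_diff f l)
      fix x
      show "(f i x - f j x)\<^sup>2 \<le> 2 * (f i x - l x)\<^sup>2 + 2 * (f j x - l x)\<^sup>2"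
        using zero_le_power2[of "f i x - l x + (f j x - l x)"]
        by (simp add: power2_eq_square algebra_simps)
    qed
    also have "\<dots> = 2 * (\<integral>x. (f i x - l x)\<^sup>2 \<partial>M) + 2 * (\<integral>x. (f j x - l x)\<^sup>2 \<partial>M)"
      by (subst Bochner_Integration.integral_add)
         (auto intro!: integrable_mult_right L2_integrable_square L2_diff f l)
    also have "\<dots> \<le> e" using N[OF that(1)] N[OF that(2)] by simp
    finally show ?thesis .
  qed
  then show ?thesis by blast
qed

text \<open>The direct method on a subspace \<open>V\<close> that need not be closed: a minimising
  sequence of \<open>q f - 2 * \<phi> f\<close> is Cauchy, and its limit represents
  \<open>\<phi>\<close>. The sequence is returned together with the limit because its members lie in
  \<open>V\<close>; for \<open>V = Cc_pos\<close> each of them is a right-hand side for which a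
  solution exists.\<close>

lemma L2_Riesz:
  fixes \<phi> :: "('a \<Rightarrow> real) \<Rightarrow> real"
  assumes V: "V \<subseteq> L2 M" "V \<noteq> {}"
    and lin: "\<And>f g s. f \<in> V \<Longrightarrow> g \<in> V \<Longrightarrow> (\<lambda>x. f x + s * g x) \<in> V"
      "\<And>f g s. f \<in> V \<Longrightarrow> g \<in> V \<Longrightarrow> \<phi> (\<lambda>x. f x + s * g x) = \<phi> f + s * \<phi> g"
    and bound: "\<And>f. f \<in> V \<Longrightarrow> (\<phi> f)\<^sup>2 \<le> K * (\<integral>x. (f x)\<^sup>2 \<partial>M)" and K: "K \<ge> 0"
  obtains f g where "\<And>j. f j \<in> V" "L2_tendsto M f g"
    "\<And>h. h \<in> V \<Longrightarrow> \<phi> h = (\<integral>x. h x * g x \<partial>M)" "(\<integral>x. (g x)\<^sup>2 \<partial>M) \<le> K"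
proof -
  define q where "q f = (\<integral>x. (f x)\<^sup>2 \<partial>M)" for f :: "'a \<Rightarrow> real"
  define J where "J f = q f - 2 * \<phi> f" for f
  have q_nonneg: "q f \<ge> 0" for f by (simp add: q_def)
  have expand: "q (\<lambda>x. f x + s * g x) = q f + 2 * s * (\<integral>x. f x * g x \<partial>M) + s\<^sup>2 * q g"
    if "f \<in> V" "g \<in> V" for f g s
    using L2_square_expand[of f M g "- s"] that V by (auto simp: q_def)
  \<comment> \<open>From \<open>(\<phi> f)\<^sup>2 \<le> K * q f\<close> and the inequality of
    arithmetic and geometric means.\<close>
  have J_low: "J f \<ge> - K" if "f \<in> V" for f
  proof -
    have "(\<phi> f)\<^sup>2 \<le> K * q f" using bound[OF that] by (simp add: q_def)
    also have "\<dots> \<le> ((K + q f) / 2)\<^sup>2"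
      using zero_le_power2[of "K - q f"] by (simp add: power2_eq_square field_simps)
    finally have "\<phi> f \<le> (K + q f) / 2"
      by (rule power2_le_imp_le) (use K q_nonneg[of f] in simp)
    then show ?thesis by (simp add: J_def)
  qed
  define d where "d = Inf (J ` V)"
  have d_le: "d \<le> J f" if "f \<in> V" for f
    unfolding d_def by (rule cInf_lower) (use that J_low in \<open>auto intro!: bdd_belowI2\<close>)
  have "\<exists>f\<in>V. J f < d + 1 / real (Suc j)" for j
    using cInf_lessD[of "J ` V" "d + 1 / real (Suc j)"] V(2) unfolding d_def by auto
  then obtain f where f: "\<And>j. f j \<in> V" "\<And>j. J (f j) < d + 1 / real (Suc j)" by metis
  define \<delta> where "\<delta> j = J (f j) - d" for j
  have \<delta>: "0 \<le> \<delta> j" "\<delta> j \<le> 1 / real (Suc j)" for j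
    using d_le[OF f(1)[of j]] f(2)[of j] by (auto simp: \<delta>_def)
  \<comment> \<open>A move from \<open>f j\<close> in the direction \<open>h\<close> lowers
    \<open>J\<close> by at most \<open>\<delta> j\<close>. Required for every step length
    \<open>s\<close>, this is a bound on a discriminant.\<close>
  have var: "((\<integral>x. f j x * h x \<partial>M) - \<phi> h)\<^sup>2 \<le> \<delta> j * q h" if h: "h \<in> V" for j h
  proof (rule quadratic_nonneg_discriminant)
    fix s
    have "d \<le> J (\<lambda>x. f j x + (- s) * h x)" by (intro d_le lin f h)
    also have "\<dots> = J (f j) - 2 * s * ((\<integral>x. f j x * h x \<partial>M) - \<phi> h) + s\<^sup>2 * q h"
      using expand[OF f(1) h, of j "- s"] lin(2)[OF f(1) h, of j "- s"]
      by (simp add: J_def algebra_simps)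
    finally show "0 \<le> \<delta> j - 2 * s * ((\<integral>x. f j x * h x \<partial>M) - \<phi> h) + s\<^sup>2 * q h"
      by (simp add: \<delta>_def)
  qed (rule q_nonneg)
  have fL2: "f j \<in> L2 M" for j using f(1) V(1) by blast
  have q_diff: "q (\<lambda>x. f i x - f j x) \<le> 2 * (\<delta> i + \<delta> j)" for i j
  proof -
    define h where "h x = f i x - f j x" for x
    have "h \<in> V" using lin(1)[OF f(1) f(1), of i "-1" j] by (simp add: h_def[abs_def])
    \<comment> \<open>In place of the parallelogram law: near-stationarity at \<open>f i\<close> and
      at \<open>f j\<close> is tested on their difference \<open>h\<close>, and the two small
      defects \<open>A\<close> and \<open>B\<close> differ by exactly \<open>q h\<close>.\<close>
    define A B where "A = (\<integral>x. f i x * h x \<partial>M) - \<phi> h" and "B = (\<integral>x. f j x * h x \<partial>M) - \<phi> h"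
    have "h \<in> L2 M" using \<open>h \<in> V\<close> V by blast
    have "A - B = (\<integral>x. f i x * h x - f j x * h x \<partial>M)"
      unfolding A_def B_def using \<open>h \<in> L2 M\<close> fL2 by (simp add: L2_integrable_mult)
    also have "\<dots> = q h"
      unfolding q_def by (intro Bochner_Integration.integral_cong) (auto simp: h_def power2_eq_square algebra_simps)
    finally have AB: "A - B = q h" .
    have "A\<^sup>2 \<le> \<delta> i * q h" "B\<^sup>2 \<le> \<delta> j * q h"
      unfolding A_def B_def by (intro var \<open>h \<in> V\<close>)+
    moreover have "(A - B)\<^sup>2 \<le> 2 * A\<^sup>2 + 2 * B\<^sup>2"
      using zero_le_power2[of "A + B"] by (simp add: power2_eq_square algebra_simps)
    ultimately have "q h * q h \<le> 2 * (\<delta> i + \<delta> j) * q h"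
      unfolding AB power2_eq_square by (simp add: algebra_simps)
    then show ?thesis
      using q_nonneg[of h] \<delta>(1)[of i] \<delta>(1)[of j]
      by (cases "q h = 0") (auto simp: h_def[abs_def])
  qed
  have "\<exists>N. \<forall>i\<ge>N. \<forall>j\<ge>N. (\<integral>x. (f i x - f j x)\<^sup>2 \<partial>M) \<le> e" if "e > 0" for e
  proof -
    obtain N where N: "1 / real (Suc N) < e / 4"
      using \<open>e > 0\<close> nat_approx_posE[of "e / 4"] by auto
    have small: "\<delta> i \<le> e / 4" if "i \<ge> N" for i
      using \<delta>(2)[of i] N that by (smt (verit) frac_le of_nat_0_less_iff of_nat_mono Suc_le_mono zero_less_Suc)
    have "q (\<lambda>x. f i x - f j x) \<le> e" if "i \<ge> N" "j \<ge> N" for i j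
      using q_diff[of i j] small[OF that(1)] small[OF that(2)] by argo
    then show ?thesis unfolding q_def by blast
  qed
  then obtain g where g: "L2_tendsto M f g" using L2_complete[of f M] fL2 by blast
  have "\<delta> \<longlonglongrightarrow> 0"
    by (rule null_sequence_dominated[OF \<delta> LIMSEQ_Suc[OF lim_1_over_n]])
  have rep: "\<phi> h = (\<integral>x. h x * g x \<partial>M)" if h: "h \<in> V" for h
  proof -
    have "(\<lambda>j. \<delta> j * q h) \<longlonglongrightarrow> 0" by (rule tendsto_mult_left_zero) fact
    then have "(\<lambda>j. ((\<integral>x. f j x * h x \<partial>M) - \<phi> h)\<^sup>2) \<longlonglongrightarrow> 0"
      by (rule null_sequence_dominated[OF zero_le_power2 var[OF h]])
    then have "(\<lambda>j. (\<integral>x. f j x * h x \<partial>M) - \<phi> h) \<longlonglongrightarrow> 0" by simp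
    then have "(\<lambda>j. \<integral>x. f j x * h x \<partial>M) \<longlonglongrightarrow> \<phi> h" by (rule LIM_zero_cancel)
    moreover have "(\<lambda>j. \<integral>x. f j x * h x \<partial>M) \<longlonglongrightarrow> (\<integral>x. g x * h x \<partial>M)"
      by (rule L2_tendsto_inner[OF g]) (use h V in blast)
    ultimately show ?thesis by (simp add: LIMSEQ_unique mult.commute)
  qed
  have "q g \<le> K"
  proof -
    have gL2: "g \<in> L2 M" using g by (simp add: L2_tendsto_iff)
    have "(\<lambda>j. \<integral>x. f j x * g x \<partial>M) \<longlonglongrightarrow> (\<integral>x. g x * g x \<partial>M)"
      by (rule L2_tendsto_inner[OF g gL2])
    then have "(\<lambda>j. (\<phi> (f j))\<^sup>2) \<longlonglongrightarrow> (q g)\<^sup>2"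
      unfolding rep[OF f(1)] q_def power2_eq_square[of "g _"] by (rule tendsto_power)
    moreover have "(\<lambda>j. K * q (f j)) \<longlonglongrightarrow> K * q g"
      unfolding q_def by (intro tendsto_intros L2_tendsto_norm g)
    ultimately have "(q g)\<^sup>2 \<le> K * q g"
      by (rule LIMSEQ_le) (use bound f(1) q_def in auto)
    then show ?thesis using K q_nonneg[of g] by (cases "q g = 0") (auto simp: power2_eq_square)
  qed
  then show ?thesis using that f(1) g rep unfolding q_def by blast
qed

section \<open>The one-dimensional problem\<close>

lemma nonneg_of_deriv_nonneg:
  fixes D D' :: "real \<Rightarrow> real"
  assumes "\<And>t. t > 0 \<Longrightarrow> (D has_real_derivative D' t) (at t)" "\<And>t. t > 0 \<Longrightarrow> D' t \<ge> 0"
    and "(D \<longlongrightarrow> 0) (at_right 0)" "t > 0"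
  shows "D t \<ge> 0"
proof (rule tendsto_upperbound[OF assms(3)])
  have "D s \<le> D t" if "0 < s" "s < t" for s
  proof (rule DERIV_nonneg_imp_nondecreasing[of s t])
    show "\<exists>y. (D has_real_derivative y) (at x) \<and> y \<ge> 0" if "s \<le> x" for x
      using assms(1,2)[of x] \<open>0 < s\<close> that by (intro exI[of _ "D' x"]) auto
  qed (use that in simp)
  then show "\<forall>\<^sub>F s in at_right 0. D s \<le> D t"
    using eventually_at_right_less[of "0::real"] \<open>t > 0\<close>
    by (auto simp: eventually_at_right_field intro!: exI[of _ t])
qed simp

text \<open>All that the one-dimensional analysis knows about hyperbolic volume.
  \<open>S_deriv\<close> is the chain rule through the radius,
  \<open>dS/dt = cosh / (n sg sinh ^ (n - 1))\<close>, with \<open>S / S ^ n\<close> standing for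
  the negative power.\<close>

locale volume_profile =
  fixes n :: nat and sg :: real and S :: "real \<Rightarrow> real"
  assumes n: "n \<ge> 4" and sg: "sg > 0"
    and S_pos: "t > 0 \<Longrightarrow> S t > 0"
    and S_deriv: "t > 0 \<Longrightarrow>
      (S has_real_derivative sqrt (1 + (S t)\<^sup>2) * S t / (real n * sg * S t ^ n)) (at t)"
    and S_0: "(S \<longlongrightarrow> 0) (at_right 0)"
begin

text \<open>\<open>S t\<close> and \<open>C t\<close> are the hyperbolic sine and cosine of the radius of the ball of volume \<open>t\<close> (\<open>sg\<close>
  is the volume of the Euclidean unit ball), and \<open>X\<close> is the square of the hyperbolic tangent. The
  Euclidean weight at volume \<open>t\<close> is \<open>k A\<close>; \<open>k1\<close> and \<open>k2\<close> are the derivatives of \<open>k\<close>.\<close>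

definition C where "C t = sqrt (1 + (S t)\<^sup>2)"
definition W where "W t = S t ^ n"
definition X where "X t = 1 - 1 / (C t)\<^sup>2"
text \<open>The logarithmic derivative \<open>t W' / W\<close>, which would be 1 in Euclidean space.
  It governs the ratio of the weights, since \<open>t k1 / k = 2 c (1 - Y)\<close>.\<close>

definition Y where "Y t = t * C t / (sg * W t)"
definition A where "A t = (real n * sg * W t / S t)\<^sup>2"
definition c where "c = (real n - 1) / real n"
definition k where "k t = (t / (sg * W t)) powr (2 * c)"
definition k1 where "k1 t = k t * (2 * c / t) * (1 - Y t)"
definition k2 where "k2 t = (2 * c * k t / t\<^sup>2) *
   (2 * c * (1 - Y t)\<^sup>2 - (1 - Y t) - Y t * (1 + X t * Y t / real n - Y t))"
definition \<kappa> where "\<kappa> = (real n - 1) ^ 4 / 16"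

lemma c_bounds: "c > 0" "c < 1" "c * real n = real n - 1"
  using n by (auto simp: c_def field_simps)

lemma C_sq: "(C t)\<^sup>2 = 1 + (S t)\<^sup>2"
  by (simp add: C_def add_nonneg_nonneg)

lemma C_ge_1: "C t \<ge> 1"
  by (simp add: C_def)

lemma W_pos: "t > 0 \<Longrightarrow> W t > 0"
  by (simp add: W_def S_pos)

lemma X_bounds: "0 \<le> X t" "X t < 1"
  using C_sq[of t] by (auto simp: X_def field_simps add_pos_nonneg)

lemma X_eq: "X t * (C t)\<^sup>2 = (S t)\<^sup>2"
proof -
  have "(C t)\<^sup>2 \<noteq> 0" using C_ge_1[of t] by simp
  then have "X t * (C t)\<^sup>2 = (C t)\<^sup>2 - 1" by (simp add: X_def left_diff_distrib)
  then show ?thesis by (simp add: C_sq)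
qed

lemma W_deriv: "t > 0 \<Longrightarrow> (W has_real_derivative C t / sg) (at t)"
proof -
  assume t: "t > 0"
  have "(W has_real_derivative
      real n * (C t * S t / (real n * sg * S t ^ n) * S t ^ (n - Suc 0))) (at t)"
    unfolding W_def using DERIV_power[OF S_deriv[OF t], of n] by (simp add: C_def)
  also have "S t ^ n = S t * S t ^ (n - Suc 0)" using n by (simp flip: power_Suc)
  also have "real n * (C t * S t / (real n * sg * (S t * S t ^ (n - Suc 0))) * S t ^ (n - Suc 0)) = C t / sg"
    using S_pos[OF t] sg n by (simp add: field_simps)
  finally show ?thesis .
qed

lemma C_deriv: "t > 0 \<Longrightarrow> (C has_real_derivative ((C t)\<^sup>2 - 1) / (real n * sg * W t)) (at t)"
proof -
  assume t: "t > 0"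
  have p: "1 + (S t)\<^sup>2 > 0" by (simp add: add_pos_nonneg)
  have Cp: "C t > 0" using C_ge_1[of t] by linarith
  have "((\<lambda>t. 1 + (S t)\<^sup>2) has_real_derivative
      0 + real 2 * (sqrt (1 + (S t)\<^sup>2) * S t / (real n * sg * S t ^ n) * S t ^ (2 - Suc 0))) (at t)"
    by (intro DERIV_add DERIV_const DERIV_power S_deriv t)
  then have "((\<lambda>t. 1 + (S t)\<^sup>2) has_real_derivative
      2 * (C t * (S t)\<^sup>2) / (real n * sg * W t)) (at t)"
    by (rule DERIV_cong) (simp add: C_def W_def power2_eq_square)
  from DERIV_chain2[OF DERIV_real_sqrt[OF p] this]
  have "(C has_real_derivative inverse (C t) / 2 * (2 * (C t * (S t)\<^sup>2) / (real n * sg * W t))) (at t)"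
    by (simp add: C_def[abs_def])
  then show ?thesis
    by (rule DERIV_cong) (use Cp in \<open>simp add: C_sq\<close>)
qed

lemma C_W_tendsto: "(C \<longlongrightarrow> 1) (at_right 0)" "(W \<longlongrightarrow> 0) (at_right 0)"
proof -
  have "(C \<longlongrightarrow> sqrt (1 + 0\<^sup>2)) (at_right 0)"
    unfolding C_def by (intro tendsto_intros S_0)
  then show "(C \<longlongrightarrow> 1) (at_right 0)" by simp
  have "(W \<longlongrightarrow> 0 ^ n) (at_right 0)"
    unfolding W_def by (intro tendsto_intros S_0)
  moreover have "(0::real) ^ n = 0" using n by simp
  ultimately show "(W \<longlongrightarrow> 0) (at_right 0)" by simp
qed

text \<open>For \<open>a = (n + 1) / (n + 2)\<close> the derivative of \<open>R a\<close> is at most \<open>1 / sg\<close>, for \<open>a = (n - 1) / n\<close> it is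
  at least \<open>1 / sg\<close>.\<close>

definition R where "R a t = W t * C t / (1 + a * ((C t)\<^sup>2 - 1))"

section \<open>Rational bounds of the enclosed volume\<close>

lemma R_deriv:
  assumes "t > 0" "a \<ge> 0" and s: "s = (S t)\<^sup>2"
  shows "(R a has_real_derivative
    ((1 + s + s / real n) * (1 + a * s) - 2 * a * (1 + s) * s / real n) / (sg * (1 + a * s)\<^sup>2))
    (at t)"
proof -
  have C: "(C t)\<^sup>2 = 1 + s" using C_sq s by simp
  have p: "1 + a * s > 0" using assms s by (intro add_pos_nonneg) auto
  have W: "W t > 0" using W_pos assms by simp
  have "(R a has_real_derivative
     ((C t / sg * C t + ((C t)\<^sup>2 - 1) / (real n * sg * W t) * W t) * (1 + a * ((C t)\<^sup>2 - 1))
       - W t * C t * (a * (2 * C t * (((C t)\<^sup>2 - 1) / (real n * sg * W t)))))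
     / ((1 + a * ((C t)\<^sup>2 - 1)) * (1 + a * ((C t)\<^sup>2 - 1)))) (at t)"
  proof -
    have "((\<lambda>t. 1 + a * ((C t)\<^sup>2 - 1)) has_real_derivative
        0 + a * (real 2 * (((C t)\<^sup>2 - 1) / (real n * sg * W t) * C t ^ (2 - Suc 0)) - 0)) (at t)"
      by (intro DERIV_add DERIV_const DERIV_cmult DERIV_diff DERIV_power C_deriv assms)
    then have "((\<lambda>t. 1 + a * ((C t)\<^sup>2 - 1)) has_real_derivative
        a * (2 * C t * (((C t)\<^sup>2 - 1) / (real n * sg * W t)))) (at t)"
      by (rule DERIV_cong) simp
    then show ?thesis
      unfolding R_def using p C
      by (intro DERIV_divide DERIV_mult W_deriv C_deriv assms) auto
  qed
  also have "(C t / sg * C t + ((C t)\<^sup>2 - 1) / (real n * sg * W t) * W t) = (1 + s + s / real n) / sg"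
    using C W sg n by (simp add: field_simps power2_eq_square)
  also have "W t * C t * (a * (2 * C t * (((C t)\<^sup>2 - 1) / (real n * sg * W t)))) =
      2 * a * (C t)\<^sup>2 * ((C t)\<^sup>2 - 1) / (real n * sg)"
    using W sg n by (simp add: field_simps power2_eq_square)
  also have "(((1 + s + s / real n) / sg) * (1 + a * ((C t)\<^sup>2 - 1)) -
      2 * a * (C t)\<^sup>2 * ((C t)\<^sup>2 - 1) / (real n * sg))
     / ((1 + a * ((C t)\<^sup>2 - 1)) * (1 + a * ((C t)\<^sup>2 - 1))) =
    ((1 + s + s / real n) * (1 + a * s) - 2 * a * (1 + s) * s / real n) / (sg * (1 + a * s)\<^sup>2)"
  proof -
    have quotient: "(p / sg * q - r / (real n * sg)) / (q * q) = (p * q - r / real n) / (sg * q\<^sup>2)"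
      if "q > 0" for p q r :: real
      using that sg n by (simp add: divide_simps power2_eq_square)
    show ?thesis
      unfolding C using quotient[OF p, of "1 + s + s / real n" "2 * a * (1 + s) * s"] by simp
  qed
  finally show ?thesis .
qed

lemma R_0: "(R a \<longlongrightarrow> 0) (at_right 0)"
proof -
  have "(R a \<longlongrightarrow> 0 * 1 / (1 + a * (1\<^sup>2 - 1))) (at_right 0)"
    unfolding R_def by (intro tendsto_intros C_W_tendsto) simp
  then show ?thesis by simp
qed

text \<open>The value \<open>(n + 1) / (n + 2)\<close> is the one for which the derivatives of
  \<open>R a\<close> and of \<open>t / sg\<close> agree to first order in
  \<open>s = S\<^sup>2\<close> at the origin. In the comparison of numerators the terms linear in
  \<open>s\<close> then cancel, and the quadratic ones are ordered by
  \<open>(n - 1) a \<le> n a\<^sup>2\<close>.\<close>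

lemma lower_bound: "R ((real n + 1) / (real n + 2)) t \<le> t / sg" if "t > 0"
proof -
  define a where "a = (real n + 1) / (real n + 2)"
  have a: "a \<ge> 0" "a * (real n + 2) = real n + 1" by (auto simp: a_def)
  define D' where "D' t = 1 / sg - ((1 + (S t)\<^sup>2 + (S t)\<^sup>2 / real n) * (1 + a * (S t)\<^sup>2)
     - 2 * a * (1 + (S t)\<^sup>2) * (S t)\<^sup>2 / real n) / (sg * (1 + a * (S t)\<^sup>2)\<^sup>2)" for t
  have "t / sg - R a t \<ge> 0"
  proof (rule nonneg_of_deriv_nonneg[of "\<lambda>t. t / sg - R a t" D'])
    show "((\<lambda>t. t / sg - R a t) has_real_derivative D' t) (at t)" if "t > 0" for t
      unfolding D'_def using that a(1)
      by (intro DERIV_diff DERIV_cdivide DERIV_ident R_deriv refl)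
    show "D' t \<ge> 0" if "t > 0" for t
    proof -
      define s where "s = (S t)\<^sup>2"
      have s: "s \<ge> 0" by (simp add: s_def)
      have p: "1 + a * s > 0" using s a by (intro add_pos_nonneg) auto
      have aa: "(real n - 1) * a \<le> real n * a * a"
      proof -
        have "real n - 1 \<le> real n * a"
          using n by (simp add: a_def field_simps)
        then show ?thesis using a(1) mult_right_mono by blast
      qed
      have "real n * ((1 + s + s / real n) * (1 + a * s) - 2 * a * (1 + s) * s / real n)
          = real n + (real n + 1 + real n * a - 2 * a) * s + (real n - 1) * a * s\<^sup>2"
        using n by (simp add: field_simps power2_eq_square)
      also have "\<dots> = real n + 2 * real n * a * s + (real n - 1) * a * s\<^sup>2"
      proof -
        have "real n + 1 + real n * a - 2 * a = 2 * real n * a" using a(2) by (simp add: algebra_simps)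
        then show ?thesis by simp
      qed
      also have "\<dots> \<le> real n + 2 * real n * a * s + real n * a * a * s\<^sup>2"
        by (intro add_left_mono mult_right_mono aa) simp
      also have "\<dots> = real n * (1 + a * s)\<^sup>2"
        by (simp add: power2_eq_square algebra_simps)
      finally have "(1 + s + s / real n) * (1 + a * s) - 2 * a * (1 + s) * s / real n \<le> (1 + a * s)\<^sup>2"
        using n by simp
      then show ?thesis
        unfolding D'_def s_def[symmetric] using p sg by (simp add: field_simps)
    qed
    have "((\<lambda>t. t / sg - R a t) \<longlongrightarrow> 0 / sg - 0) (at_right 0)"
      by (intro tendsto_intros R_0) (use sg in auto)
    then show "((\<lambda>t. t / sg - R a t) \<longlongrightarrow> 0) (at_right 0)" by simp
  qed fact
  then show ?thesis by (simp add: a_def)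
qed

text \<open>The counterpart of \<open>lower_bound\<close> at infinity: for
  \<open>a = (n - 1) / n\<close> the coefficients of \<open>s\<^sup>2\<close> agree instead, and the
  linear ones are ordered because \<open>a \<le> 1\<close>.\<close>

lemma upper_bound: "t / sg \<le> R ((real n - 1) / real n) t" if "t > 0"
proof -
  define a where "a = (real n - 1) / real n"
  have a: "a \<ge> 0" "a * real n = real n - 1" using n by (auto simp: a_def)
  define D' where "D' t = ((1 + (S t)\<^sup>2 + (S t)\<^sup>2 / real n) * (1 + a * (S t)\<^sup>2)
     - 2 * a * (1 + (S t)\<^sup>2) * (S t)\<^sup>2 / real n) / (sg * (1 + a * (S t)\<^sup>2)\<^sup>2) - 1 / sg" for t
  have "R a t - t / sg \<ge> 0"
  proof (rule nonneg_of_deriv_nonneg[of "\<lambda>t. R a t - t / sg" D'])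
    show "((\<lambda>t. R a t - t / sg) has_real_derivative D' t) (at t)" if "t > 0" for t
      unfolding D'_def using that a(1)
      by (intro DERIV_diff DERIV_cdivide DERIV_ident R_deriv refl)
    show "D' t \<ge> 0" if "t > 0" for t
    proof -
      define s where "s = (S t)\<^sup>2"
      have s: "s \<ge> 0" by (simp add: s_def)
      have p: "1 + a * s > 0" using s a by (intro add_pos_nonneg) auto
      have "real n * (1 + a * s)\<^sup>2 =
          real n + 2 * (real n * a) * s + (real n * a) * a * s\<^sup>2"
        by (simp add: power2_eq_square algebra_simps)
      also have "\<dots> \<le> real n + (real n + 1 + real n * a - 2 * a) * s + (real n - 1) * a * s\<^sup>2"
      proof -
        have "2 * a \<le> 2" using n by (simp add: a_def field_simps)
        then have "2 * (real n * a) \<le> real n + 1 + real n * a - 2 * a"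
          using a(2) by (simp add: algebra_simps)
        then have "2 * (real n * a) * s \<le> (real n + 1 + real n * a - 2 * a) * s"
          using s by (rule mult_right_mono)
        moreover have "real n * a = real n - 1" using a(2) by (simp add: mult.commute)
        ultimately show ?thesis by simp
      qed
      also have "\<dots> = real n * ((1 + s + s / real n) * (1 + a * s) - 2 * a * (1 + s) * s / real n)"
        using n by (simp add: field_simps power2_eq_square)
      finally have "(1 + a * s)\<^sup>2 \<le> (1 + s + s / real n) * (1 + a * s) - 2 * a * (1 + s) * s / real n"
        using n by simp
      moreover have "1 / sg \<le> z / (sg * q\<^sup>2)" if "q\<^sup>2 \<le> z" "q > 0" for z q
        using that sg by (simp add: field_simps)
      ultimately show ?thesis
        unfolding D'_def s_def[symmetric] using p by (simp only: diff_ge_0_iff_ge)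
    qed
    have "((\<lambda>t. R a t - t / sg) \<longlongrightarrow> 0 - 0 / sg) (at_right 0)"
      by (intro tendsto_intros R_0) (use sg in auto)
    then show "((\<lambda>t. R a t - t / sg) \<longlongrightarrow> 0) (at_right 0)" by simp
  qed fact
  then show ?thesis by (simp add: a_def)
qed

text \<open>Dividing \<open>1 + a s\<close> by \<open>C\<^sup>2 = 1 + s\<close> gives
  \<open>1 - (1 - a) X\<close>, and \<open>1 - a = 1 / (n + 2)\<close> for the constant of
  \<open>lower_bound\<close>. In the variables \<open>X\<close> and \<open>Y\<close> the bound
  becomes linear in each.\<close>

lemma Y_lower: "1 \<le> Y t * (1 - X t / (real n + 2))" if "t > 0"
proof -
  define s where "s = (S t)\<^sup>2"
  have C: "(C t)\<^sup>2 = 1 + s" using C_sq s_def by simp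
  have s: "s \<ge> 0" by (simp add: s_def)
  have p: "1 + (real n + 1) / (real n + 2) * s > 0" using s by (intro add_pos_nonneg) auto
  have Cp: "C t > 0" using C_ge_1[of t] by linarith
  have W: "W t > 0" using W_pos that by simp
  have X: "X t = s / (1 + s)" using s by (simp add: X_def C field_simps)
  have "1 - X t / (real n + 2) = (1 + (real n + 1) / (real n + 2) * s) / (C t)\<^sup>2"
  proof -
    have "1 - s / (1 + s) / q = (1 + (q - 1) / q * s) / (1 + s)" if "q > 0" for q
      using that s by (simp add: divide_simps; simp add: algebra_simps)
    from this[of "real n + 2"] show ?thesis unfolding X C by simp
  qed
  moreover have "W t * C t \<le> t / sg * (1 + (real n + 1) / (real n + 2) * s)"
    using lower_bound[OF that] p by (simp add: R_def C pos_divide_le_eq)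
  then have "W t * C t * C t \<le> t / sg * (1 + (real n + 1) / (real n + 2) * s) * C t"
    using Cp by (intro mult_right_mono) auto
  then have "1 \<le> t * C t / (sg * W t) * ((1 + (real n + 1) / (real n + 2) * s) / (C t)\<^sup>2)"
    using W Cp sg by (simp add: pos_le_divide_eq power2_eq_square mult_ac)
  ultimately show ?thesis by (simp add: Y_def)
qed

lemma Y_upper: "Y t * (1 - X t / real n) \<le> 1" if "t > 0"
proof -
  define s where "s = (S t)\<^sup>2"
  have C: "(C t)\<^sup>2 = 1 + s" using C_sq s_def by simp
  have s: "s \<ge> 0" by (simp add: s_def)
  have p: "1 + (real n - 1) / real n * s > 0" using s n by (intro add_pos_nonneg) auto
  have Cp: "C t > 0" using C_ge_1[of t] by linarith
  have W: "W t > 0" using W_pos that by simp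
  have X: "X t = s / (1 + s)" using s by (simp add: X_def C field_simps)
  have "1 - X t / real n = (1 + (real n - 1) / real n * s) / (C t)\<^sup>2"
  proof -
    have "1 - s / (1 + s) / q = (1 + (q - 1) / q * s) / (1 + s)" if "q > 0" for q
      using that s by (simp add: divide_simps; simp add: algebra_simps)
    from this[of "real n"] show ?thesis unfolding X C using n by simp
  qed
  moreover have "t / sg * (1 + (real n - 1) / real n * s) \<le> W t * C t"
    using upper_bound[OF that] p by (simp add: R_def C pos_le_divide_eq)
  then have "t / sg * (1 + (real n - 1) / real n * s) * C t \<le> W t * C t * C t"
    using Cp by (intro mult_right_mono) auto
  then have "t * C t / (sg * W t) * ((1 + (real n - 1) / real n * s) / (C t)\<^sup>2) \<le> 1"
    using W Cp sg by (simp add: pos_divide_le_eq power2_eq_square mult_ac)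
  ultimately show ?thesis by (simp add: Y_def)
qed

section \<open>The ratio of the two weights\<close>

lemma Y_pos: "t > 0 \<Longrightarrow> Y t > 0"
  using C_ge_1[of t] W_pos[of t] sg by (simp add: Y_def zero_less_divide_iff)

lemma Y_ge_1: "t > 0 \<Longrightarrow> Y t \<ge> 1"
proof -
  assume t: "t > 0"
  have "0 \<le> Y t * (X t / (real n + 2))" using Y_pos[OF t] X_bounds[of t] by simp
  then show ?thesis using Y_lower[OF t] by (simp add: algebra_simps)
qed

lemma cY_le_1: "t > 0 \<Longrightarrow> c * Y t \<le> 1"
proof -
  assume t: "t > 0"
  have "c \<le> 1 - X t / real n" using n X_bounds[of t] by (simp add: c_def field_simps)
  then have "c * Y t \<le> (1 - X t / real n) * Y t" using Y_pos[OF t] by (intro mult_right_mono) auto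
  then show ?thesis using Y_upper[OF t] by (simp add: mult.commute)
qed

lemma k_deriv: "t > 0 \<Longrightarrow> (k has_real_derivative k1 t) (at t)"
proof -
  assume t: "t > 0"
  note W = W_pos[OF t]
  have p: "t / (sg * W t) > 0" using t W sg by simp
  have "(k has_real_derivative (t / (sg * W t)) powr (2 * c) *
     (0 * ln (t / (sg * W t)) + (1 * (sg * W t) - t * (sg * (C t / sg))) / ((sg * W t) * (sg * W t)) * (2 * c) / (t / (sg * W t)))) (at t)"
    unfolding k_def using W sg
    by (intro DERIV_powr DERIV_divide DERIV_ident DERIV_cmult W_deriv t p) auto
  then show ?thesis
    by (rule DERIV_cong) (use t W sg in \<open>simp add: k1_def k_def Y_def field_simps\<close>)
qed

text \<open>The bracket collects the logarithmic derivatives of \<open>t\<close>, \<open>C\<close>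
  and \<open>W\<close>: here \<open>t C' / C = X Y / n\<close> and
  \<open>t W' / W = Y\<close>.\<close>

lemma Y_deriv: "t > 0 \<Longrightarrow> (Y has_real_derivative Y t / t * (1 + X t * Y t / real n - Y t)) (at t)"
proof -
  assume t: "t > 0"
  note W = W_pos[OF t]
  have Cp: "C t > 0" using C_ge_1[of t] by linarith
  have "(Y has_real_derivative ((1 * C t + ((C t)\<^sup>2 - 1) / (real n * sg * W t) * t) * (sg * W t)
      - t * C t * (sg * (C t / sg))) / ((sg * W t) * (sg * W t))) (at t)"
    unfolding Y_def using W sg
    by (intro DERIV_divide DERIV_mult DERIV_ident DERIV_cmult W_deriv C_deriv t) auto
  moreover have "((1 * C t + ((C t)\<^sup>2 - 1) / (real n * sg * W t) * t) * (sg * W t)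
      - t * C t * (sg * (C t / sg))) / ((sg * W t) * (sg * W t)) =
      Y t / t * (1 + X t * Y t / real n - Y t)"
    unfolding Y_def X_def using t W sg Cp n
    by (simp add: divide_simps; simp add: algebra_simps power2_eq_square)
  ultimately show ?thesis by (rule DERIV_cong)
qed

lemma k1_deriv: "t > 0 \<Longrightarrow> (k1 has_real_derivative k2 t) (at t)"
proof -
  assume t: "t > 0"
  have d: "((\<lambda>t. 2 * c / t) has_real_derivative - (2 * c) / (t * t)) (at t)"
    using DERIV_divide[OF DERIV_const DERIV_ident, of t "2 * c"] t by simp
  have "((\<lambda>t. k t * (2 * c / t) * (1 - Y t)) has_real_derivative
     (k1 t * (2 * c / t) + (- (2 * c) / (t * t)) * k t) * (1 - Y t)
      + (0 - Y t / t * (1 + X t * Y t / real n - Y t)) * (k t * (2 * c / t))) (at t)"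
    by (intro DERIV_mult DERIV_diff DERIV_const k_deriv Y_deriv d t)
  moreover have "(\<lambda>t. k t * (2 * c / t) * (1 - Y t)) = k1"
    by (simp add: k1_def fun_eq_iff)
  moreover have "(k1 t * (2 * c / t) + (- (2 * c) / (t * t)) * k t) * (1 - Y t)
      + (0 - Y t / t * (1 + X t * Y t / real n - Y t)) * (k t * (2 * c / t)) = k2 t"
    unfolding k1_def k2_def using t
    by (simp add: divide_simps; simp add: algebra_simps power2_eq_square)
  ultimately show ?thesis by simp
qed

lemma k_pos: "t > 0 \<Longrightarrow> k t > 0"
  using W_pos[of t] sg by (simp add: k_def)

lemma Y_tendsto: "(Y \<longlongrightarrow> 1) (at_right 0)"
proof (rule tendsto_sandwich)
  have ev: "\<forall>\<^sub>F t in at_right (0::real). t > 0" by (simp add: eventually_at_right_less)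
  show "\<forall>\<^sub>F t in at_right 0. 1 \<le> Y t" using ev by eventually_elim (rule Y_ge_1)
  have "Y t \<le> 1 / (1 - X t / real n)" if "t > 0" for t
  proof -
    have "X t / real n < 1" using X_bounds[of t] n by simp
    then show ?thesis using Y_upper[OF that] by (simp add: pos_le_divide_eq)
  qed
  then show "\<forall>\<^sub>F t in at_right 0. Y t \<le> 1 / (1 - X t / real n)" using ev by (auto elim: eventually_mono)
  have "((\<lambda>t. 1 / (1 - X t / real n)) \<longlongrightarrow> 1 / (1 - (1 - 1 / 1\<^sup>2) / real n)) (at_right 0)"
    unfolding X_def by (intro tendsto_intros C_W_tendsto) (use n in auto)
  then show "((\<lambda>t. 1 / (1 - X t / real n)) \<longlongrightarrow> 1) (at_right 0)" by simp
qed simp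

text \<open>The product \<open>k C\<close> tends to 1 at the origin and decreases: \<open>t\<close>
  times the derivative of its logarithm is \<open>X Y / n - 2 c (Y - 1)\<close>, and
  \<open>Y_lower\<close> bounds \<open>Y - 1\<close> below by \<open>X Y / (n + 2)\<close>. The sign
  is right once \<open>2 (n - 1) \<ge> n + 2\<close>, which is exactly \<open>n \<ge> 4\<close>. The
  factor \<open>C\<close> strengthens \<open>k \<le> 1\<close> to \<open>k_sq_le\<close>.\<close>

lemma k_C_le_1: "t > 0 \<Longrightarrow> k t * C t \<le> 1"
proof -
  assume t: "t > 0"
  have "1 - k t * C t \<ge> 0"
  proof (rule nonneg_of_deriv_nonneg[of "\<lambda>t. 1 - k t * C t"
      "\<lambda>t. k t * C t / t * (2 * c * (Y t - 1) - X t * Y t / real n)"])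
    fix t :: real assume t: "t > 0"
    have Cp: "C t > 0" using C_ge_1[of t] by linarith
    have "((\<lambda>t. 1 - k t * C t) has_real_derivative
        0 - (k1 t * C t + ((C t)\<^sup>2 - 1) / (real n * sg * W t) * k t)) (at t)"
      by (intro DERIV_diff DERIV_const DERIV_mult k_deriv C_deriv t)
    moreover have "0 - (k1 t * C t + ((C t)\<^sup>2 - 1) / (real n * sg * W t) * k t) =
        k t * C t / t * (2 * c * (Y t - 1) - X t * Y t / real n)"
    proof -
      have eq: "((C t)\<^sup>2 - 1) / (real n * sg * W t) = C t / t * (X t * Y t / real n)"
        unfolding X_def Y_def using t W_pos[OF t] sg Cp n
        by (simp add: divide_simps; simp add: algebra_simps power2_eq_square)
      show ?thesis
        unfolding eq k1_def using t n by (simp add: divide_simps; simp add: algebra_simps)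
    qed
    ultimately show "((\<lambda>t. 1 - k t * C t) has_real_derivative
        k t * C t / t * (2 * c * (Y t - 1) - X t * Y t / real n)) (at t)" by simp
    have "X t * Y t / real n \<le> 2 * c * (X t * Y t / (real n + 2))"
    proof -
      have "real n + 2 \<le> 2 * (c * real n)" using c_bounds(3) n by simp
      then have "1 / real n \<le> 2 * c / (real n + 2)" using n by (simp add: field_simps)
      then have "X t * Y t * (1 / real n) \<le> X t * Y t * (2 * c / (real n + 2))"
        using X_bounds[of t] Y_pos[OF t] by (intro mult_left_mono) auto
      then show ?thesis by (simp add: mult_ac)
    qed
    also have "\<dots> \<le> 2 * c * (Y t - 1)"
      using Y_lower[OF t] c_bounds by (intro mult_left_mono) (auto simp: algebra_simps)
    finally show "0 \<le> k t * C t / t * (2 * c * (Y t - 1) - X t * Y t / real n)"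
      using k_pos[OF t] Cp t by simp
  next
    have ev: "\<forall>\<^sub>F t in at_right (0::real). t > 0" by (simp add: eventually_at_right_less)
    have "((\<lambda>t. (Y t / C t) powr (2 * c)) \<longlongrightarrow> (1 / 1) powr (2 * c)) (at_right 0)"
      by (intro tendsto_intros Y_tendsto C_W_tendsto) auto
    \<comment> \<open>The quotient \<open>Y / C\<close> is \<open>t / (sg W)\<close>, so its limit
      at the origin follows from those of \<open>Y\<close> and \<open>C\<close>.\<close>
    moreover have "k = (\<lambda>t. (Y t / C t) powr (2 * c))"
    proof
      show "k t = (Y t / C t) powr (2 * c)" for t
        using C_ge_1[of t] by (simp add: k_def Y_def)
    qed
    ultimately have "(k \<longlongrightarrow> 1) (at_right 0)" by simp
    then have "((\<lambda>t. 1 - k t * C t) \<longlongrightarrow> 1 - 1 * 1) (at_right 0)"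
      by (intro tendsto_intros C_W_tendsto)
    then show "((\<lambda>t. 1 - k t * C t) \<longlongrightarrow> 0) (at_right 0)" by simp
  qed fact
  then show ?thesis by simp
qed

lemma k_le_1: "t > 0 \<Longrightarrow> k t \<le> 1"
proof -
  assume t: "t > 0"
  have "k t * 1 \<le> k t * C t" using k_pos[OF t] C_ge_1 by (intro mult_left_mono) auto
  then show ?thesis using k_C_le_1[OF t] by simp
qed

lemma k1_nonpos: "t > 0 \<Longrightarrow> k1 t \<le> 0"
  unfolding k1_def by (rule mult_nonneg_nonpos) (use k_pos[of t] Y_ge_1[of t] c_bounds in auto)

lemma k_sq_le: "t > 0 \<Longrightarrow> (k t)\<^sup>2 \<le> 1 - X t"
proof -
  assume t: "t > 0"
  have Cp: "C t > 0" using C_ge_1[of t] by linarith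
  have "(k t * C t)\<^sup>2 \<le> 1\<^sup>2"
    using k_C_le_1[OF t] k_pos[OF t] Cp by (intro power_mono) auto
  then show ?thesis using Cp by (simp add: X_def power_mult_distrib field_simps)
qed

lemma t_sq_A: "t > 0 \<Longrightarrow> (real n - 1)\<^sup>2 * t\<^sup>2 / A t = (c * Y t)\<^sup>2 * X t"
proof -
  assume t: "t > 0"
  have Cp: "C t > 0" using C_ge_1[of t] by linarith
  have "(c * Y t)\<^sup>2 * X t = c\<^sup>2 * (t / (sg * W t))\<^sup>2 * (X t * (C t)\<^sup>2)"
    by (simp add: Y_def power_mult_distrib power_divide)
  also have "\<dots> = (real n - 1)\<^sup>2 * t\<^sup>2 / A t"
    unfolding X_eq using W_pos[OF t] S_pos[OF t] sg n
    by (simp add: A_def c_def power_mult_distrib power_divide)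
  finally show ?thesis ..
qed

lemma A_pos: "t > 0 \<Longrightarrow> A t > 0"
  using W_pos[of t] S_pos[of t] sg n by (simp add: A_def)

text \<open>Since \<open>X < 1\<close>, this contains the quadratic growth of \<open>A\<close> that
  produces \<open>\<kappa>\<close>. The factor \<open>X\<close> keeps track of how much is gained at
  small volumes, and \<open>key_inequality\<close> spends that gain.\<close>

lemma A_lower: "t > 0 \<Longrightarrow> (real n - 1)\<^sup>2 * t\<^sup>2 / A t \<le> X t"
proof -
  assume t: "t > 0"
  have "(c * Y t)\<^sup>2 \<le> 1\<^sup>2"
    using cY_le_1[OF t] Y_pos[OF t] c_bounds by (intro power_mono) auto
  then have "(c * Y t)\<^sup>2 * X t \<le> 1 * X t" using X_bounds[of t] by (intro mult_right_mono) auto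
  then show ?thesis using t_sq_A[OF t] by simp
qed

text \<open>This is the sign of the coefficient that remains in \<open>lyap'_le\<close> after both
  Hardy squares are split off. The left side is at most \<open>X\<^sup>2\<close> by
  \<open>A_lower\<close>, and \<open>k\<^sup>2 \<le> 1 - X\<close> makes
  \<open>1 - X\<^sup>2\<close> at least \<open>k\<^sup>2 (1 + X)\<close>. What is left to show is
  that the derivatives of \<open>k\<close> cost at most \<open>k\<^sup>2 X\<close>; the cost turns
  out to be at most \<open>16 / ((n - 1) (n + 2))\<close> times this, a factor of 8/9 for
  \<open>n = 4\<close>.\<close>

lemma key_inequality:
  assumes t: "t > 0"
  shows "16 * \<kappa> * t ^ 4 / (A t)\<^sup>2 \<le> 1 - (k t)\<^sup>2 + 4 * k t * (t\<^sup>2 * k2 t + t * k1 t)"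
proof -
  define x y where "x = X t" and "y = Y t"
  have x: "0 \<le> x" "x < 1" using X_bounds x_def by auto
  have y: "y > 0" "y \<ge> 1" using Y_pos[OF t] Y_ge_1[OF t] y_def by auto
  \<comment> \<open>The bracket is \<open>- (t\<^sup>2 k2 + t k1) / (2 c k)\<close>, as
    \<open>K\<close> shows below.\<close>
  have Q: "8 * c * (x * y\<^sup>2 / real n + y * (1 - y) - 2 * c * (1 - y)\<^sup>2) \<le> x"
  proof -
    have "y * (1 - y) \<le> - (y * (y * x / (real n + 2)))"
    proof -
      have "1 - y \<le> - (y * x / (real n + 2))"
        using Y_lower[OF t] by (simp add: x_def y_def algebra_simps)
      then show ?thesis using y mult_left_mono[of "1 - y" "- (y * x / (real n + 2))" y] by simp
    qed
    moreover have "0 \<le> 2 * c * (1 - y)\<^sup>2" using c_bounds by simp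
    ultimately have "x * y\<^sup>2 / real n + y * (1 - y) - 2 * c * (1 - y)\<^sup>2
        \<le> x * y\<^sup>2 / real n - y * (y * x / (real n + 2))" by linarith
    also have "\<dots> = x * y\<^sup>2 * (2 / (real n * (real n + 2)))"
    proof -
      have "1 / real n - 1 / (real n + 2) = 2 / (real n * (real n + 2))"
        using n by (simp add: divide_simps)
      then have "x * y\<^sup>2 * (1 / real n - 1 / (real n + 2)) = x * y\<^sup>2 * (2 / (real n * (real n + 2)))"
        by simp
      then show ?thesis by (simp add: right_diff_distrib power2_eq_square mult_ac)
    qed
    finally have "8 * c * (x * y\<^sup>2 / real n + y * (1 - y) - 2 * c * (1 - y)\<^sup>2) \<le>
        8 * c * (x * y\<^sup>2 * (2 / (real n * (real n + 2))))"
      using c_bounds by (intro mult_left_mono) auto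
    also have "\<dots> = (c * y)\<^sup>2 * (x * (16 / (c * real n * (real n + 2))))"
      using c_bounds(1) n by (simp add: power2_eq_square divide_simps)
    also have "\<dots> \<le> 1\<^sup>2 * (x * 1)"
    proof (intro mult_mono power_mono)
      show "16 / (c * real n * (real n + 2)) \<le> 1"
      proof -
        have "(4 - 1) * (4 + 2) \<le> (real n - 1) * (real n + 2)" using n by (intro mult_mono) auto
        then show ?thesis using n unfolding c_bounds(3) by (simp add: divide_le_eq)
      qed
    qed (use x y c_bounds cY_le_1[OF t] n in \<open>auto simp: y_def\<close>)
    finally show ?thesis by simp
  qed
  have K: "4 * k t * (t\<^sup>2 * k2 t + t * k1 t) =
      - ((k t)\<^sup>2 * (8 * c * (x * y\<^sup>2 / real n + y * (1 - y) - 2 * c * (1 - y)\<^sup>2)))"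
  proof -
    have a: "t\<^sup>2 * k2 t = 2 * c * k t * (2 * c * (1 - y)\<^sup>2 - (1 - y) - y * (1 + x * y / real n - y))"
      using t by (simp add: k2_def x_def y_def)
    have b: "t * k1 t = 2 * c * k t * (1 - y)"
      using t by (simp add: k1_def y_def)
    show ?thesis unfolding a b by (simp add: algebra_simps power2_eq_square)
  qed
  have "16 * \<kappa> * t ^ 4 / (A t)\<^sup>2 = ((real n - 1)\<^sup>2 * t\<^sup>2 / A t)\<^sup>2"
    by (simp add: \<kappa>_def power_mult_distrib power_divide flip: power_mult)
  also have "\<dots> \<le> x\<^sup>2"
    unfolding x_def using A_lower[OF t] A_pos[OF t] by (intro power_mono) auto
  \<comment> \<open>Factored so that \<open>k_sq_le\<close> applies to \<open>1 - x\<close>.\<close>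
  also have "\<dots> = 1 - (1 - x) * (1 + x)" by (simp add: power2_eq_square algebra_simps)
  also have "\<dots> \<le> 1 - (k t)\<^sup>2 * (1 + x)"
    using k_sq_le[OF t] x by (intro diff_left_mono mult_right_mono) (auto simp: x_def)
  also have "\<dots> \<le> 1 - (k t)\<^sup>2 * (1 + 8 * c * (x * y\<^sup>2 / real n + y * (1 - y) - 2 * c * (1 - y)\<^sup>2))"
    using Q by (intro diff_left_mono mult_left_mono) auto
  also have "\<dots> = 1 - (k t)\<^sup>2 + 4 * k t * (t\<^sup>2 * k2 t + t * k1 t)"
    unfolding K by (simp add: distrib_left)
  finally show ?thesis .
qed

end

section \<open>Square-integrable functions on the half-line\<close>

text \<open>A measure on the whole line with no mass outside \<open>{0<..}\<close>, so that Borel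
  functions of a real variable need no restriction.\<close>

definition half_line :: "real measure" where
  "half_line = density lborel (\<lambda>t. ennreal (indicator {0<..} t))"

lemma sets_half_line [measurable_cong, simp]: "sets half_line = sets borel"
  and space_half_line [simp]: "space half_line = UNIV"
  by (auto simp: half_line_def)

lemma nn_integral_half_line:
  "f \<in> borel_measurable borel \<Longrightarrow>
    (\<integral>\<^sup>+t. f t \<partial>half_line) = (\<integral>\<^sup>+t. f t * indicator {0<..} t \<partial>lborel)"
  by (auto simp: half_line_def nn_integral_density mult.commute indicator_def intro!: nn_integral_cong)

lemma AE_half_line: "AE t in half_line. t > 0"
  unfolding half_line_def by (subst AE_density) (auto simp: indicator_def)

lemma half_line_integral_support:
  fixes p :: "real \<Rightarrow> real"
  assumes "0 < a" "continuous_on UNIV p" "\<And>t. t \<notin> {a..b} \<Longrightarrow> p t = 0"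
  shows "integrable half_line p" "(\<integral>t. p t \<partial>half_line) = integral {a..b} p"
proof -
  have p: "p \<in> borel_measurable borel" using assms(2) by (rule borel_measurable_continuous_onI)
  have set: "set_integrable lborel {a..b} p"
    by (rule borel_integrable_atLeastAtMost') (rule continuous_on_subset[OF assms(2)], simp)
  have eq: "indicator {0<..} t *\<^sub>R p t = indicator {a..b} t *\<^sub>R p t" for t
    using assms(1,3) by (auto simp: indicator_def)
  show "integrable half_line p"
    unfolding half_line_def using p set by (simp add: integrable_density eq set_integrable_def del: real_scaleR_def)
  have "(\<integral>t. p t \<partial>half_line) = (LINT t : {a..b} | lborel. p t)"
    unfolding half_line_def set_lebesgue_integral_def using p
    by (subst integral_density) (auto simp: eq simp del: real_scaleR_def)
  then show "(\<integral>t. p t \<partial>half_line) = integral {a..b} p"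
    using set_borel_integral_eq_integral(2)[OF set] by simp
qed

lemma nn_integral_half_line_le:
  assumes p: "p \<in> borel_measurable borel" "continuous_on {0<..} p" "\<And>t. t > 0 \<Longrightarrow> p t \<ge> 0"
    and le: "\<And>s T. 0 < s \<Longrightarrow> s < T \<Longrightarrow> integral {s..T} p \<le> K"
  shows "(\<integral>\<^sup>+t. ennreal (p t) \<partial>half_line) \<le> ennreal K"
proof -
  \<comment> \<open>With \<open>j + 2\<close> every interval is nondegenerate, as \<open>le\<close>
    demands; with \<open>j + 1\<close> the first one would be the point 1.\<close>
  define I where "I j = {1 / real (j + 2) .. real (j + 2)}" for j :: nat
  have I_pos: "0 < 1 / real (j + 2)" "1 / real (j + 2) < real (j + 2)" for j :: nat
  proof -
    have "1 / real (j + 2) < 1" by simp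
    also have "1 < real (j + 2)" by simp
    finally show "1 / real (j + 2) < real (j + 2)" .
  qed simp
  have I: "I j \<subseteq> {0<..}" for j
  proof
    fix t assume "t \<in> I j"
    then have "0 < 1 / real (j + 2)" "1 / real (j + 2) \<le> t" by (auto simp: I_def)
    then show "t \<in> {0<..}" unfolding greaterThan_iff by (rule less_le_trans)
  qed
  have I_mono: "I i \<subseteq> I j" if "i \<le> j" for i j
  proof -
    have "1 / real (j + 2) \<le> 1 / real (i + 2)" using that by (intro divide_left_mono) auto
    then show ?thesis using that unfolding I_def by (intro atLeastatMost_subset_iff[THEN iffD2]) simp
  qed
  have "(\<integral>\<^sup>+t. ennreal (p t) \<partial>half_line) = (\<integral>\<^sup>+t. ennreal (p t) * indicator {0<..} t \<partial>lborel)"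
    by (rule nn_integral_half_line) (use p in measurable)
  also have "\<dots> = (\<integral>\<^sup>+t. (SUP j. ennreal (p t) * indicator (I j) t) \<partial>lborel)"
  proof (rule nn_integral_cong)
    fix t :: real
    show "ennreal (p t) * indicator {0<..} t = (SUP j. ennreal (p t) * indicator (I j) t)"
    proof (cases "t > 0")
      case True
      obtain i where i: "1 / real (Suc i) < t" using nat_approx_posE[OF True] by blast
      obtain l where l: "t < real l" using reals_Archimedean2 by blast
      have "1 / real (i + l + 2) \<le> 1 / real (Suc i)" by (intro divide_left_mono) auto
      then have "t \<in> I (i + l)" using i l by (auto simp: I_def)
      then have "ennreal (p t) * indicator {0<..} t \<le> (SUP j. ennreal (p t) * indicator (I j) t)"
        using True by (intro SUP_upper2[of "i + l"]) auto
      moreover have "(SUP j. ennreal (p t) * indicator (I j) t) \<le> ennreal (p t) * indicator {0<..} t"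
        using True by (intro SUP_least) (auto simp: indicator_def)
      ultimately show ?thesis by (rule antisym)
    next
      case False
      then have "t \<notin> I j" for j using I by auto
      then show ?thesis using False by simp
    qed
  qed
  also have "\<dots> = (SUP j. \<integral>\<^sup>+t. ennreal (p t) * indicator (I j) t \<partial>lborel)"
  proof (rule nn_integral_monotone_convergence_SUP)
    show "incseq (\<lambda>j t. ennreal (p t) * indicator (I j) t)"
      using I_mono by (auto simp: incseq_def le_fun_def indicator_def)
    show "(\<lambda>t. ennreal (p t) * indicator (I j) t) \<in> borel_measurable lborel" for j
      unfolding I_def using p by measurable
  qed
  also have "\<dots> \<le> ennreal K"
  proof (rule SUP_least)
    fix j
    have "continuous_on (I j) p" using continuous_on_subset[OF p(2) I] .
    then have "(p has_integral (integral (I j) p)) (I j)"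
      unfolding I_def by (intro integrable_integral integrable_continuous_interval)
    then have "(\<integral>\<^sup>+t. ennreal (p t) * indicator (I j) t \<partial>lborel) = ennreal (integral (I j) p)"
      using I p(3) by (intro nn_integral_has_integral_lebesgue') auto
    also have "\<dots> \<le> ennreal K"
      unfolding I_def by (intro ennreal_leI le I_pos)
    finally show "(\<integral>\<^sup>+t. ennreal (p t) * indicator (I j) t \<partial>lborel) \<le> ennreal K" .
  qed
  finally show ?thesis .
qed

definition Cc_pos :: "(real \<Rightarrow> real) set" where
  "Cc_pos = {f. continuous_on UNIV f \<and> (\<exists>a b. 0 < a \<and> a \<le> b \<and> (\<forall>t. t \<notin> {a..b} \<longrightarrow> f t = 0))}"

lemma Cc_pos_borel: "f \<in> Cc_pos \<Longrightarrow> f \<in> borel_measurable borel"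
  by (auto simp: Cc_pos_def intro: borel_measurable_continuous_onI)

lemma Cc_pos_L2: "f \<in> Cc_pos \<Longrightarrow> f \<in> L2 half_line"
proof -
  assume f: "f \<in> Cc_pos"
  then obtain a b where "0 < a" "continuous_on UNIV f" "\<And>t. t \<notin> {a..b} \<Longrightarrow> f t = 0"
    by (auto simp: Cc_pos_def)
  then have "integrable half_line (\<lambda>t. (f t)\<^sup>2)"
    by (intro half_line_integral_support[of a _ b]) (auto intro!: continuous_intros)
  then show ?thesis using Cc_pos_borel[OF f] by (intro L2I) (auto simp: measurable_cong_sets[OF sets_half_line refl])
qed

lemma Cc_pos_lincomb:
  assumes "f \<in> Cc_pos" "g \<in> Cc_pos"
  shows "(\<lambda>t. f t + s * g t) \<in> Cc_pos"
proof -
  obtain a b where f: "0 < a" "a \<le> b" "continuous_on UNIV f" "\<And>t. t \<notin> {a..b} \<Longrightarrow> f t = 0"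
    using assms by (auto simp: Cc_pos_def)
  obtain a' b' where g: "0 < a'" "a' \<le> b'" "continuous_on UNIV g" "\<And>t. t \<notin> {a'..b'} \<Longrightarrow> g t = 0"
    using assms by (auto simp: Cc_pos_def)
  have "f t + s * g t = 0" if "t \<notin> {min a a'..max b b'}" for t
  proof -
    have "t \<notin> {a..b}" "t \<notin> {a'..b'}" using that by auto
    then show ?thesis using f(4) g(4) by simp
  qed
  moreover have "0 < min a a'" "min a a' \<le> max b b'" using f g by auto
  moreover have "continuous_on UNIV (\<lambda>t. f t + s * g t)" using f g by (intro continuous_intros)
  ultimately show ?thesis unfolding Cc_pos_def mem_Collect_eq by blast
qed

section \<open>Radial solutions\<close>

context volume_profile
begin

text \<open>\<open>P\<close> is the solution of \<open>(A P')' = f\<close> with \<open>F = A P'\<close> vanishing at \<open>0\<close> and \<open>P\<close> vanishing at infinity;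
  \<open>euclid f F\<close> is then the Euclidean Laplacian \<open>(k A P')' = (k F)'\<close>.\<close>

definition solution where
  "solution a b f F P \<longleftrightarrow> 0 < a \<and> a \<le> b \<and> continuous_on UNIV f \<and> (\<forall>t. t \<notin> {a..b} \<longrightarrow> f t = 0) \<and>
     (\<forall>t. (F has_real_derivative f t) (at t)) \<and> (\<forall>t\<le>a. F t = 0) \<and>
     (\<forall>t>0. (P has_real_derivative F t / A t) (at t)) \<and> (\<exists>p. \<forall>t\<le>a. P t = p) \<and>
     (\<exists>M. \<forall>t\<ge>b. \<bar>P t\<bar> \<le> M / t)"

definition euclid where
  "euclid f F t = (if t \<in> {0<..} then k t * f t + k1 t * F t else 0)"

lemma solutionD:
  assumes "solution a b f F P"
  shows "0 < a" "a \<le> b" "continuous_on UNIV f" "\<And>t. t \<notin> {a..b} \<Longrightarrow> f t = 0"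
    "\<And>t. (F has_real_derivative f t) (at t)" "\<And>t. t \<le> a \<Longrightarrow> F t = 0"
    "\<And>t. t > 0 \<Longrightarrow> (P has_real_derivative F t / A t) (at t)"
    "\<exists>p. \<forall>t\<le>a. P t = p" "\<exists>M. \<forall>t\<ge>b. \<bar>P t\<bar> \<le> M / t"
  using assms unfolding solution_def by blast+

lemma solution_diff:
  assumes "solution a b f F P" "solution a' b' f' F' P'"
  shows "solution (min a a') (max b b') (\<lambda>t. f t - f' t) (\<lambda>t. F t - F' t) (\<lambda>t. P t - P' t)"
proof -
  note s = solutionD[OF assms(1)] and s' = solutionD[OF assms(2)]
  have "\<exists>M. \<forall>t\<ge>max b b'. \<bar>P t - P' t\<bar> \<le> M / t"
  proof -
    obtain M where M: "\<forall>t\<ge>b. \<bar>P t\<bar> \<le> M / t" using s(9) ..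
    obtain M' where M': "\<forall>t\<ge>b'. \<bar>P' t\<bar> \<le> M' / t" using s'(9) ..
    have "\<bar>P t - P' t\<bar> \<le> (M + M') / t" if "t \<ge> max b b'" for t
      using M[rule_format, of t] M'[rule_format, of t] that by (simp add: add_divide_distrib)
    then show ?thesis by blast
  qed
  moreover have "\<exists>p. \<forall>t\<le>min a a'. P t - P' t = p"
  proof -
    obtain p where p: "\<forall>t\<le>a. P t = p" using s(8) ..
    obtain p' where p': "\<forall>t\<le>a'. P' t = p'" using s'(8) ..
    from p p' show ?thesis by (intro exI[of _ "p - p'"]) simp
  qed
  moreover have "f t - f' t = 0" if "t \<notin> {min a a'..max b b'}" for t
  proof -
    have "t \<notin> {a..b}" "t \<notin> {a'..b'}" using that by auto
    then show ?thesis using s(4) s'(4) by simp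
  qed
  moreover have "((\<lambda>t. P t - P' t) has_real_derivative (F t - F' t) / A t) (at t)" if "t > 0" for t
    using DERIV_diff[OF s(7) s'(7), of t] that by (simp add: diff_divide_distrib)
  moreover have "0 < min a a'" "min a a' \<le> max b b'" using s(1,2) s'(1,2) by auto
  moreover have "continuous_on UNIV (\<lambda>t. f t - f' t)" using s(3) s'(3) by (intro continuous_intros)
  moreover have "((\<lambda>t. F t - F' t) has_real_derivative f t - f' t) (at t)" for t
    by (intro DERIV_diff s(5) s'(5))
  moreover have "F t - F' t = 0" if "t \<le> min a a'" for t using s(6) s'(6) that by simp
  ultimately show ?thesis unfolding solution_def by blast
qed

lemma solution_continuous:
  assumes "solution a b f F P"
  shows "continuous_on UNIV f" "continuous_on UNIV F" "continuous_on UNIV P"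
proof -
  note s = solutionD[OF assms]
  show "continuous_on UNIV f" by (rule s(3))
  show "continuous_on UNIV F"
    by (intro continuous_at_imp_continuous_on ballI DERIV_isCont[OF s(5)])
  \<comment> \<open>The derivative of \<open>P\<close> is known only for positive arguments.
    Constancy up to \<open>a\<close> covers the rest of the line, and the two open sets
    overlap.\<close>
  have "continuous_on ({0<..} \<union> {..<a}) P"
  proof (rule continuous_on_open_Un)
    show "continuous_on {0<..} P"
      by (intro continuous_at_imp_continuous_on ballI DERIV_isCont[OF s(7)]) simp
    obtain p where p: "\<forall>t\<le>a. P t = p" using s(8) ..
    have "continuous_on {..<a} (\<lambda>_. p)" by simp
    then show "continuous_on {..<a} P" by (rule continuous_on_eq) (simp add: p)
  qed auto
  moreover have "{0<..} \<union> {..<a} = (UNIV :: real set)" using s(1) by auto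
  ultimately show "continuous_on UNIV P" by simp
qed

lemma k_continuous: "continuous_on {0<..} k" "continuous_on {0<..} k1"
  by (auto intro!: continuous_at_imp_continuous_on DERIV_isCont k_deriv k1_deriv)

lemma euclid_continuous:
  assumes "solution a b f F P" shows "continuous_on {0<..} (euclid f F)"
proof -
  note c = continuous_on_subset[OF solution_continuous(1)[OF assms], of "{0<..}"]
    continuous_on_subset[OF solution_continuous(2)[OF assms], of "{0<..}"]
  have "continuous_on {0<..} (\<lambda>t. k t * f t + k1 t * F t)"
    by (intro continuous_intros k_continuous c) auto
  then show ?thesis by (rule continuous_on_eq) (simp add: euclid_def)
qed

lemma euclid_borel:
  assumes "solution a b f F P" shows "euclid f F \<in> borel_measurable borel"
proof -
  note c = continuous_on_subset[OF solution_continuous(1)[OF assms], of "{0<..}"]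
    continuous_on_subset[OF solution_continuous(2)[OF assms], of "{0<..}"]
  show ?thesis
    unfolding euclid_def
    by (intro borel_measurable_continuous_on_if continuous_intros k_continuous c) auto
qed

text \<open>The boundary term left by the two integrations by parts.\<close>

definition lyap where
  "lyap F P t = ((1 - (k t)\<^sup>2) / (2 * t) - k t * k1 t) * (F t)\<^sup>2 - 2 * \<kappa> * (t * (P t)\<^sup>2)"

text \<open>Kept in the shape in which the quotient and product rules deliver the derivative of
  \<open>lyap\<close>; it is simplified only in \<open>lyap'_le\<close>.\<close>

definition lyap' where
  "lyap' f F P t = ((- (2 * (k1 t * k t)) * (2 * t) - (1 - (k t)\<^sup>2) * 2) / ((2 * t) * (2 * t))
       - (k1 t * k1 t + k2 t * k t)) * (F t)\<^sup>2
     + (2 * (f t * F t)) * ((1 - (k t)\<^sup>2) / (2 * t) - k t * k1 t)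
     - 2 * \<kappa> * ((P t)\<^sup>2 + 2 * (F t / A t * P t) * t)"

lemma lyap_deriv:
  assumes "solution a b f F P" "t > 0"
  shows "(lyap F P has_real_derivative lyap' f F P t) (at t)"
proof -
  note F = solutionD(5)[OF assms(1), of t] and P = solutionD(7)[OF assms]
  have sq: "((\<lambda>t. (g t)\<^sup>2) has_real_derivative 2 * (g' * g t)) (at t)"
    if "(g has_real_derivative g') (at t)" for g g'
    using DERIV_power[OF that, of 2] by (rule DERIV_cong) simp
  have two: "((\<lambda>t. 2 * t) has_real_derivative 2) (at t)"
    using DERIV_cmult_Id[of "2::real" t UNIV] by simp
  have "((\<lambda>t. 1 - (k t)\<^sup>2) has_real_derivative - (2 * (k1 t * k t))) (at t)"
    using DERIV_diff[OF DERIV_const sq[OF k_deriv[OF assms(2)]], of 1] by simp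
  note D1 = DERIV_divide[OF this two]
  have tP: "((\<lambda>t. t * (P t)\<^sup>2) has_real_derivative (P t)\<^sup>2 + 2 * (F t / A t * P t) * t) (at t)"
    using DERIV_mult[OF DERIV_ident sq[OF P]] by (rule DERIV_cong) simp
  have D2: "((\<lambda>t. (1 - (k t)\<^sup>2) / (2 * t) - k t * k1 t) has_real_derivative
     ((- (2 * (k1 t * k t)) * (2 * t) - (1 - (k t)\<^sup>2) * 2) / ((2 * t) * (2 * t))
       - (k1 t * k1 t + k2 t * k t))) (at t)"
    by (intro DERIV_diff DERIV_mult k_deriv k1_deriv assms(2) D1) (use assms(2) in simp)
  show ?thesis
    unfolding lyap_def lyap'_def
    by (intro DERIV_diff DERIV_mult D2 DERIV_cmult tP sq[OF F])
qed

text \<open>With \<open>\<phi> = F / (2 t)\<close> the defect is a sum of three terms: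
  \<open>(1 - k\<^sup>2) (f - \<phi>)\<^sup>2\<close>, the square behind the Hardy inequality for
  \<open>F\<close>; \<open>\<kappa> (P + 2 t P')\<^sup>2\<close>, the one behind the Hardy
  inequality for \<open>P\<close>, where \<open>2 t P' = 4 t z \<phi>\<close>; and a multiple of
  \<open>\<phi>\<^sup>2\<close> whose coefficient is nonnegative by
  \<open>key_inequality\<close>.\<close>

lemma lyap'_le:
  assumes "t > 0"
  shows "lyap' f F P t \<le> (f t)\<^sup>2 - ((euclid f F t)\<^sup>2 + \<kappa> * (P t)\<^sup>2)"
proof -
  define \<phi> where "\<phi> = F t / (2 * t)"
  have F: "F t = 2 * t * \<phi>" using assms by (simp add: \<phi>_def)
  define z where "z = t / A t"
  have k2: "(1 - (k t)\<^sup>2) \<ge> 0" using k_le_1[OF assms] k_pos[OF assms] by (simp add: abs_square_le_1 abs_le_iff)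
  have *: "16 * \<kappa> * (t * z)\<^sup>2 \<le> 1 - (k t)\<^sup>2 + 4 * k t * (t\<^sup>2 * k2 t + t * k1 t)"
    using key_inequality[OF assms] by (simp add: z_def power_mult_distrib power_divide power2_eq_square power4_eq_xxxx)
  have L: "lyap' f F P t = (- 4 * t * k1 t * k t - 2 * (1 - (k t)\<^sup>2) - 4 * t\<^sup>2 * ((k1 t)\<^sup>2 + k2 t * k t)) * \<phi>\<^sup>2
     + 2 * f t * \<phi> * ((1 - (k t)\<^sup>2) - 2 * t * (k t * k1 t))
     - 2 * \<kappa> * ((P t)\<^sup>2 + 4 * t * z * \<phi> * P t)"
    unfolding lyap'_def F z_def using assms
    by (simp add: divide_simps power2_eq_square; simp add: algebra_simps)
  have "(f t)\<^sup>2 - ((euclid f F t)\<^sup>2 + \<kappa> * (P t)\<^sup>2) - lyap' f F P t =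
      (1 - (k t)\<^sup>2) * (f t - \<phi>)\<^sup>2 + \<kappa> * (P t + 4 * t * z * \<phi>)\<^sup>2 +
      (1 - (k t)\<^sup>2 + 4 * k t * (t\<^sup>2 * k2 t + t * k1 t) - 16 * \<kappa> * (t * z)\<^sup>2) * \<phi>\<^sup>2"
  proof -
    have e: "euclid f F t = k t * f t + k1 t * (2 * t * \<phi>)" using assms by (simp add: euclid_def F)
    show ?thesis unfolding L e by (simp add: algebra_simps power2_eq_square)
  qed
  moreover have "0 \<le> (1 - (k t)\<^sup>2) * (f t - \<phi>)\<^sup>2" using k2 by simp
  moreover have "0 \<le> \<kappa> * (P t + 4 * t * z * \<phi>)\<^sup>2" by (simp add: \<kappa>_def)
  moreover have "0 \<le> (1 - (k t)\<^sup>2 + 4 * k t * (t\<^sup>2 * k2 t + t * k1 t) - 16 * \<kappa> * (t * z)\<^sup>2) * \<phi>\<^sup>2"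
    using * by (intro mult_nonneg_nonneg) auto
  ultimately show ?thesis by linarith
qed

end

text \<open>The base point \<open>c\<close> may lie on either side of \<open>x\<close>, so the
  compact interval of the fundamental theorem is chosen to contain \<open>c\<close> together with a
  neighbourhood of \<open>x\<close>.\<close>

lemma LBINT_has_derivative:
  fixes f :: "real \<Rightarrow> real"
  assumes I: "open I" "\<And>x y. x \<in> I \<Longrightarrow> y \<in> I \<Longrightarrow> {x..y} \<subseteq> I" and f: "continuous_on I f"
    and c: "c \<in> I" and x: "x \<in> I"
  shows "((\<lambda>u. LBINT y=ereal c..ereal u. f y) has_real_derivative f x) (at x)"
proof -
  obtain e where e: "e > 0" "cball x e \<subseteq> I" using I(1) x open_contains_cball by blast
  then have xe: "x - e \<in> I" "x + e \<in> I" by (auto simp: subset_iff dist_real_def)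
  define a b where "a = min c (x - e)" and "b = max c (x + e)"
  have "a \<in> I" "b \<in> I" using xe c by (auto simp: a_def b_def min_def max_def)
  then have "continuous_on {a..b} f" using f I(2) continuous_on_subset by blast
  then have "((\<lambda>u. LBINT y=ereal c..ereal u. f y) has_vector_derivative f x) (at x within {a..b})"
    using e(1) by (intro interval_integral_FTC2) (auto simp: a_def b_def)
  moreover have "at x within {a..b} = at x"
    using e(1) by (intro at_within_Icc_at) (auto simp: a_def b_def)
  ultimately show ?thesis by (simp add: has_real_derivative_iff_has_vector_derivative)
qed

lemma const_of_deriv_zero:
  fixes F :: "real \<Rightarrow> real"
  assumes "\<And>x. (F has_real_derivative F' x) (at x)" "s \<le> t" "\<And>x. s < x \<Longrightarrow> x < t \<Longrightarrow> F' x = 0"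
  shows "F t = F s"
proof (cases "s = t")
  case False
  have "continuous_on {s..t} F"
    by (intro continuous_at_imp_continuous_on ballI DERIV_isCont[OF assms(1)])
  then show ?thesis
    using False assms(1)[of x for x] assms(2,3) by (intro DERIV_isconst_end) (simp, simp, metis)
qed simp

lemma Cc_pos_mult_continuous:
  assumes f: "f \<in> Cc_pos" and g: "continuous_on {0<..} g"
  shows "continuous_on UNIV (\<lambda>t. g t * f t)"
proof -
  obtain a b where ab: "0 < a" "continuous_on UNIV f" "\<And>t. t \<notin> {a..b} \<Longrightarrow> f t = 0"
    using f by (auto simp: Cc_pos_def)
  have "continuous_on ({0<..} \<union> {..<a}) (\<lambda>t. g t * f t)"
  proof (rule continuous_on_open_Un)
    show "continuous_on {0<..} (\<lambda>t. g t * f t)"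
      by (intro continuous_on_mult g continuous_on_subset[OF ab(2)]) simp
    have "continuous_on {..<a} (\<lambda>_. 0 :: real)" by simp
    then show "continuous_on {..<a} (\<lambda>t. g t * f t)"
      by (rule continuous_on_eq) (use ab(3) in simp)
  qed auto
  moreover have "{0<..} \<union> {..<a} = (UNIV :: real set)" using ab(1) by auto
  ultimately show ?thesis by simp
qed

lemma le_divide_imp_nonpos:
  fixes I K :: real
  assumes "\<And>T. T \<ge> b \<Longrightarrow> I \<le> K / T"
  shows "I \<le> 0"
proof (rule tendsto_lowerbound)
  show "((\<lambda>T. K / T) \<longlongrightarrow> 0) at_top" by (intro tendsto_divide_0[OF tendsto_const] filterlim_at_top_imp_at_infinity filterlim_ident)
  show "\<forall>\<^sub>F T in at_top. I \<le> K / T"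
    using eventually_ge_at_top[of b] by eventually_elim (rule assms)
qed simp

text \<open>A trapezoid: 1 on \<open>[2 / (m + 1), m + 1]\<close> and 0 outside
  \<open>[1 / (m + 1), m + 2]\<close>. It brings solutions, which have no compact support in the
  open half-line, into \<open>Cc_pos\<close>.\<close>

definition cutoff where
  "cutoff m t = max 0 (min 1 (min (real (Suc m) * t - 1) (real (Suc m) + 1 - t)))"

lemma cutoff_bounds: "0 \<le> cutoff m t" "cutoff m t \<le> 1"
  by (auto simp: cutoff_def)

lemma cutoff_Cc_pos:
  assumes "continuous_on UNIV g"
  shows "(\<lambda>t. cutoff m t * g t) \<in> Cc_pos"
proof -
  have "continuous_on UNIV (\<lambda>t. cutoff m t * g t)"
    unfolding cutoff_def by (intro continuous_intros assms)
  moreover have "cutoff m t * g t = 0" if "t \<notin> {1 / real (Suc m)..real (Suc m) + 1}" for t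
  proof -
    have "real (Suc m) * t - 1 \<le> 0 \<or> real (Suc m) + 1 - t \<le> 0"
      using that by (auto simp: field_simps)
    then show ?thesis by (auto simp: cutoff_def max_def min_def)
  qed
  moreover have "1 / real (Suc m) \<le> real (Suc m) + 1"
    by (rule order_trans[of _ 1]) simp_all
  moreover have "0 < 1 / real (Suc m)" by simp
  ultimately show ?thesis unfolding Cc_pos_def by blast
qed

lemma cutoff_tendsto: "t > 0 \<Longrightarrow> (\<lambda>m. cutoff m t) \<longlonglongrightarrow> 1"
proof -
  assume t: "t > 0"
  obtain i where i: "2 < real i * t" using ex_less_of_nat_mult[OF t] by blast
  obtain l where l: "t < real l" using reals_Archimedean2 by blast
  have "cutoff m t = 1" if "m \<ge> i + l" for m
  proof -
    have "real i * t \<le> real (Suc m) * t" using that t by (intro mult_right_mono) auto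
    then have "real (Suc m) * t - 1 \<ge> 1" using i by linarith
    moreover have "real (Suc m) + 1 - t \<ge> 1" using l that by simp
    ultimately show ?thesis by (simp add: cutoff_def)
  qed
  then have "\<forall>\<^sub>F m in sequentially. cutoff m t = 1" by (auto simp: eventually_sequentially)
  then show ?thesis by (rule tendsto_eventually)
qed

context volume_profile
begin

section \<open>The energy inequality for solutions\<close>

lemma \<kappa>_pos: "\<kappa> > 0"
  using n by (simp add: \<kappa>_def)

lemma lyap_le_0:
  assumes "solution a b f F P" "0 < t" "t \<le> a"
  shows "lyap F P t \<le> 0"
  using solutionD(6)[OF assms(1,3)] assms(2) \<kappa>_pos by (simp add: lyap_def)

lemma lyap_ge:
  assumes "t > 0" shows "lyap F P t \<ge> - 2 * \<kappa> * t * (P t)\<^sup>2"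
proof -
  have "(k t)\<^sup>2 \<le> 1" using k_le_1[OF assms] k_pos[OF assms] by (simp add: abs_square_le_1)
  then have "0 \<le> (1 - (k t)\<^sup>2) / (2 * t)" using assms by simp
  moreover have "k t * k1 t \<le> 0"
    by (rule mult_nonneg_nonpos) (use k_pos[OF assms] k1_nonpos[OF assms] in auto)
  ultimately have "0 \<le> ((1 - (k t)\<^sup>2) / (2 * t) - k t * k1 t) * (F t)\<^sup>2" by simp
  then show ?thesis by (simp add: lyap_def)
qed

text \<open>The bound \<open>lyap'_le\<close> is integrated from \<open>s'\<close> to
  \<open>T'\<close>. At \<open>s' \<le> a\<close> the function \<open>F\<close> vanishes and
  \<open>lyap\<close> is nonpositive; at \<open>T'\<close> it is at least
  \<open>- 2 \<kappa> M\<^sup>2 / T'\<close> because \<open>P\<close> decays like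
  \<open>1 / t\<close>. Letting \<open>T'\<close> grow removes both boundary terms.\<close>

lemma energy_interval:
  assumes sol: "solution a b f F P" and s: "0 < s" "s < T"
  shows "integral {s..T} (\<lambda>t. (euclid f F t)\<^sup>2 + \<kappa> * (P t)\<^sup>2) \<le> (\<integral>t. (f t)\<^sup>2 \<partial>half_line)"
proof -
  define p where "p t = (euclid f F t)\<^sup>2 + \<kappa> * (P t)\<^sup>2" for t
  note c = solution_continuous[OF sol]
  have p_cont: "continuous_on {0<..} p"
    unfolding p_def by (intro continuous_intros euclid_continuous[OF sol] continuous_on_subset[OF c(3)]) auto
  have p_int: "p integrable_on {s..T}" if "0 < s" for s T
    using that by (intro integrable_continuous_interval continuous_on_subset[OF p_cont]) auto
  have p_nonneg: "p t \<ge> 0" for t using \<kappa>_pos by (simp add: p_def)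
  obtain M where M: "\<forall>t\<ge>b. \<bar>P t\<bar> \<le> M / t" using solutionD(9)[OF sol] ..
  define K where "K = (\<integral>t. (f t)\<^sup>2 \<partial>half_line)"
  have "integral {s..T} p - K \<le> 2 * \<kappa> * M\<^sup>2 / T'" if T': "T' \<ge> max b T" for T'
  proof -
    \<comment> \<open>Lowered to at most \<open>a\<close>, so that the interval starts where
      \<open>F\<close> is still 0 and contains the support of \<open>f\<close>.\<close>
    define s' where "s' = min s a"
    have s': "0 < s'" "s' \<le> a" "s' \<le> s" using s solutionD(1)[OF sol] by (auto simp: s'_def)
    have T'': "T \<le> T'" "b \<le> T'" "0 < T'" "s' \<le> T'" using T' s s' by auto
    have "((lyap' f F P) has_integral (lyap F P T' - lyap F P s')) {s'..T'}"
      using s' T'' by (intro fundamental_theorem_of_calculus)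
        (auto simp flip: has_real_derivative_iff_has_vector_derivative
              intro!: has_field_derivative_at_within lyap_deriv[OF sol])
    moreover have "((\<lambda>t. (f t)\<^sup>2 - p t) has_integral
        (integral {s'..T'} (\<lambda>t. (f t)\<^sup>2) - integral {s'..T'} p)) {s'..T'}"
      by (intro has_integral_diff integrable_integral p_int s' integrable_continuous_interval
          continuous_intros continuous_on_subset[OF c(1)]) auto
    ultimately have "lyap F P T' - lyap F P s' \<le> integral {s'..T'} (\<lambda>t. (f t)\<^sup>2) - integral {s'..T'} p"
    proof (rule has_integral_le)
      fix t assume "t \<in> {s'..T'}"
      then show "lyap' f F P t \<le> (f t)\<^sup>2 - p t"
        using lyap'_le[of t f F P] s' by (simp add: p_def)
    qed
    moreover have "integral {s'..T'} (\<lambda>t. (f t)\<^sup>2) = K"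
      unfolding K_def
      by (rule half_line_integral_support(2)[symmetric])
         (use s' T'' solutionD(4)[OF sol] in \<open>auto intro!: continuous_intros c\<close>)
    moreover have "integral {s..T} p \<le> integral {s'..T'} p"
      by (rule integral_subset_le) (use s' T'' s p_nonneg in \<open>auto intro!: p_int\<close>)
    moreover have "lyap F P s' \<le> 0" by (rule lyap_le_0[OF sol s'(1,2)])
    moreover have "lyap F P T' \<ge> - (2 * \<kappa> * M\<^sup>2 / T')"
    proof -
      have "\<bar>P T'\<bar>\<^sup>2 \<le> (M / T')\<^sup>2" using M T'' by (intro power_mono) auto
      then have "2 * \<kappa> * T' * (P T')\<^sup>2 \<le> 2 * \<kappa> * T' * (M / T')\<^sup>2"
        using \<kappa>_pos T'' by (intro mult_left_mono) auto
      also have "\<dots> = 2 * \<kappa> * M\<^sup>2 / T'" using T'' by (simp add: power2_eq_square)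
      finally show ?thesis using lyap_ge[OF T''(3), where F = F and P = P] by simp
    qed
    ultimately show ?thesis by linarith
  qed
  then have "integral {s..T} p - K \<le> 0" by (rule le_divide_imp_nonpos)
  moreover have "p = (\<lambda>t. (euclid f F t)\<^sup>2 + \<kappa> * (P t)\<^sup>2)" by (simp add: p_def fun_eq_iff)
  ultimately show ?thesis by (simp add: K_def)
qed

text \<open>Square-integrability of \<open>P\<close> and of its Euclidean Laplacian is itself a
  consequence of the inequality on intervals, since both terms are nonnegative and
  \<open>\<kappa> > 0\<close>.\<close>

lemma solution_energy:
  assumes sol: "solution a b f F P"
  shows "euclid f F \<in> L2 half_line" "P \<in> L2 half_line"
    "(\<integral>t. (euclid f F t)\<^sup>2 \<partial>half_line) + \<kappa> * (\<integral>t. (P t)\<^sup>2 \<partial>half_line) \<le> (\<integral>t. (f t)\<^sup>2 \<partial>half_line)"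
proof -
  define K where "K = (\<integral>t. (f t)\<^sup>2 \<partial>half_line)"
  have K: "K \<ge> 0" by (simp add: K_def)
  note c = solution_continuous[OF sol]
  have [measurable]: "P \<in> borel_measurable borel" using c(3) by (rule borel_measurable_continuous_onI)
  have [measurable]: "euclid f F \<in> borel_measurable borel" by (rule euclid_borel[OF sol])
  have *: "(\<integral>\<^sup>+t. ennreal ((euclid f F t)\<^sup>2 + \<kappa> * (P t)\<^sup>2) \<partial>half_line) \<le> ennreal K"
  proof (rule nn_integral_half_line_le)
    show "continuous_on {0<..} (\<lambda>t. (euclid f F t)\<^sup>2 + \<kappa> * (P t)\<^sup>2)"
      by (intro continuous_intros euclid_continuous[OF sol] continuous_on_subset[OF c(3)]) auto
  qed (use energy_interval[OF sol] \<kappa>_pos in \<open>auto simp: K_def\<close>)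
  have "(\<integral>\<^sup>+t. ennreal ((euclid f F t)\<^sup>2) \<partial>half_line) \<le> ennreal K"
    by (rule order_trans[OF nn_integral_mono *]) (use \<kappa>_pos in \<open>auto intro!: ennreal_leI\<close>)
  then show 1: "euclid f F \<in> L2 half_line"
    by (intro L2_nn_integral) (auto intro: le_less_trans simp: measurable_cong_sets[OF sets_half_line refl])
  have "(\<integral>\<^sup>+t. ennreal ((sqrt \<kappa> * P t)\<^sup>2) \<partial>half_line) \<le> ennreal K"
    by (rule order_trans[OF nn_integral_mono *])
       (use \<kappa>_pos in \<open>auto intro!: ennreal_leI simp: power_mult_distrib\<close>)
  then have "(\<lambda>t. sqrt \<kappa> * P t) \<in> L2 half_line"
    by (intro L2_nn_integral) (auto intro: le_less_trans simp: measurable_cong_sets[OF sets_half_line refl])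
  from L2_cmult[OF this, of "1 / sqrt \<kappa>"] show 2: "P \<in> L2 half_line"
    using \<kappa>_pos by simp
  have int: "integrable half_line (\<lambda>t. (euclid f F t)\<^sup>2 + \<kappa> * (P t)\<^sup>2)"
    using 1 2 by (auto simp: L2_def)
  have "ennreal (\<integral>t. (euclid f F t)\<^sup>2 + \<kappa> * (P t)\<^sup>2 \<partial>half_line) \<le> ennreal K"
    using * \<kappa>_pos by (subst (asm) nn_integral_eq_integral[OF int]) auto
  then have "(\<integral>t. (euclid f F t)\<^sup>2 + \<kappa> * (P t)\<^sup>2 \<partial>half_line) \<le> K"
    using K by (simp add: ennreal_le_iff)
  then show "(\<integral>t. (euclid f F t)\<^sup>2 \<partial>half_line) + \<kappa> * (\<integral>t. (P t)\<^sup>2 \<partial>half_line) \<le> (\<integral>t. (f t)\<^sup>2 \<partial>half_line)"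
    using 1 2 by (simp add: K_def L2_def)
qed

section \<open>Symmetry and existence of solutions\<close>

lemma solution_Cc_pos: "solution a b f F P \<Longrightarrow> f \<in> Cc_pos"
  unfolding Cc_pos_def solution_def by blast

text \<open>The operator is symmetric: in the derivative of the Wronskian
  \<open>D = P F' - F P'\<close> the terms with \<open>1 / A\<close> cancel. \<open>D\<close>
  vanishes near the origin, and beyond both supports \<open>F\<close> and \<open>F'\<close> are
  constant while \<open>P\<close> and \<open>P'\<close> are \<open>O(1 / t)\<close>, so there is no
  contribution from infinity.\<close>

lemma solution_symmetric:
  assumes "solution a b f F P" "solution a' b' f' F' P'"
  shows "(\<integral>t. P t * f' t \<partial>half_line) = (\<integral>t. f t * P' t \<partial>half_line)"
proof -
  note s = solutionD[OF assms(1)] and s' = solutionD[OF assms(2)]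
  note c = solution_continuous[OF assms(1)] and c' = solution_continuous[OF assms(2)]
  define D where "D t = P t * F' t - F t * P' t" for t
  define q where "q t = P t * f' t - f t * P' t" for t
  define a0 b0 where "a0 = min a a'" and "b0 = max b b'"
  have a0: "0 < a0" "a0 \<le> a" "a0 \<le> a'" using s s' by (auto simp: a0_def)
  have D: "(D has_real_derivative q t) (at t)" if t: "t > 0" for t
  proof -
    have "(D has_real_derivative (F t / A t * F' t + f' t * P t) - (f t * P' t + F' t / A t * F t)) (at t)"
      unfolding D_def by (intro DERIV_diff DERIV_mult s(5) s(7) s'(5) s'(7) t)
    then show ?thesis by (rule DERIV_cong) (simp add: q_def)
  qed
  obtain M where M: "\<forall>t\<ge>b. \<bar>P t\<bar> \<le> M / t" using s(9) ..
  obtain M' where M': "\<forall>t\<ge>b'. \<bar>P' t\<bar> \<le> M' / t" using s'(9) ..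
  define I where "I = (\<integral>t. q t \<partial>half_line)"
  have "\<bar>I\<bar> \<le> (M * \<bar>F' b'\<bar> + \<bar>F b\<bar> * M') / T" if T: "T \<ge> b0" for T
  proof -
    have T': "T \<ge> b" "T \<ge> b'" "T > 0" "a0 \<le> T" using T s(1,2) a0 by (auto simp: b0_def)
    have "(q has_integral (D T - D a0)) {a0..T}"
      using a0 T' by (intro fundamental_theorem_of_calculus)
        (auto simp flip: has_real_derivative_iff_has_vector_derivative
              intro!: has_field_derivative_at_within D)
    moreover have "D a0 = 0" using s(6) s'(6) a0 by (simp add: D_def)
    ultimately have "integral {a0..T} q = D T" by (simp add: integral_unique)
    moreover have "I = integral {a0..T} q"
      unfolding I_def
    proof (rule half_line_integral_support(2)[OF a0(1)])
      show "continuous_on UNIV q" unfolding q_def by (intro continuous_intros c c')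
      fix t assume "t \<notin> {a0..T}"
      then have "t \<notin> {a..b}" "t \<notin> {a'..b'}" using a0 T' by auto
      then show "q t = 0" by (simp add: q_def s(4) s'(4))
    qed
    moreover have "F T = F b" by (rule const_of_deriv_zero[OF s(5) T'(1)]) (use s(4) in auto)
    moreover have "F' T = F' b'" by (rule const_of_deriv_zero[OF s'(5) T'(2)]) (use s'(4) in auto)
    ultimately have I: "\<bar>I\<bar> \<le> \<bar>P T\<bar> * \<bar>F' b'\<bar> + \<bar>F b\<bar> * \<bar>P' T\<bar>"
      using abs_triangle_ineq4[of "P T * F' b'" "F b * P' T"] by (simp add: D_def abs_mult)
    also have "\<dots> \<le> M / T * \<bar>F' b'\<bar> + \<bar>F b\<bar> * (M' / T)"
      using M M' T' by (intro add_mono mult_left_mono mult_right_mono) auto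
    also have "\<dots> = (M * \<bar>F' b'\<bar> + \<bar>F b\<bar> * M') / T" by (simp add: add_divide_distrib)
    finally show ?thesis .
  qed
  then have "\<bar>I\<bar> \<le> 0" by (rule le_divide_imp_nonpos)
  then have "I = 0" by simp
  moreover have "integrable half_line (\<lambda>t. P t * f' t)"
    by (intro L2_integrable_mult solution_energy(2)[OF assms(1)] Cc_pos_L2 solution_Cc_pos[OF assms(2)])
  moreover have "integrable half_line (\<lambda>t. f t * P' t)"
    by (intro L2_integrable_mult solution_energy(2)[OF assms(2)] Cc_pos_L2 solution_Cc_pos[OF assms(1)])
  ultimately show ?thesis by (simp add: I_def q_def)
qed

text \<open>\<open>E t\<close> is the integral of \<open>1 / A\<close> from \<open>t\<close> to
  infinity, finite because \<open>1 / A t \<le> M / t\<^sup>2\<close>. It is obtained without an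
  improper integral: \<open>e\<close> increases, \<open>e + M / t\<close> decreases, and
  \<open>L\<close> is their common limit.\<close>

lemma Green_potential_exists:
  obtains E where "\<And>t. t > 0 \<Longrightarrow> (E has_real_derivative - (1 / A t)) (at t)"
    "\<And>t. t > 0 \<Longrightarrow> 0 \<le> E t" "\<And>t. t > 0 \<Longrightarrow> E t \<le> 1 / (real n - 1)\<^sup>2 / t"
proof -
  define M where "M = 1 / (real n - 1)\<^sup>2"
  have bound: "1 / A t \<le> M / t\<^sup>2" if "t > 0" for t
  proof -
    have "(real n - 1)\<^sup>2 * t\<^sup>2 / A t \<le> 1" using A_lower[OF that] X_bounds[of t] by simp
    then show ?thesis using that n A_pos[OF that] by (simp add: M_def field_simps)
  qed
  have "continuous_on {0<..} S"
    by (intro continuous_at_imp_continuous_on ballI DERIV_isCont[OF S_deriv]) simp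
  then have cont: "continuous_on {0<..} (\<lambda>t. 1 / A t)"
    unfolding A_def W_def using n sg S_pos by (intro continuous_intros) (auto simp: less_imp_neq[THEN not_sym])
  define e where "e u = (LBINT y=ereal 1..ereal u. 1 / A y)" for u
  have e: "(e has_real_derivative 1 / A t) (at t)" if "t > 0" for t
    unfolding e_def by (rule LBINT_has_derivative[of "{0<..}"]) (use that cont in auto)
  have e_mono: "e s \<le> e t" if "0 < s" "s \<le> t" for s t
  proof (rule DERIV_nonneg_imp_nondecreasing[OF that(2)])
    fix x assume "s \<le> x"
    then have "x > 0" using that by simp
    then show "\<exists>y. (e has_real_derivative y) (at x) \<and> 0 \<le> y"
      using e[of x] A_pos[of x] by (intro exI[of _ "1 / A x"]) auto
  qed
  have eM: "e t + M / t \<le> e s + M / s" if "0 < s" "s \<le> t" for s t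
  proof (rule DERIV_nonpos_imp_nonincreasing[OF that(2)])
    fix x assume "s \<le> x"
    then have x: "x > 0" using that by simp
    have "((\<lambda>t. M / t) has_real_derivative - (M / x\<^sup>2)) (at x)"
      using DERIV_divide[OF DERIV_const DERIV_ident, of x M] x by (simp add: power2_eq_square)
    from DERIV_add[OF e[OF x] this]
    show "\<exists>y. ((\<lambda>t. e t + M / t) has_real_derivative y) (at x) \<and> y \<le> 0"
      using bound[OF x] by (intro exI[of _ "1 / A x + - (M / x\<^sup>2)"]) simp
  qed
  have M0: "M \<ge> 0" by (simp add: M_def)
  have cross: "e s \<le> e t + M / t" if "0 < s" "0 < t" for s t
  proof -
    have "e s \<le> e (max s t)" using that by (intro e_mono) auto
    also have "\<dots> \<le> e (max s t) + M / max s t" using that M0 by simp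
    also have "\<dots> \<le> e t + M / t" using that by (intro eM) auto
    finally show ?thesis .
  qed
  define L where "L = Inf ((\<lambda>t. e t + M / t) ` {0<..})"
  have L: "e t \<le> L" "L \<le> e t + M / t" if "t > 0" for t
  proof -
    show "e t \<le> L" unfolding L_def by (rule cInf_greatest) (use cross that in auto)
    show "L \<le> e t + M / t" unfolding L_def
      by (rule cInf_lower) (use cross[OF that] that in \<open>auto intro!: bdd_belowI2[of _ "e t"]\<close>)
  qed
  show ?thesis
  proof (rule that[of "\<lambda>t. L - e t"])
    fix t :: real assume t: "t > 0"
    show "((\<lambda>t. L - e t) has_real_derivative - (1 / A t)) (at t)"
      using DERIV_diff[OF DERIV_const e[OF t], of L] by simp
    show "0 \<le> L - e t" "L - e t \<le> 1 / (real n - 1)\<^sup>2 / t" using L[OF t] by (auto simp: M_def)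
  qed
qed

text \<open>Variation of constants with the Green function \<open>- E (max s t)\<close>: the part of
  \<open>f\<close> beyond \<open>t\<close> enters through \<open>J\<close>, the part before
  \<open>t\<close> through \<open>E F\<close>. Beyond the support only \<open>- E t * F b\<close>
  remains, which inherits the decay of \<open>E\<close>.\<close>

lemma solution_exists:
  assumes f: "f \<in> Cc_pos"
  obtains a b F P where "solution a b f F P"
proof -
  obtain a0 b0 where ab: "0 < a0" "a0 \<le> b0" "continuous_on UNIV f" "\<And>t. t \<notin> {a0..b0} \<Longrightarrow> f t = 0"
    using f by (auto simp: Cc_pos_def)
  \<comment> \<open>Widened so that \<open>f\<close> vanishes on the closed half-lines up to
    \<open>a\<close> and from \<open>b\<close> on.\<close>
  define a b where "a = a0 / 2" and "b = b0 + 1"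
  have a: "0 < a" "a < a0" "b0 < b" "a \<le> b" using ab by (auto simp: a_def b_def)
  have f0: "f t = 0" if "t \<le> a \<or> t \<ge> b" for t using ab(4)[of t] that a by auto
  obtain E where E: "\<And>t. t > 0 \<Longrightarrow> (E has_real_derivative - (1 / A t)) (at t)"
    "\<And>t. t > 0 \<Longrightarrow> 0 \<le> E t" "\<And>t. t > 0 \<Longrightarrow> E t \<le> 1 / (real n - 1)\<^sup>2 / t"
    using Green_potential_exists by blast
  have "continuous_on {0<..} E"
    by (intro continuous_at_imp_continuous_on ballI DERIV_isCont[OF E(1)]) simp
  from Cc_pos_mult_continuous[OF f this]
  have Ef: "continuous_on UNIV (\<lambda>t. E t * f t)" .
  define F J where "F u = (LBINT y=ereal a..ereal u. f y)"
    and "J u = (LBINT y=ereal b..ereal u. E y * f y)" for u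
  have F: "(F has_real_derivative f t) (at t)" for t
    unfolding F_def by (rule LBINT_has_derivative[of UNIV]) (use ab in auto)
  have J: "(J has_real_derivative E t * f t) (at t)" for t
    unfolding J_def by (rule LBINT_has_derivative[of UNIV]) (use Ef in auto)
  have [simp]: "F a = 0" "J b = 0" by (auto simp: F_def J_def)
  have F_0: "F t = 0" if "t \<le> a" for t
    using const_of_deriv_zero[OF F that] f0 by simp
  have J_0: "J t = 0" if "t \<ge> b" for t
    using const_of_deriv_zero[OF J that] f0 by simp
  have J_a: "J t = J a" if "t \<le> a" for t
    using const_of_deriv_zero[OF J that] f0 by simp
  have F_b: "F t = F b" if "t \<ge> b" for t
    using const_of_deriv_zero[OF F that] f0 by simp
  define P where "P t = J t - E t * F t" for t
  have "solution a b f F P"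
    unfolding solution_def
  proof (intro conjI allI impI)
    show "(P has_real_derivative F t / A t) (at t)" if "t > 0" for t
      using DERIV_diff[OF J DERIV_mult[OF E(1)[OF that] F]]
      unfolding P_def by (rule DERIV_cong) (simp add: algebra_simps)
    have "P t = J a" if "t \<le> a" for t
      unfolding P_def J_a[OF that] F_0[OF that] by simp
    then show "\<exists>p. \<forall>t\<le>a. P t = p" by blast
    have "\<bar>P t\<bar> \<le> (1 / (real n - 1)\<^sup>2 * \<bar>F b\<bar>) / t" if "t \<ge> b" for t
    proof -
      have t: "t > 0" using that a by simp
      have "\<bar>P t\<bar> = E t * \<bar>F b\<bar>"
        unfolding P_def F_b[OF that] J_0[OF that] using E(2)[OF t] by (simp add: abs_mult)
      also have "\<dots> \<le> (1 / (real n - 1)\<^sup>2 / t) * \<bar>F b\<bar>"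
        using E(3)[OF t] by (intro mult_right_mono) auto
      finally show ?thesis by simp
    qed
    then show "\<exists>M. \<forall>t\<ge>b. \<bar>P t\<bar> \<le> M / t" by blast
    show "f t = 0" if "t \<notin> {a..b}" for t using f0 that by auto
  qed (fact a ab(3) F | rule F_0, assumption)+
  then show ?thesis by (rule that)
qed

end

section \<open>Volumes of balls\<close>

lemma distr_eq_of_lessThan:
  fixes N :: "real measure"
  assumes T: "T \<in> borel_measurable M" and N: "sets N = sets borel"
    and eq: "\<And>a. emeasure M {x \<in> space M. T x < a} = emeasure N {..<a}"
    and fin: "\<And>a. emeasure N {..<a} \<noteq> \<infinity>"
  shows "distr M borel T = N"
proof (rule measure_eqI_generator_eq[where E = "range lessThan" and \<Omega> = UNIV and A = "\<lambda>i. {..<real i}"])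
  have "{..<a} \<inter> {..<b} = {..<min a b}" for a b :: real by auto
  then show "Int_stable (range lessThan :: real set set)"
    by (auto simp: Int_stable_def)
  show "sets (distr M borel T) = sigma_sets UNIV (range lessThan)"
    by (simp add: borel_Iio sets_measure_of)
  then show "sets N = sigma_sets UNIV (range lessThan)" using N by simp
  have e: "emeasure (distr M borel T) {..<a} = emeasure N {..<a}" for a
    using T by (subst emeasure_distr) (auto simp: eq[symmetric] vimage_def Int_def conj_commute)
  then show "emeasure (distr M borel T) X = emeasure N X" if "X \<in> range lessThan" for X
    using that by auto
  show "(\<Union>i. {..<real i}) = UNIV" using reals_Archimedean2 by auto
  show "emeasure (distr M borel T) {..<real i} \<noteq> \<infinity>" for i using e fin by simp
qed auto

lemma emeasure_half_line_lessThan: "emeasure half_line {..<a} = ennreal a"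
proof -
  have "emeasure half_line {..<a} = (\<integral>\<^sup>+t. indicator {..<a} t \<partial>half_line)" by simp
  also have "\<dots> = (\<integral>\<^sup>+t. indicator {..<a} t * indicator {0<..} t \<partial>lborel)"
    by (rule nn_integral_half_line) simp
  also have "\<dots> = (\<integral>\<^sup>+t. indicator {0<..<a} t \<partial>lborel)"
    by (intro nn_integral_cong) (auto simp: indicator_def)
  also have "\<dots> = ennreal a"
    by (cases "a \<ge> 0") (auto simp: ennreal_neg)
  finally show ?thesis .
qed

lemma distr_eq_half_line:
  assumes T: "T \<in> borel_measurable M"
    and eq: "\<And>a. emeasure M {x \<in> space M. T x < a} = ennreal a"
  shows "distr M borel T = half_line"
  by (rule distr_eq_of_lessThan[OF T]) (auto simp: eq emeasure_half_line_lessThan)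

section \<open>Hyperbolic volume as a function of the Euclidean radius\<close>

definition hyp_density :: "nat \<Rightarrow> real \<Rightarrow> real \<Rightarrow> real" where
  "hyp_density n sg r = real n * sg * r ^ (n - 1) * (2 / (1 - r\<^sup>2)) ^ n"

definition hyp_vol :: "nat \<Rightarrow> real \<Rightarrow> real \<Rightarrow> real" where
  "hyp_vol n sg s = integral {0..s} (hyp_density n sg)"

lemma power2_less_1: "0 \<le> r \<Longrightarrow> r < 1 \<Longrightarrow> r\<^sup>2 < (1::real)"
  by (simp add: abs_square_less_1)

lemma hyp_density_continuous: "s < 1 \<Longrightarrow> continuous_on {0..s} (hyp_density n sg)"
  unfolding hyp_density_def
  by (intro continuous_intros) (use power2_less_1 in force)+

lemma hyp_density_pos: "0 < n \<Longrightarrow> 0 < sg \<Longrightarrow> 0 < r \<Longrightarrow> r < 1 \<Longrightarrow> hyp_density n sg r > 0"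
  unfolding hyp_density_def using power2_less_1[of r] by (intro mult_pos_pos zero_less_power divide_pos_pos) auto

lemma hyp_vol_0 [simp]: "hyp_vol n sg 0 = 0"
  by (simp add: hyp_vol_def)

lemma hyp_vol_deriv:
  assumes "0 < s" "s < 1"
  shows "(hyp_vol n sg has_real_derivative hyp_density n sg s) (at s)"
proof -
  define b where "b = (1 + s) / 2"
  have b: "s < b" "b < 1" using assms by (auto simp: b_def)
  have "(hyp_vol n sg has_real_derivative hyp_density n sg s) (at s within {0..b})"
    unfolding hyp_vol_def
    by (rule integral_has_real_derivative[OF hyp_density_continuous]) (use assms b in auto)
  moreover have "at s within {0..b} = at s"
    using assms b by (intro at_within_Icc_at) auto
  ultimately show ?thesis by simp
qed

lemma hyp_vol_continuous: "continuous_on {0..<1} (hyp_vol n sg)"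
proof (clarsimp simp: continuous_on_eq_continuous_within)
  fix s :: real assume s: "0 \<le> s" "s < 1"
  define b where "b = (1 + s) / 2"
  have b: "s < b" "b < 1" using s by (auto simp: b_def)
  have "(hyp_vol n sg has_real_derivative hyp_density n sg s) (at s within {0..b})"
    unfolding hyp_vol_def
    by (rule integral_has_real_derivative[OF hyp_density_continuous]) (use s b in auto)
  then have "continuous (at s within {0..b}) (hyp_vol n sg)"
    by (rule DERIV_continuous)
  moreover have "at s within {0..b} = at s within {0..<1}"
    by (rule at_within_nhd[of s "{..<b}"]) (use s b in auto)
  ultimately show "continuous (at s within {0..<1}) (hyp_vol n sg)" by simp
qed

lemma hyp_vol_less:
  assumes "0 < n" "0 < sg" "0 \<le> r" "r < s" "s < 1"
  shows "hyp_vol n sg r < hyp_vol n sg s"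
proof (rule DERIV_pos_imp_increasing_open[OF \<open>r < s\<close>])
  show "\<exists>y. (hyp_vol n sg has_real_derivative y) (at x) \<and> 0 < y" if "r < x" "x < s" for x
    using hyp_vol_deriv[of x n sg] hyp_density_pos[of n sg x] that assms by auto
  show "continuous_on {r..s} (hyp_vol n sg)"
    by (rule continuous_on_subset[OF hyp_vol_continuous]) (use assms in auto)
qed

lemma hyp_vol_less_iff:
  assumes "0 < n" "0 < sg" "0 \<le> r" "r < 1" "0 \<le> s" "s < 1"
  shows "hyp_vol n sg r < hyp_vol n sg s \<longleftrightarrow> r < s"
  using hyp_vol_less[of n sg r s] hyp_vol_less[of n sg s r] assms
  by (metis linorder_neqE_linordered_idom order_less_asym)

text \<open>Volume is unbounded near the boundary of the model:
  \<open>2 / (1 - x\<^sup>2) \<ge> 1 / (1 - x) \<ge> 1\<close> and \<open>n \<ge> 2\<close> put the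
  density above \<open>c0 / (1 - x)\<^sup>2\<close> on the right half of the interval. The
  antiderivative is \<open>c0 / (1 - s)\<close>, and the subtracted 2 is the value of
  \<open>1 / (1 - s)\<close> at the starting point 1/2.\<close>

lemma hyp_vol_lower:
  assumes "2 \<le> n" "0 < sg" "1 / 2 \<le> s" "s < 1"
  shows "real n * sg * (1 / 2) ^ (n - 1) * (1 / (1 - s) - 2) \<le> hyp_vol n sg s"
proof -
  define c0 where "c0 = real n * sg * (1 / 2) ^ (n - 1)"
  have c0: "c0 > 0" using assms by (simp add: c0_def)
  have "hyp_vol n sg (1/2) - c0 * (1 / (1 - 1/2)) \<le> hyp_vol n sg s - c0 * (1 / (1 - s))"
  proof (rule DERIV_nonneg_imp_nondecreasing[OF assms(3)])
    fix x :: real assume x: "1 / 2 \<le> x" "x \<le> s"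
    then have x1: "0 < x" "x < 1" using assms by auto
    have sq: "x\<^sup>2 < 1" using x1 by (intro power2_less_1) auto
    have "((\<lambda>s. 1 / (1 - s)) has_real_derivative 1 / (1 - x)\<^sup>2) (at x)"
      using DERIV_divide[OF DERIV_const DERIV_diff[OF DERIV_const DERIV_ident], of 1 x 1] x1
      by (simp add: power2_eq_square)
    then have D: "((\<lambda>s. hyp_vol n sg s - c0 * (1 / (1 - s))) has_real_derivative
        hyp_density n sg x - c0 * (1 / (1 - x)\<^sup>2)) (at x)"
      by (intro DERIV_diff DERIV_cmult hyp_vol_deriv x1)
    have p: "1 / (1 - x) \<le> 2 / (1 - x\<^sup>2)"
    proof -
      have "x * 2 \<le> 1 + x * x"
        using zero_le_power2[of "1 - x"] by (simp add: power2_eq_square algebra_simps)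
      then show ?thesis using x1 sq by (simp add: field_simps power2_eq_square)
    qed
    have "1 \<le> 1 / (1 - x)" using x1 by simp
    with p have p1: "1 \<le> 2 / (1 - x\<^sup>2)" by linarith
    have "(1 / (1 - x))\<^sup>2 \<le> (2 / (1 - x\<^sup>2))\<^sup>2" using p x1 by (intro power_mono) auto
    also have "\<dots> \<le> (2 / (1 - x\<^sup>2)) ^ n" by (rule power_increasing[OF assms(1) p1])
    finally have "c0 * (1 / (1 - x)\<^sup>2) \<le> c0 * (2 / (1 - x\<^sup>2)) ^ n"
      using c0 by (intro mult_left_mono) (auto simp: power_divide)
    also have "\<dots> \<le> hyp_density n sg x"
      unfolding hyp_density_def c0_def using x assms sq
      by (intro mult_right_mono mult_left_mono power_mono) auto
    finally show "\<exists>y. ((\<lambda>s. hyp_vol n sg s - c0 * (1 / (1 - s))) has_real_derivative y) (at x) \<and> 0 \<le> y"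
      using D by (intro exI[of _ "hyp_density n sg x - c0 * (1 / (1 - x)\<^sup>2)"]) simp
  qed
  moreover have "0 \<le> hyp_vol n sg (1/2)"
    using hyp_vol_less[of n sg 0 "1/2"] assms by simp
  ultimately show ?thesis by (simp add: c0_def right_diff_distrib)
qed

lemma hyp_vol_surj:
  assumes "2 \<le> n" "0 < sg" "0 \<le> t"
  obtains s where "0 \<le> s" "s < 1" "hyp_vol n sg s = t"
proof -
  define c0 where "c0 = real n * sg * (1 / 2) ^ (n - 1)"
  have c0: "c0 > 0" using assms by (simp add: c0_def)
  \<comment> \<open>Chosen so that the bound of \<open>hyp_vol_lower\<close> at
    \<open>s1 = 1 - 1 / w\<close> is exactly \<open>t\<close>.\<close>
  define w where "w = t / c0 + 2"
  define s1 where "s1 = 1 - 1 / w"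
  have q: "w \<ge> 2" using assms c0 by (simp add: w_def)
  then have "1 / w \<le> 1 / 2" by (intro divide_left_mono) auto
  then have s1: "1 / 2 \<le> s1" "s1 < 1" using q by (auto simp: s1_def)
  have "t = c0 * (w - 2)" using c0 by (simp add: w_def)
  also have "\<dots> = c0 * (1 / (1 - s1) - 2)" by (simp add: s1_def)
  also have "\<dots> \<le> hyp_vol n sg s1"
    unfolding c0_def using s1 assms by (intro hyp_vol_lower) auto
  finally have "\<exists>s\<ge>0. s \<le> s1 \<and> hyp_vol n sg s = t"
    using assms s1 by (intro IVT') (auto intro!: continuous_on_subset[OF hyp_vol_continuous])
  then show ?thesis using that s1 by force
qed

definition hyp_rad :: "nat \<Rightarrow> real \<Rightarrow> real \<Rightarrow> real" where
  "hyp_rad n sg t = (SOME s. 0 \<le> s \<and> s < 1 \<and> hyp_vol n sg s = t)"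

lemma hyp_rad:
  assumes "2 \<le> n" "0 < sg" "0 \<le> t"
  shows "0 \<le> hyp_rad n sg t" "hyp_rad n sg t < 1" "hyp_vol n sg (hyp_rad n sg t) = t"
proof -
  have "\<exists>s. 0 \<le> s \<and> s < 1 \<and> hyp_vol n sg s = t"
    using hyp_vol_surj[OF assms] by blast
  from someI_ex[OF this]
  show "0 \<le> hyp_rad n sg t" "hyp_rad n sg t < 1" "hyp_vol n sg (hyp_rad n sg t) = t"
    unfolding hyp_rad_def by blast+
qed

lemma hyp_vol_nonneg:
  assumes "0 < n" "0 < sg" "0 \<le> s" "s < 1"
  shows "hyp_vol n sg s \<ge> 0"
  using hyp_vol_less[of n sg 0 s] assms by (cases "s = 0") auto

lemma hyp_rad_vol:
  assumes "2 \<le> n" "0 < sg" "0 \<le> s" "s < 1"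
  shows "hyp_rad n sg (hyp_vol n sg s) = s"
proof -
  have v: "0 \<le> hyp_vol n sg s" using hyp_vol_nonneg assms by simp
  note r = hyp_rad[OF assms(1,2) v]
  show ?thesis
    using hyp_vol_less_iff[of n sg "hyp_rad n sg (hyp_vol n sg s)" s]
      hyp_vol_less_iff[of n sg s "hyp_rad n sg (hyp_vol n sg s)"] r assms by auto
qed

lemma hyp_rad_pos: "2 \<le> n \<Longrightarrow> 0 < sg \<Longrightarrow> 0 < t \<Longrightarrow> 0 < hyp_rad n sg t"
  using hyp_rad[of n sg t] by (cases "hyp_rad n sg t = 0") auto

lemma hyp_rad_deriv:
  assumes "2 \<le> n" "0 < sg" "0 < t"
  shows "(hyp_rad n sg has_real_derivative inverse (hyp_density n sg (hyp_rad n sg t))) (at t)"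
proof -
  define s where "s = hyp_rad n sg t"
  have s: "0 < s" "s < 1" "hyp_vol n sg s = t"
    using hyp_rad[of n sg t] hyp_rad_pos[OF assms] assms by (auto simp: s_def)
  define d where "d = min s (1 - s) / 2"
  have d: "d > 0" "d < s" "d < 1 - s" using s by (auto simp: d_def min_def)
  have "isCont (hyp_rad n sg) (hyp_vol n sg s)"
  proof (rule isCont_inverse_function[where f = "hyp_vol n sg" and x = s and d = d])
    fix z assume "\<bar>z - s\<bar> \<le> d"
    then have z: "0 < z" "z < 1" using d by auto
    show "hyp_rad n sg (hyp_vol n sg z) = z" using hyp_rad_vol assms z by simp
    show "isCont (hyp_vol n sg) z" using DERIV_isCont[OF hyp_vol_deriv] z by blast
  qed fact
  then have cont: "isCont (hyp_rad n sg) t" using s by simp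
  have der: "(hyp_vol n sg has_real_derivative hyp_density n sg (hyp_rad n sg t)) (at (hyp_rad n sg t))"
    using hyp_vol_deriv s by (simp add: s_def)
  have "hyp_density n sg (hyp_rad n sg t) \<noteq> 0"
    using hyp_density_pos[of n sg s] s assms by (simp add: s_def)
  moreover have "hyp_vol n sg (hyp_rad n sg y) = y" if "0 < y" for y
    using hyp_rad(3)[of n sg y] assms that by simp
  ultimately show ?thesis
    using assms(3) by (intro DERIV_inverse_function[where f = "hyp_vol n sg" and a = 0 and b = "t + 1"] der cont) auto
qed

text \<open>For the geodesic radius \<open>ln ((1 + s) / (1 - s))\<close> the hyperbolic sine is
  \<open>2 s / (1 - s\<^sup>2)\<close>, a rational function of the Euclidean radius
  \<open>s\<close>.\<close>

definition hyp_sinh :: "nat \<Rightarrow> real \<Rightarrow> real \<Rightarrow> real" where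
  "hyp_sinh n sg t = 2 * hyp_rad n sg t / (1 - (hyp_rad n sg t)\<^sup>2)"

lemma hyp_profile:
  assumes "4 \<le> n" "0 < sg"
  shows "volume_profile n sg (hyp_sinh n sg)"
proof
  have n2: "2 \<le> n" "0 < n" using assms by auto
  fix t :: real assume t: "t > 0"
  define s where "s = hyp_rad n sg t"
  have s: "0 < s" "s < 1" using hyp_rad[of n sg t] hyp_rad_pos[of n sg t] n2 assms t by (auto simp: s_def)
  define p where "p = 1 - s\<^sup>2"
  have p: "p > 0" using power2_less_1[of s] s by (simp add: p_def)
  show "hyp_sinh n sg t > 0" using s p by (simp add: hyp_sinh_def s_def p_def)
  have sinh: "hyp_sinh n sg t = 2 * s / p" by (simp add: hyp_sinh_def s_def p_def)
  \<comment> \<open>The hyperbolic cosine, from \<open>(1 - s\<^sup>2)\<^sup>2 + 4 s\<^sup>2 = (1 +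
    s\<^sup>2)\<^sup>2\<close>.\<close>
  have "1 + (2 * s / p)\<^sup>2 = ((1 + s\<^sup>2) / p)\<^sup>2"
    using p by (simp add: field_simps; simp add: p_def power2_eq_square algebra_simps)
  then have cosh: "sqrt (1 + (hyp_sinh n sg t)\<^sup>2) = (1 + s\<^sup>2) / p"
    unfolding sinh using p by (simp add: real_sqrt_unique)
  note D = hyp_rad_deriv[OF n2(1) assms(2) t]
  have D2: "((\<lambda>s. 2 * s / (1 - s\<^sup>2)) has_real_derivative 2 * (1 + s\<^sup>2) / p\<^sup>2) (at s)"
  proof -
    have "((\<lambda>s. 2 * s / (1 - s\<^sup>2)) has_real_derivative
      (2 * (1 - s\<^sup>2) - 2 * s * (0 - real 2 * (1 * s ^ (2 - Suc 0)))) / ((1 - s\<^sup>2) * (1 - s\<^sup>2))) (at s)"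
      using p by (intro DERIV_divide DERIV_diff DERIV_const DERIV_power DERIV_ident DERIV_cmult_Id) (simp add: p_def)
    then show ?thesis by (rule DERIV_cong) (simp add: p_def power2_eq_square algebra_simps)
  qed
  have "(hyp_sinh n sg has_real_derivative 2 * (1 + s\<^sup>2) / p\<^sup>2 * inverse (hyp_density n sg s)) (at t)"
    unfolding hyp_sinh_def using DERIV_chain2[OF D2[unfolded s_def] D] by (simp add: s_def)
  moreover have "2 * (1 + s\<^sup>2) / p\<^sup>2 * inverse (hyp_density n sg s) =
     sqrt (1 + (hyp_sinh n sg t)\<^sup>2) * hyp_sinh n sg t / (real n * sg * hyp_sinh n sg t ^ n)"
  proof -
    define z where "z = s ^ (n - 1) * (2 / p) ^ n"
    have z: "z > 0" using s p by (simp add: z_def)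
    have sn: "s ^ n = s * s ^ (n - 1)" using n2 by (simp flip: power_Suc)
    have "(2 * s / p) ^ n = s ^ n * (2 / p) ^ n" by (simp add: power_divide power_mult_distrib)
    then have 1: "(2 * s / p) ^ n = s * z" unfolding sn z_def by simp
    have 2: "hyp_density n sg s = real n * sg * z" by (simp add: hyp_density_def z_def p_def)
    show ?thesis
      unfolding cosh unfolding sinh 1 2 using s p n2 assms z
      by (simp add: field_simps power2_eq_square)
  qed
  ultimately show "(hyp_sinh n sg has_real_derivative
     sqrt (1 + (hyp_sinh n sg t)\<^sup>2) * hyp_sinh n sg t / (real n * sg * hyp_sinh n sg t ^ n)) (at t)"
    by simp
next
  have n2: "2 \<le> n" "0 < n" using assms by auto
  have "(hyp_rad n sg \<longlongrightarrow> 0) (at_right 0)"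
  proof (rule tendstoI)
    fix e :: real assume "e > 0"
    define d where "d = min e (1/2)"
    have d: "0 < d" "d < 1" "d \<le> e" using \<open>e > 0\<close> by (auto simp: d_def)
    have v: "hyp_vol n sg d > 0" using hyp_vol_less[of n sg 0 d] d n2 assms by simp
    have "dist (hyp_rad n sg t) 0 < e" if "0 < t" "t < hyp_vol n sg d" for t
      using hyp_rad[of n sg t] hyp_vol_less_iff[of n sg "hyp_rad n sg t" d] that d n2 assms by simp
    then show "\<forall>\<^sub>F t in at_right 0. dist (hyp_rad n sg t) 0 < e"
      using v by (auto simp: eventually_at_right_field)
  qed
  then have "(hyp_sinh n sg \<longlongrightarrow> 2 * 0 / (1 - 0\<^sup>2)) (at_right 0)"
    unfolding hyp_sinh_def by (intro tendsto_intros) auto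
  then show "(hyp_sinh n sg \<longlongrightarrow> 0) (at_right 0)" by simp
qed fact+

section \<open>Polar coordinates\<close>

lemma unit_ball_vol_nat_pos: "unit_ball_vol (real n) > 0"
  by (rule unit_ball_vol_pos) simp

definition hvol :: "'a::euclidean_space \<Rightarrow> real" where
  "hvol x = hyp_vol DIM('a) (unit_ball_vol (real DIM('a))) (norm x)"

definition evol :: "'a::euclidean_space \<Rightarrow> real" where
  "evol x = unit_ball_vol (real DIM('a)) * norm x ^ DIM('a)"

lemma power_integral:
  fixes sg :: real
  assumes "0 < n" "0 \<le> a"
  shows "((\<lambda>r. real n * sg * r ^ (n - 1)) has_integral sg * a ^ n) {0..a}"
proof -
  have "((\<lambda>r. real n * sg * r ^ (n - 1)) has_integral (sg * a ^ n - sg * 0 ^ n)) {0..a}"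
  proof (rule fundamental_theorem_of_calculus[OF assms(2)])
    fix x :: real
    have "((\<lambda>r. sg * r ^ n) has_real_derivative sg * (real n * (1 * x ^ (n - Suc 0)))) (at x within {0..a})"
      by (intro DERIV_cmult DERIV_power DERIV_ident)
    then show "((\<lambda>r. sg * r ^ n) has_vector_derivative real n * sg * x ^ (n - 1)) (at x within {0..a})"
      by (simp add: has_real_derivative_iff_has_vector_derivative mult_ac)
  qed
  then show ?thesis using assms by (simp add: zero_power)
qed

text \<open>Polar integration from the volumes of balls alone: an image measure on the line that is
  finite on every \<open>{..<a}\<close> is determined by its values there, and these are the volumes
  \<open>sg * a ^ n\<close>.\<close>

lemma distr_norm:
  "distr (lebesgue :: 'a::euclidean_space measure) borel norm =
    density lborel (\<lambda>r. ennreal (real DIM('a) * unit_ball_vol (real DIM('a)) * r ^ (DIM('a) - 1)) * indicator {0<..} r)"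
  (is "_ = ?N")
proof (rule distr_eq_of_lessThan)
  let ?n = "DIM('a)" and ?sg = "unit_ball_vol (real DIM('a))"
  have emN: "emeasure ?N {..<a} = ennreal (if a \<ge> 0 then ?sg * a ^ ?n else 0)" for a
  proof -
    have "emeasure ?N {..<a} = (\<integral>\<^sup>+r. ennreal (real ?n * ?sg * r ^ (?n - 1)) * indicator {0<..} r * indicator {..<a} r \<partial>lborel)"
      by (subst emeasure_density) auto
    also have "\<dots> = (\<integral>\<^sup>+r. ennreal (real ?n * ?sg * r ^ (?n - 1)) * indicator {0..a} r \<partial>lborel)"
      by (intro nn_integral_cong_AE, use AE_lborel_singleton[of 0] AE_lborel_singleton[of a] in eventually_elim)
         (auto simp: indicator_def)
    also have "\<dots> = ennreal (if a \<ge> 0 then ?sg * a ^ ?n else 0)"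
    proof (cases "a \<ge> 0")
      case True
      then show ?thesis
        using power_integral[of ?n a ?sg]
        by (subst nn_integral_has_integral_lebesgue') (auto simp: unit_ball_vol_nat_pos less_imp_le)
    qed simp
    finally show ?thesis .
  qed
  show "emeasure ?N {..<a} \<noteq> \<infinity>" for a unfolding emN by simp
  show "emeasure lebesgue {x \<in> space lebesgue. norm (x::'a) < a} = emeasure ?N {..<a}" for a
  proof -
    have "{x. norm (x::'a) < a} = ball 0 a" by (auto simp: dist_norm)
    then show ?thesis
      unfolding emN by (cases "a \<ge> 0") (auto simp: emeasure_ball not_le ball_empty)
  qed
qed (auto intro!: measurable_completion)

lemma nn_integral_norm:
  assumes "g \<in> borel_measurable borel"
  shows "(\<integral>\<^sup>+x. g (norm (x::'a::euclidean_space)) \<partial>lebesgue) =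
    (\<integral>\<^sup>+r. ennreal (real DIM('a) * unit_ball_vol (real DIM('a)) * r ^ (DIM('a) - 1)) * indicator {0<..} r * g r \<partial>lborel)"
proof -
  have "(\<integral>\<^sup>+x. g (norm (x::'a)) \<partial>lebesgue) = (\<integral>\<^sup>+r. g r \<partial>distr (lebesgue :: 'a measure) borel norm)"
    using assms by (subst nn_integral_distr) (auto intro!: measurable_completion)
  also have "\<dots> = (\<integral>\<^sup>+r. ennreal (real DIM('a) * unit_ball_vol (real DIM('a)) * r ^ (DIM('a) - 1)) * indicator {0<..} r * g r \<partial>lborel)"
    unfolding distr_norm using assms by (subst nn_integral_density) auto
  finally show ?thesis .
qed

section \<open>The hyperbolic measure and enclosed volumes\<close>

definition conf :: "'a::euclidean_space \<Rightarrow> real" where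
  "conf x = 2 / (1 - (norm x)\<^sup>2)"

lemma conf_pos: "x \<in> ball 0 1 \<Longrightarrow> conf x > 0"
  using power2_less_1[of "norm x"] by (simp add: conf_def)

lemma conf_measurable [measurable]: "conf \<in> borel_measurable borel"
  unfolding conf_def by measurable

lemma hyp_measure_conf:
  "hyp_measure = density (lebesgue_on (ball 0 1)) (\<lambda>x::'a::euclidean_space. ennreal (conf x ^ DIM('a)))"
  by (simp add: hyp_measure_def conf_def)

lemma space_hyp [simp]: "space hyp_measure = ball 0 1"
  and sets_hyp: "sets (hyp_measure :: 'a::euclidean_space measure) = sets (lebesgue_on (ball 0 1))"
  by (auto simp: hyp_measure_def)

lemma measurable_hyp: "borel_measurable hyp_measure = borel_measurable (lebesgue_on (ball 0 1))"
  by (rule measurable_cong_sets) (auto simp: sets_hyp)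

lemma conf_measurable_on: "(\<lambda>x::'a::euclidean_space. conf x ^ DIM('a)) \<in> borel_measurable (lebesgue_on (ball 0 1))"
  by (intro borel_measurable_power measurable_restrict_space1 measurable_completion)
     simp

lemma AE_hyp_iff:
  "(AE x in hyp_measure. P x) \<longleftrightarrow> (AE x in lebesgue. x \<in> ball 0 1 \<longrightarrow> P (x::'a::euclidean_space))"
proof -
  have "(AE x in hyp_measure. P x) \<longleftrightarrow> (AE x in lebesgue_on (ball 0 1). 0 < ennreal (conf x ^ DIM('a)) \<longrightarrow> P (x::'a))"
    unfolding hyp_measure_conf
    by (intro AE_density measurable_compose[OF _ measurable_ennreal] conf_measurable_on)
  also have "\<dots> \<longleftrightarrow> (AE x in lebesgue. x \<in> ball 0 1 \<longrightarrow> 0 < ennreal (conf x ^ DIM('a)) \<longrightarrow> P (x::'a))"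
    by (subst AE_restrict_space_iff) auto
  also have "\<dots> \<longleftrightarrow> (AE x in lebesgue. x \<in> ball 0 1 \<longrightarrow> P (x::'a))"
  proof (intro AE_cong)
    fix x :: 'a
    show "(x \<in> ball 0 1 \<longrightarrow> 0 < ennreal (conf x ^ DIM('a)) \<longrightarrow> P x) \<longleftrightarrow> (x \<in> ball 0 1 \<longrightarrow> P x)"
      using zero_less_power[OF conf_pos[of x], of "DIM('a)"] by auto
  qed
  finally show ?thesis .
qed

lemma integral_hyp:
  fixes f :: "'a::euclidean_space \<Rightarrow> real"
  assumes "f \<in> borel_measurable hyp_measure"
  shows "(\<integral>x. f x \<partial>hyp_measure) = (\<integral>x. indicator (ball 0 1) x * (conf x ^ DIM('a) * f x) \<partial>lebesgue)"
proof -
  have "AE x in lebesgue_on (ball 0 1). 0 \<le> conf (x::'a) ^ DIM('a)"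
    by (intro AE_I2 zero_le_power less_imp_le conf_pos) simp
  then have "(\<integral>x. f x \<partial>hyp_measure) = (\<integral>x. conf x ^ DIM('a) *\<^sub>R f x \<partial>lebesgue_on (ball 0 1))"
    unfolding hyp_measure_conf
    by (intro integral_density conf_measurable_on) (use assms measurable_hyp in auto)
  also have "\<dots> = (\<integral>x. indicator (ball 0 1) x *\<^sub>R (conf x ^ DIM('a) *\<^sub>R f x) \<partial>lebesgue)"
    by (subst integral_restrict_space) auto
  finally show ?thesis by simp
qed

lemma emeasure_hyp_ball:
  assumes "0 \<le> s" "s < 1"
  shows "emeasure hyp_measure (ball (0::'a::euclidean_space) s) =
    ennreal (hyp_vol DIM('a) (unit_ball_vol (real DIM('a))) s)"
proof -
  let ?n = "DIM('a)" and ?sg = "unit_ball_vol (real DIM('a))"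
  define g where "g r = ennreal ((2 / (1 - r\<^sup>2)) ^ ?n) * indicator {..<s} r" for r :: real
  have g: "g \<in> borel_measurable borel" unfolding g_def by measurable
  have b: "ball (0::'a) s \<in> sets (lebesgue_on (ball 0 1))"
    using assms by (auto simp: sets_restrict_space_iff)
  have "emeasure hyp_measure (ball (0::'a) s) =
      (\<integral>\<^sup>+x. ennreal (conf x ^ ?n) * indicator (ball (0::'a) s) x \<partial>lebesgue_on (ball 0 1))"
    unfolding hyp_measure_conf
    by (rule emeasure_density[OF measurable_compose[OF conf_measurable_on measurable_ennreal] b])
  also have "\<dots> = (\<integral>\<^sup>+x. ennreal (conf x ^ ?n) * indicator (ball (0::'a) s) x * indicator (ball 0 1) x \<partial>lebesgue)"
    by (subst nn_integral_restrict_space) auto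
  also have "\<dots> = (\<integral>\<^sup>+x. g (norm (x::'a)) \<partial>lebesgue)"
    using assms by (intro nn_integral_cong) (auto simp: g_def conf_def indicator_def)
  also have "\<dots> = (\<integral>\<^sup>+r. ennreal (real ?n * ?sg * r ^ (?n - 1)) * indicator {0<..} r * g r \<partial>lborel)"
    by (rule nn_integral_norm[OF g])
  also have "\<dots> = (\<integral>\<^sup>+r. ennreal (hyp_density ?n ?sg r) * indicator {0..s} r \<partial>lborel)"
  proof (intro nn_integral_cong_AE, use AE_lborel_singleton[of 0] AE_lborel_singleton[of s] in eventually_elim)
    fix r :: real assume "r \<noteq> 0" "r \<noteq> s"
    then show "ennreal (real ?n * ?sg * r ^ (?n - 1)) * indicator {0<..} r * g r =
        ennreal (hyp_density ?n ?sg r) * indicator {0..s} r"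
      using power2_less_1[of r] assms unit_ball_vol_nat_pos[of ?n]
      by (auto simp: g_def hyp_density_def indicator_def simp flip: ennreal_mult)
  qed
  also have "\<dots> = ennreal (hyp_vol ?n ?sg s)"
    unfolding hyp_vol_def
  proof (rule nn_integral_has_integral_lebesgue')
    show "(hyp_density ?n ?sg has_integral integral {0..s} (hyp_density ?n ?sg)) {0..s}"
      by (intro integrable_integral integrable_continuous_interval hyp_density_continuous assms)
    show "0 \<le> hyp_density ?n ?sg r" if "r \<in> {0..s}" for r
      using that assms power2_less_1[of r] unit_ball_vol_nat_pos[of ?n]
      unfolding hyp_density_def by (intro mult_nonneg_nonneg zero_le_power divide_nonneg_nonneg) auto
  qed
  finally show ?thesis .
qed

lemma hyp_ball0_dist0:
  assumes "x \<in> ball (0::'a::euclidean_space) 1"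
  shows "hyp_ball0 (hyp_dist0 x) = ball (0::'a) (norm x)"
proof -
  have "hyp_dist0 y < hyp_dist0 x \<longleftrightarrow> norm y < norm x" if "y \<in> ball (0::'a) 1" for y
  proof -
    have n: "norm x < 1" "norm y < 1" using assms that by auto
    have p: "1 + norm z > 0" for z :: 'a using norm_ge_zero[of z] by linarith
    have "hyp_dist0 y < hyp_dist0 x \<longleftrightarrow> (1 + norm y) / (1 - norm y) < (1 + norm x) / (1 - norm x)"
      unfolding hyp_dist0_def using n p by (intro ln_less_cancel_iff) auto
    also have "\<dots> \<longleftrightarrow> norm y < norm x"
      using n by (simp add: divide_less_eq less_divide_eq algebra_simps)
    finally show ?thesis .
  qed
  then show ?thesis using assms by (auto simp: hyp_ball0_def)
qed

lemma measure_hyp_ball0: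
  assumes "x \<in> ball (0::'a::euclidean_space) 1"
  shows "measure hyp_measure (hyp_ball0 (hyp_dist0 x) :: 'a set) = hvol x"
  using assms hyp_vol_nonneg[of "DIM('a)" "unit_ball_vol (real DIM('a))" "norm x"]
  by (simp add: hyp_ball0_dist0 measure_def emeasure_hyp_ball hvol_def unit_ball_vol_nat_pos)

lemma hvol_continuous: "continuous_on (ball 0 1) (hvol :: 'a::euclidean_space \<Rightarrow> real)"
  unfolding hvol_def
  by (rule continuous_on_compose2[OF hyp_vol_continuous continuous_on_norm_id]) auto

lemma hvol_measurable [measurable]: "hvol \<in> borel_measurable (hyp_measure :: 'a::euclidean_space measure)"
  unfolding measurable_hyp
  by (rule continuous_imp_measurable_on_sets_lebesgue[OF hvol_continuous]) simp

lemma evol_measurable [measurable]: "evol \<in> borel_measurable (lebesgue :: 'a::euclidean_space measure)"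
  unfolding evol_def by (intro measurable_completion) measurable

text \<open>The set \<open>hvol x < a\<close> is the centred ball of volume \<open>a\<close>, so its
  measure is \<open>a\<close>. This is why the enclosed volume turns both spaces into the same
  half-line with Lebesgue measure.\<close>

lemma distr_hvol:
  assumes "2 \<le> DIM('a)"
  shows "distr hyp_measure borel (hvol :: 'a::euclidean_space \<Rightarrow> real) = half_line"
proof (rule distr_eq_half_line)
  let ?n = "DIM('a)" and ?sg = "unit_ball_vol (real DIM('a))"
  fix a :: real
  show "emeasure hyp_measure {x \<in> space hyp_measure. hvol (x::'a) < a} = ennreal a"
  proof (cases "a \<ge> 0")
    case True
    obtain s where s: "0 \<le> s" "s < 1" "hyp_vol ?n ?sg s = a"
      using hyp_vol_surj[OF assms unit_ball_vol_nat_pos True] by blast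
    have "{x \<in> space hyp_measure. hvol (x::'a) < a} = ball 0 s"
      using s hyp_vol_less_iff[of ?n ?sg "norm (x::'a)" s for x] unit_ball_vol_nat_pos[of ?n]
      by (auto simp: hvol_def)
    then show ?thesis using emeasure_hyp_ball[OF s(1,2), where 'a = 'a] s by simp
  next
    case False
    have "hvol (x::'a) \<ge> 0" if "x \<in> ball 0 1" for x
      using that hyp_vol_nonneg[of ?n ?sg "norm x"] unit_ball_vol_nat_pos[of ?n] by (simp add: hvol_def)
    then have "{x \<in> space hyp_measure. hvol (x::'a) < a} = {}" using False by force
    then have "emeasure hyp_measure {x \<in> space hyp_measure. hvol (x::'a) < a} = emeasure hyp_measure ({} :: 'a set)" by (simp only:)
    then show ?thesis using False by (simp only: emeasure_empty ennreal_neg not_le less_imp_le)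
  qed
qed measurable

lemma distr_evol:
  "distr lebesgue borel (evol :: 'a::euclidean_space \<Rightarrow> real) = half_line"
proof (rule distr_eq_half_line)
  let ?n = "DIM('a)" and ?sg = "unit_ball_vol (real DIM('a))"
  note sg = unit_ball_vol_nat_pos[of ?n]
  fix a :: real
  show "emeasure lebesgue {x \<in> space lebesgue. evol (x::'a) < a} = ennreal a"
  proof (cases "a \<ge> 0")
    case True
    define s where "s = root ?n (a / ?sg)"
    have s: "s \<ge> 0" "?sg * s ^ ?n = a" using True less_imp_neq[OF sg] by (auto simp: s_def)
    have "?sg * norm x ^ ?n < a \<longleftrightarrow> norm x < s" for x :: 'a
    proof -
      have "?sg * norm x ^ ?n < a \<longleftrightarrow> norm x ^ ?n < s ^ ?n"
        unfolding s(2)[symmetric] using sg by simp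
      also have "\<dots> \<longleftrightarrow> norm x < s"
        using power_mono_iff[OF s(1) norm_ge_zero[of x] DIM_positive[where 'a = 'a]]
        by (simp only: linorder_not_le[symmetric])
      finally show ?thesis .
    qed
    then have "{x \<in> space lebesgue. evol (x::'a) < a} = ball 0 s"
      unfolding evol_def by (intro set_eqI) simp
    moreover have "emeasure lebesgue (ball (0::'a) s) = ennreal (?sg * s ^ ?n)"
      using s(1) by (simp add: emeasure_ball)
    ultimately show ?thesis unfolding s(2) by (rule trans[OF arg_cong])
  next
    case False
    have "\<not> evol x < a" for x :: 'a
    proof -
      have "evol x \<ge> 0" using sg by (simp add: evol_def)
      then show ?thesis using False by linarith
    qed
    then have "{x \<in> space lebesgue. evol (x::'a) < a} = {}" by simp
    then have "emeasure lebesgue {x \<in> space lebesgue. evol (x::'a) < a} = emeasure lebesgue ({} :: 'a set)" by (simp only:)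
    then show ?thesis using False by (simp only: emeasure_empty ennreal_neg not_le less_imp_le)
  qed
qed measurable

section \<open>Transport of integrals to the half-line\<close>

lemma integral_transport:
  fixes g :: "real \<Rightarrow> real"
  assumes "distr M borel T = half_line" "T \<in> borel_measurable M" "g \<in> borel_measurable half_line"
  shows "(\<integral>x. g (T x) \<partial>M) = (\<integral>t. g t \<partial>half_line)"
    "integrable M (\<lambda>x. g (T x)) \<longleftrightarrow> integrable half_line g"
proof -
  have g: "g \<in> borel_measurable borel"
    using assms(3) by (simp add: measurable_cong_sets[OF sets_half_line refl])
  show "(\<integral>x. g (T x) \<partial>M) = (\<integral>t. g t \<partial>half_line)"
    unfolding assms(1)[symmetric] using assms(2) g by (simp add: integral_distr)
  show "integrable M (\<lambda>x. g (T x)) \<longleftrightarrow> integrable half_line g"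
    unfolding assms(1)[symmetric] using assms(2) g by (simp add: integrable_distr_eq)
qed

lemma L2_transport:
  assumes "distr M borel T = half_line" "T \<in> borel_measurable M" "g \<in> L2 half_line"
  shows "(\<lambda>x. g (T x)) \<in> L2 M"
proof (rule L2I)
  have g: "g \<in> borel_measurable borel"
    using assms(3) by (auto simp: L2_def measurable_cong_sets[OF sets_half_line refl])
  then show "(\<lambda>x. g (T x)) \<in> borel_measurable M" using assms(2) by measurable
  show "integrable M (\<lambda>x. (g (T x))\<^sup>2)"
    using integral_transport(2)[OF assms(1,2), of "\<lambda>t. (g t)\<^sup>2"] assms(3)
    by (simp add: L2_def)
qed

lemma L2_tendsto_transport:
  assumes "distr M borel T = half_line" "T \<in> borel_measurable M" "L2_tendsto half_line f g"
  shows "L2_tendsto M (\<lambda>j x. f j (T x)) (\<lambda>x. g (T x))"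
proof -
  have f: "f j \<in> L2 half_line" "g \<in> L2 half_line" for j
    using assms(3) by (auto simp: L2_tendsto_iff)
  have lim: "(\<lambda>k. \<integral>x. (f k x - g x)\<^sup>2 \<partial>half_line) \<longlonglongrightarrow> 0"
    using assms(3) by (auto simp: L2_tendsto_iff)
  have "(\<integral>x. (f k (T x) - g (T x))\<^sup>2 \<partial>M) = (\<integral>x. (f k x - g x)\<^sup>2 \<partial>half_line)" for k
    by (rule integral_transport(1)[OF assms(1,2)])
       (intro borel_measurable_power L2_measurable L2_diff f)
  then show ?thesis
    using lim f L2_transport[OF assms(1,2)] by (auto simp: L2_tendsto_iff)
qed

section \<open>Green's identity\<close>

lemma continuous_zero_outside:
  fixes g :: "'a::euclidean_space \<Rightarrow> real"
  assumes "open \<Omega>" "compact K" "K \<subseteq> \<Omega>" "continuous_on \<Omega> g" "\<And>x. x \<notin> K \<Longrightarrow> g x = 0"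
  shows "continuous_on UNIV g" "integrable lborel g"
proof -
  have "continuous_on (- K) (\<lambda>_. 0 :: real)" by simp
  then have "continuous_on (- K) g" by (rule continuous_on_eq) (simp add: assms(5))
  then have "continuous_on (\<Omega> \<union> - K) g"
    using assms by (intro continuous_on_open_Un) (auto simp: compact_imp_closed open_Compl)
  moreover have "\<Omega> \<union> - K = UNIV" using assms(3) by auto
  ultimately show c: "continuous_on UNIV g" by simp
  have "integrable lborel (\<lambda>x. indicator K x *\<^sub>R g x)"
    by (rule borel_integrable_compact[OF assms(2)]) (rule continuous_on_subset[OF c], simp)
  moreover have "(\<lambda>x. indicator K x *\<^sub>R g x) = g"
    using assms(5) by (auto simp: indicator_def fun_eq_iff)
  ultimately show "integrable lborel g" by simp
qed

lemma integral_translate: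
  fixes g :: "'a::euclidean_space \<Rightarrow> real"
  assumes "continuous_on UNIV g"
  shows "(\<integral>x. g (c + x) \<partial>lborel) = (\<integral>x. g x \<partial>lborel)"
proof -
  have "g \<in> borel_measurable borel" using assms by (rule borel_measurable_continuous_onI)
  then have "(\<integral>x. g x \<partial>distr lborel borel ((+) c)) = (\<integral>x. g (c + x) \<partial>lborel)"
    by (intro integral_distr) auto
  then show ?thesis by (simp add: lborel_distr_plus)
qed

text \<open>The integral of \<open>F (x + h b)\<close> does not depend on \<open>h\<close>, so its derivative at \<open>h = 0\<close> vanishes.\<close>

lemma integral_directional_derivative_eq_0:
  fixes F F' :: "'a::euclidean_space \<Rightarrow> real"
  assumes deriv: "\<And>x. ((\<lambda>s. F (x + s *\<^sub>R b)) has_real_derivative F' x) (at 0)"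
    and cont: "continuous_on UNIV F" "continuous_on UNIV F'"
    and K: "compact K" and zero: "\<And>x. x \<notin> K \<Longrightarrow> F x = 0" "\<And>x. x \<notin> K \<Longrightarrow> F' x = 0"
  shows "(\<integral>x. F' x \<partial>lborel) = 0"
proof -
  have K0: "K \<subseteq> UNIV" by simp
  have "bounded (F' ` K)"
    by (intro compact_imp_bounded compact_continuous_image continuous_on_subset[OF cont(2)] K) simp
  then obtain M where M: "\<And>x. x \<in> K \<Longrightarrow> \<bar>F' x\<bar> \<le> M" "M > 0"
    unfolding bounded_pos by auto
  then have M': "\<bar>F' x\<bar> \<le> M" for x using zero(2)[of x] by (cases "x \<in> K") auto
  obtain r where r: "r > 0" "\<And>x. x \<in> K \<Longrightarrow> norm x \<le> r"
    using compact_imp_bounded[OF K] unfolding bounded_pos by blast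
  have line: "((\<lambda>s. F (x + s *\<^sub>R b)) has_real_derivative F' (x + s *\<^sub>R b)) (at s)" for x s
  proof -
    have "((\<lambda>z. F ((x + s *\<^sub>R b) + (z - s) *\<^sub>R b)) has_real_derivative F' (x + s *\<^sub>R b) * 1) (at s)"
      by (rule DERIV_chain2[where g = "\<lambda>z. z - s"]) (use deriv[of "x + s *\<^sub>R b"] in \<open>auto intro!: derivative_eq_intros\<close>)
    then show ?thesis by (simp add: algebra_simps)
  qed
  define h where "h k = 1 / real (Suc k)" for k
  have h: "0 < h k" "h k \<le> 1" for k by (auto simp: h_def)
  have h_lim: "h \<longlonglongrightarrow> 0" unfolding h_def by (rule LIMSEQ_Suc[OF lim_1_over_n])
  define D where "D k x = (F (h k *\<^sub>R b + x) - F x) / h k" for k x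
  have int0: "(\<integral>x. D k x \<partial>lborel) = 0" for k
  proof -
    have F_int: "integrable lborel F"
      by (rule continuous_zero_outside(2)[OF open_UNIV K K0 cont(1) zero(1)])
    have "compact ((\<lambda>x. - (h k *\<^sub>R b) + x) ` K)" by (intro compact_translation K)
    moreover have "F (h k *\<^sub>R b + x) = 0" if "x \<notin> (\<lambda>x. - (h k *\<^sub>R b) + x) ` K" for x
      by (rule zero(1)) (use that in force)
    moreover have "continuous_on UNIV (\<lambda>x. F (h k *\<^sub>R b + x))"
      by (intro continuous_on_compose2[OF cont(1)] continuous_intros) auto
    ultimately have "integrable lborel (\<lambda>x. F (h k *\<^sub>R b + x))"
      by (intro continuous_zero_outside(2)[OF open_UNIV]) auto
    then show ?thesis
      unfolding D_def using F_int by (simp add: integral_translate[OF cont(1)])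
  qed
  \<comment> \<open>By the mean value theorem the difference quotients are values of
    \<open>F'\<close>, hence bounded by \<open>M\<close>; as \<open>h k \<le> 1\<close>, they all
    vanish outside one fixed ball.\<close>
  have "(\<lambda>k. \<integral>x. D k x \<partial>lborel) \<longlonglongrightarrow> (\<integral>x. F' x \<partial>lborel)"
  proof (rule integral_dominated_convergence[where w = "\<lambda>x. indicator (cball 0 (r + norm b)) x *\<^sub>R M"])
    show "F' \<in> borel_measurable lborel"
      using borel_measurable_continuous_onI[OF cont(2)] by simp
    have F: "F \<in> borel_measurable borel" using borel_measurable_continuous_onI[OF cont(1)] by simp
    show "D k \<in> borel_measurable lborel" for k unfolding D_def using F by measurable
    show "integrable lborel (\<lambda>x. indicator (cball 0 (r + norm b)) x *\<^sub>R M)"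
      by (rule borel_integrable_compact) auto
    show "AE x in lborel. (\<lambda>k. D k x) \<longlonglongrightarrow> F' x"
    proof (rule AE_I2)
      fix x
      have "((\<lambda>s. (F (x + s *\<^sub>R b) - F x) / s) \<longlongrightarrow> F' x) (at 0)"
        using deriv[of x] by (simp add: has_field_derivative_iff)
      moreover have "filterlim h (at 0) sequentially"
        using h_lim h(1) by (auto simp: filterlim_at intro!: always_eventually) (metis less_irrefl)
      ultimately have "(\<lambda>k. (F (x + h k *\<^sub>R b) - F x) / h k) \<longlonglongrightarrow> F' x"
        by (rule filterlim_compose)
      then show "(\<lambda>k. D k x) \<longlonglongrightarrow> F' x" by (simp add: D_def add.commute)
    qed
    show "AE x in lborel. norm (D k x) \<le> indicator (cball 0 (r + norm b)) x *\<^sub>R M" for k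
    proof (rule AE_I2)
      fix x
      obtain z where z: "F (x + h k *\<^sub>R b) - F (x + 0 *\<^sub>R b) = (h k - 0) * F' (x + z *\<^sub>R b)"
        using MVT2[OF h(1)[of k] line[of x]] by blast
      then have "D k x = F' (x + z *\<^sub>R b)" using h(1)[of k] by (simp add: D_def add.commute)
      then have "\<bar>D k x\<bar> \<le> M" using M' by simp
      moreover have "D k x = 0" if "x \<notin> cball 0 (r + norm b)"
      proof -
        have nx: "norm x > r + norm b" using that by simp
        then have "x \<notin> K" using r norm_ge_zero[of b] by fastforce
        moreover have "h k *\<^sub>R b + x \<notin> K"
        proof
          assume "h k *\<^sub>R b + x \<in> K"
          then have "norm (h k *\<^sub>R b + x) \<le> r" by (rule r(2))
          moreover have "norm x - norm (h k *\<^sub>R b) \<le> norm (h k *\<^sub>R b + x)"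
            by (metis add.commute norm_diff_ineq)
          moreover have "norm (h k *\<^sub>R b) \<le> norm b" using h[of k] by (simp add: mult_left_le_one_le)
          ultimately show False using nx by linarith
        qed
        ultimately show ?thesis using zero(1) by (simp add: D_def)
      qed
      ultimately show "norm (D k x) \<le> indicator (cball 0 (r + norm b)) x *\<^sub>R M"
        using M(2) by (auto simp: indicator_def)
    qed
  qed
  then show ?thesis by (simp add: int0 LIMSEQ_const_iff)
qed

lemma partial_deriv_zero:
  assumes "open U" "\<And>x. x \<in> U \<Longrightarrow> f x = 0" "x \<in> U"
  shows "partial_deriv b f x = 0"
proof -
  have "(f has_derivative (\<lambda>_. 0)) (at x)"
    by (rule has_derivative_transform_within_open[OF has_derivative_const[of 0] assms(1,3)])
       (use assms(2) in auto)
  then have "frechet_derivative f (at x) = (\<lambda>_. 0)" by (metis frechet_derivative_at)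
  then show ?thesis by (simp add: partial_deriv_def)
qed

lemma has_derivative_line:
  assumes "(F has_derivative D) (at x)"
  shows "((\<lambda>s. F (x + s *\<^sub>R b)) has_real_derivative D b) (at 0)"
proof -
  have "((\<lambda>s. x + s *\<^sub>R b) has_derivative (\<lambda>s. s *\<^sub>R b)) (at 0)"
    by (auto intro!: derivative_eq_intros)
  then have "((\<lambda>s. F (x + s *\<^sub>R b)) has_derivative (\<lambda>s. D (s *\<^sub>R b))) (at 0)"
    by (rule has_derivative_compose) (use assms in simp)
  moreover have "D (s *\<^sub>R b) = D b * s" for s
    using has_derivative_linear[OF assms] by (simp add: linear_cmul)
  ultimately show ?thesis by (simp add: has_field_derivative_def)
qed

lemma test_functionD:
  assumes "\<phi> \<in> test_functions \<Omega>"
  obtains K where "compact K" "K \<subseteq> \<Omega>"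
    "\<And>x. x \<notin> K \<Longrightarrow> \<phi> x = 0"
    "\<And>x b. x \<notin> K \<Longrightarrow> partial_deriv b \<phi> x = 0"
    "\<And>x b c. x \<notin> K \<Longrightarrow> partial_deriv c (partial_deriv b \<phi>) x = 0"
proof
  let ?K = "closure {x. \<phi> x \<noteq> 0}"
  show "compact ?K" "?K \<subseteq> \<Omega>" using assms by (auto simp: test_functions_def)
  show 0: "\<phi> x = 0" if "x \<notin> ?K" for x
    using that closure_subset[of "{x. \<phi> x \<noteq> 0}"] by blast
  have o: "open (- ?K)" by (rule open_Compl) simp
  show 1: "partial_deriv b \<phi> x = 0" if "x \<notin> ?K" for x b
    by (rule partial_deriv_zero[OF o _ iffD2[OF Compl_iff that]]) (rule 0, erule ComplD)
  show "partial_deriv c (partial_deriv b \<phi>) x = 0" if "x \<notin> ?K" for x b c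
    by (rule partial_deriv_zero[OF o _ iffD2[OF Compl_iff that]]) (rule 1, erule ComplD)
qed

lemma test_function_C2:
  assumes "\<phi> \<in> test_functions \<Omega>"
  shows "(\<phi> has_derivative (\<lambda>v. frechet_derivative \<phi> (at x) v)) (at x)"
    "b \<in> Basis \<Longrightarrow> (partial_deriv b \<phi> has_derivative (\<lambda>v. frechet_derivative (partial_deriv b \<phi>) (at x) v)) (at x)"
    "continuous_on UNIV \<phi>"
    "b \<in> Basis \<Longrightarrow> continuous_on UNIV (partial_deriv b \<phi>)"
    "b \<in> Basis \<Longrightarrow> c \<in> Basis \<Longrightarrow> continuous_on UNIV (partial_deriv c (partial_deriv b \<phi>))"
proof -
  have "C_diff (Suc (Suc 0)) \<phi>" using assms unfolding test_functions_def smooth_def by blast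
  then have d0: "\<And>x. \<phi> differentiable (at x)"
    and d1: "\<And>x b. b \<in> Basis \<Longrightarrow> partial_deriv b \<phi> differentiable (at x)"
    and c: "\<And>b c. b \<in> Basis \<Longrightarrow> c \<in> Basis \<Longrightarrow> continuous_on UNIV (partial_deriv c (partial_deriv b \<phi>))"
    by auto
  show "(\<phi> has_derivative (\<lambda>v. frechet_derivative \<phi> (at x) v)) (at x)"
    using d0 frechet_derivative_works by blast
  show "(partial_deriv b \<phi> has_derivative (\<lambda>v. frechet_derivative (partial_deriv b \<phi>) (at x) v)) (at x)"
    if "b \<in> Basis" using d1[OF that] frechet_derivative_works by blast
  show "continuous_on UNIV \<phi>"
    by (intro continuous_at_imp_continuous_on ballI differentiable_imp_continuous_within d0)
  show "continuous_on UNIV (partial_deriv b \<phi>)" if "b \<in> Basis"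
    by (intro continuous_at_imp_continuous_on ballI differentiable_imp_continuous_within d1 that)
  show "continuous_on UNIV (partial_deriv c (partial_deriv b \<phi>))" if "b \<in> Basis" "c \<in> Basis"
    by (rule c[OF that])
qed

text \<open>The difference of the two integrands is the divergence of
  \<open>\<psi> q grad \<phi> - \<phi> X\<close>, and each component integrates to 0 by
  \<open>integral_directional_derivative_eq_0\<close>. The flux \<open>X = q grad \<psi>\<close> has
  its own derivative \<open>X'\<close>, so that second derivatives of \<open>\<psi>\<close> never
  appear.\<close>

lemma Green_identity:
  fixes \<phi> \<psi> q :: "'a::euclidean_space \<Rightarrow> real" and gpsi gq X :: "'a \<Rightarrow> 'a"
  assumes \<phi>: "\<phi> \<in> test_functions \<Omega>" and \<Omega>: "open \<Omega>"
    and \<psi>: "\<And>x. x \<in> \<Omega> \<Longrightarrow> (\<psi> has_derivative (\<lambda>v. gpsi x \<bullet> v)) (at x)"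
    and q: "\<And>x. x \<in> \<Omega> \<Longrightarrow> (q has_derivative (\<lambda>v. gq x \<bullet> v)) (at x)" "continuous_on \<Omega> gq"
    and X: "\<And>x. x \<in> \<Omega> \<Longrightarrow> (X has_derivative X' x) (at x)"
      "\<And>b. b \<in> Basis \<Longrightarrow> continuous_on \<Omega> (\<lambda>x. X' x b \<bullet> b)"
    and flux: "\<And>x. x \<in> \<Omega> \<Longrightarrow> X x = q x *\<^sub>R gpsi x"
  shows "(\<integral>x. \<psi> x * (q x * laplacian \<phi> x + gq x \<bullet> gradient \<phi> x) \<partial>lebesgue) =
    (\<integral>x. (\<Sum>b\<in>Basis. X' x b \<bullet> b) * \<phi> x \<partial>lebesgue)"
proof -
  obtain K where K: "compact K" "K \<subseteq> \<Omega>" and zero: "\<And>x. x \<notin> K \<Longrightarrow> \<phi> x = 0"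
    "\<And>x b. x \<notin> K \<Longrightarrow> partial_deriv b \<phi> x = 0"
    "\<And>x b c. x \<notin> K \<Longrightarrow> partial_deriv c (partial_deriv b \<phi>) x = 0"
    using test_functionD[OF \<phi>] by metis
  note C2 = test_function_C2[OF \<phi>]
  note sub = continuous_on_subset[OF _ subset_UNIV, of _ \<Omega>]
  have \<psi>_cont: "continuous_on \<Omega> \<psi>"
    by (intro continuous_at_imp_continuous_on ballI has_derivative_continuous[OF \<psi>])
  have q_cont: "continuous_on \<Omega> q"
    by (intro continuous_at_imp_continuous_on ballI has_derivative_continuous[OF q(1)])
  have X_cont: "continuous_on \<Omega> X"
    by (intro continuous_at_imp_continuous_on ballI has_derivative_continuous[OF X(1)])
  define L where "L b x = \<psi> x * (q x * partial_deriv b (partial_deriv b \<phi>) x + (gq x \<bullet> b) * partial_deriv b \<phi> x)" for b x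
  define Rr where "Rr b x = (X' x b \<bullet> b) * \<phi> x" for b x
  have L: "continuous_on UNIV (L b)" "integrable lborel (L b)" if b: "b \<in> Basis" for b
  proof -
    have "continuous_on \<Omega> (L b)" unfolding L_def
      by (intro continuous_intros \<psi>_cont q_cont q(2) sub C2(3-5) b)
    moreover have "L b x = 0" if "x \<notin> K" for x using zero that by (simp add: L_def)
    ultimately show "continuous_on UNIV (L b)" "integrable lborel (L b)"
      using continuous_zero_outside[OF \<Omega> K] by blast+
  qed
  have Rr: "continuous_on UNIV (Rr b)" "integrable lborel (Rr b)" if b: "b \<in> Basis" for b
  proof -
    have "continuous_on \<Omega> (Rr b)" unfolding Rr_def
      by (intro continuous_intros X(2) sub C2(3-5) b)
    moreover have "Rr b x = 0" if "x \<notin> K" for x using zero that by (simp add: Rr_def)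
    ultimately show "continuous_on UNIV (Rr b)" "integrable lborel (Rr b)"
      using continuous_zero_outside[OF \<Omega> K] by blast+
  qed
  have main: "(\<integral>x. L b x \<partial>lborel) = (\<integral>x. Rr b x \<partial>lborel)" if b: "b \<in> Basis" for b
  proof -
    define F where "F x = \<psi> x * q x * partial_deriv b \<phi> x - \<phi> x * (X x \<bullet> b)" for x
    have "continuous_on \<Omega> F" unfolding F_def
      by (intro continuous_intros \<psi>_cont q_cont X_cont sub C2(3-5) b)
    moreover have F0: "F x = 0" if "x \<notin> K" for x using zero that by (simp add: F_def)
    ultimately have F: "continuous_on UNIV F"
      using continuous_zero_outside[OF \<Omega> K] by blast
    have "(\<integral>x. L b x - Rr b x \<partial>lborel) = 0"
    proof (rule integral_directional_derivative_eq_0[OF _ F _ K(1) F0])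
      show "continuous_on UNIV (\<lambda>x. L b x - Rr b x)" by (intro continuous_intros L Rr b)
      show "L b x - Rr b x = 0" if "x \<notin> K" for x using zero that by (simp add: L_def Rr_def)
      show "((\<lambda>s. F (x + s *\<^sub>R b)) has_real_derivative L b x - Rr b x) (at 0)" for x
      proof (cases "x \<in> \<Omega>")
        case True
        let ?d = "\<lambda>v. frechet_derivative \<phi> (at x) v" and ?d2 = "\<lambda>v. frechet_derivative (partial_deriv b \<phi>) (at x) v"
        have "(F has_derivative (\<lambda>v. (\<psi> x * q x * ?d2 v + (\<psi> x * (gq x \<bullet> v) + (gpsi x \<bullet> v) * q x) * partial_deriv b \<phi> x)
            - (\<phi> x * (X' x v \<bullet> b) + ?d v * (X x \<bullet> b)))) (at x)"
          unfolding F_def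
          by (intro has_derivative_diff has_derivative_mult has_derivative_inner_left \<psi>[OF True] q(1)[OF True] C2(1) C2(2)[OF b] X(1)[OF True])
        from has_derivative_line[OF this, of b]
        show ?thesis
          by (rule DERIV_cong)
             (simp add: L_def Rr_def flux[OF True] partial_deriv_def algebra_simps)
      next
        case False
        then have x: "x \<in> - K" using K by auto
        have "open (- K)" using K(1) by (simp add: compact_imp_closed open_Compl)
        then have "(F has_derivative (\<lambda>_. 0)) (at x)"
          by (rule has_derivative_transform_within_open[OF has_derivative_const[of 0] _ x])
             (use F0 in auto)
        from has_derivative_line[OF this, of b]
        show ?thesis using x zero by (simp add: L_def Rr_def)
      qed
    qed
    then show ?thesis using L(2)[OF b] Rr(2)[OF b] by simp
  qed
  have "(\<integral>x. \<psi> x * (q x * laplacian \<phi> x + gq x \<bullet> gradient \<phi> x) \<partial>lebesgue) = (\<integral>x. (\<Sum>b\<in>Basis. L b x) \<partial>lebesgue)"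
    by (intro Bochner_Integration.integral_cong refl)
       (simp add: L_def laplacian_def gradient_def inner_sum_right sum_distrib_left sum.distrib algebra_simps)
  also have "\<dots> = (\<integral>x. (\<Sum>b\<in>Basis. L b x) \<partial>lborel)"
    by (rule integral_completion)
       (auto intro!: borel_measurable_sum borel_measurable_continuous_onI[OF L(1)])
  also have "\<dots> = (\<Sum>b\<in>Basis. \<integral>x. L b x \<partial>lborel)" by (rule Bochner_Integration.integral_sum[OF L(2)])
  also have "\<dots> = (\<Sum>b\<in>Basis. \<integral>x. Rr b x \<partial>lborel)" by (rule sum.cong[OF refl main])
  also have "\<dots> = (\<integral>x. (\<Sum>b\<in>Basis. Rr b x) \<partial>lborel)" by (rule Bochner_Integration.integral_sum[OF Rr(2), symmetric])
  also have "\<dots> = (\<integral>x. (\<Sum>b\<in>Basis. Rr b x) \<partial>lebesgue)"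
    by (rule integral_completion[symmetric])
       (auto intro!: borel_measurable_sum borel_measurable_continuous_onI[OF Rr(1)])
  finally show ?thesis by (simp add: Rr_def sum_distrib_right)
qed

section \<open>Green's identity for radial functions\<close>

lemma has_derivative_compose_norm:
  fixes x :: "'a::euclidean_space"
  assumes "x \<noteq> 0" "(g has_real_derivative g') (at (norm x))"
  shows "((\<lambda>x. g (norm x)) has_derivative (\<lambda>v. ((g' / norm x) *\<^sub>R x) \<bullet> v)) (at x)"
proof -
  have "((\<lambda>x. g (norm x)) has_derivative (\<lambda>v. g' * (v \<bullet> sgn x))) (at x)"
    by (rule has_derivative_compose[OF has_derivative_norm[OF assms(1)]])
       (use assms(2) in \<open>simp add: has_field_derivative_def\<close>)
  moreover have "g' * (v \<bullet> sgn x) = ((g' / norm x) *\<^sub>R x) \<bullet> v" for v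
    by (simp add: sgn_div_norm inner_commute divide_inverse)
  ultimately show ?thesis by simp
qed

text \<open>One statement for both spaces: \<open>P\<close> is the conformal factor and
  \<open>\<theta>\<close> sends the Euclidean radius to the enclosed volume. If
  \<open>m * r ^ (n - 1)\<close> is the area of the Euclidean sphere of radius \<open>r\<close>, the
  assumption on \<open>H\<close> says that \<open>G\<close> is the total flux of
  \<open>q grad \<Psi>\<close> through the sphere enclosing a given volume. The divergence is then
  \<open>G'\<close> per unit of that volume, and \<open>P ^ n\<close> is the density of that
  volume.\<close>

lemma radial_Green:
  fixes \<phi> q P :: "'a::euclidean_space \<Rightarrow> real" and gq :: "'a \<Rightarrow> 'a"
  assumes \<phi>: "\<phi> \<in> test_functions \<Omega>" and \<Omega>: "open \<Omega>" and n: "2 \<le> DIM('a)" and m: "m > 0"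
    and \<theta>: "\<And>x. x \<in> \<Omega> \<Longrightarrow> x \<noteq> 0 \<Longrightarrow>
        (\<theta> has_real_derivative m * norm x ^ (DIM('a) - 1) * P x ^ DIM('a)) (at (norm x))"
      "\<And>x. x \<in> \<Omega> \<Longrightarrow> x \<noteq> 0 \<Longrightarrow> \<theta> (norm x) > 0"
    and near: "\<delta> > 0" "\<And>x::'a. norm x < \<delta> \<Longrightarrow> \<theta> (norm x) < a"
    and P: "continuous_on \<Omega> P" "\<And>x. x \<in> \<Omega> \<Longrightarrow> P x > 0"
    and q: "\<And>x. x \<in> \<Omega> \<Longrightarrow> q x = P x ^ (DIM('a) - 2)"
      "\<And>x. x \<in> \<Omega> \<Longrightarrow> (q has_derivative (\<lambda>v. gq x \<bullet> v)) (at x)" "continuous_on \<Omega> gq"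
    and G: "\<And>t. t > 0 \<Longrightarrow> (G has_real_derivative G' t) (at t)" "continuous_on {0<..} G'"
      "\<And>t. t < a \<Longrightarrow> G t = 0" "\<And>t. t < a \<Longrightarrow> G' t = 0"
    and \<Psi>: "\<And>t. t > 0 \<Longrightarrow> (\<Psi> has_real_derivative H t) (at t)" "\<And>t. t < a \<Longrightarrow> \<Psi> t = pc"
    and H: "\<And>x. x \<in> \<Omega> \<Longrightarrow> x \<noteq> 0 \<Longrightarrow>
      H (\<theta> (norm x)) = G (\<theta> (norm x)) / (m * (norm x * P x) ^ (DIM('a) - 1))\<^sup>2"
  shows "(\<integral>x. \<Psi> (\<theta> (norm x)) * (q x * laplacian \<phi> x + gq x \<bullet> gradient \<phi> x) \<partial>lebesgue) =
    (\<integral>x. G' (\<theta> (norm x)) * P x ^ DIM('a) * \<phi> x \<partial>lebesgue)"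
proof -
  let ?n = "DIM('a)"
  define d where "d x = m * norm x ^ (?n - 1) * P x ^ ?n" for x
  \<comment> \<open>Makes the radial field \<open>w (norm x) *\<^sub>R x\<close> carry the flux
    \<open>G\<close> through the sphere of radius \<open>norm x\<close>, whose area is counted as
    \<open>m * r ^ (n - 1)\<close>.\<close>
  define w where "w r = G (\<theta> r) / (m * r ^ ?n)" for r
  define w' where "w' x = (G' (\<theta> (norm x)) * d x * (m * norm x ^ ?n)
      - G (\<theta> (norm x)) * (m * (real ?n * norm x ^ (?n - 1)))) / ((m * norm x ^ ?n) * (m * norm x ^ ?n))" for x
  \<comment> \<open>For \<open>norm x < \<delta>\<close> the solution is constant and the flux is 0;
    the case distinction removes the singularity of the norm at the origin.\<close>
  define gpsi where "gpsi x = (if norm x < \<delta> then 0 else (H (\<theta> (norm x)) * d x / norm x) *\<^sub>R x)" for x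
  define X where "X x = w (norm x) *\<^sub>R x" for x :: 'a
  define X' where "X' x v = (if norm x < \<delta> then 0 else w (norm x) *\<^sub>R v + (((w' x / norm x) *\<^sub>R x) \<bullet> v) *\<^sub>R x)" for x v :: 'a
  have far: "x \<noteq> 0" if "\<not> norm x < \<delta>" for x :: 'a using that near(1) by auto
  have near_open: "open {x::'a. norm x < \<delta>}" by (intro open_Collect_less continuous_intros)
  have pw: "r ^ ?n = r * r ^ (?n - 1)" for r :: real using n by (simp flip: power_Suc)
  have pw2: "r ^ (?n - 1) = r * r ^ (?n - 2)" for r :: real
  proof -
    have "?n - 1 = Suc (?n - 2)" using n by simp
    then show ?thesis by (simp only: power_Suc)
  qed
  have w_deriv: "(w has_real_derivative w' x) (at (norm x))" if x: "x \<in> \<Omega>" "x \<noteq> 0" for x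
  proof -
    have "((\<lambda>r. G (\<theta> r)) has_real_derivative G' (\<theta> (norm x)) * d x) (at (norm x))"
      unfolding d_def by (rule DERIV_chain2[OF G(1)[OF \<theta>(2)[OF x]] \<theta>(1)[OF x]])
    moreover have "((\<lambda>r. m * r ^ ?n) has_real_derivative m * (real ?n * norm x ^ (?n - 1))) (at (norm x))"
      using DERIV_cmult[OF DERIV_pow[of ?n "norm x"], of m] by simp
    ultimately have "((\<lambda>r. G (\<theta> r) / (m * r ^ ?n)) has_real_derivative
      (G' (\<theta> (norm x)) * d x * (m * norm x ^ ?n) - G (\<theta> (norm x)) * (m * (real ?n * norm x ^ (?n - 1))))
       / ((m * norm x ^ ?n) * (m * norm x ^ ?n))) (at (norm x))"
      by (rule DERIV_divide) (use m x in simp)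
    then show ?thesis by (simp add: w_def[abs_def] w'_def)
  qed
  have w_0: "w (norm x) = 0" if "norm x < \<delta>" for x :: 'a
    using G(3)[OF near(2)[OF that]] by (simp add: w_def)
  have w'_0: "w' x = 0" if "norm x < \<delta>" for x :: 'a
    using G(3)[OF near(2)[OF that]] G(4)[OF near(2)[OF that]] by (simp add: w'_def)
  have "(\<integral>x. \<Psi> (\<theta> (norm x)) * (q x * laplacian \<phi> x + gq x \<bullet> gradient \<phi> x) \<partial>lebesgue) =
    (\<integral>x. (\<Sum>b\<in>Basis. X' x b \<bullet> b) * \<phi> x \<partial>lebesgue)"
  proof (rule Green_identity[where gpsi = gpsi and X = X, OF \<phi> \<Omega> _ q(2,3)])
    show "((\<lambda>x. \<Psi> (\<theta> (norm x))) has_derivative (\<lambda>v. gpsi x \<bullet> v)) (at x)" if x: "x \<in> \<Omega>" for x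
    proof (cases "norm x < \<delta>")
      case True
      have "((\<lambda>x. \<Psi> (\<theta> (norm x))) has_derivative (\<lambda>_. 0)) (at x)"
        by (rule has_derivative_transform_within_open[OF has_derivative_const[of pc] near_open])
           (use True \<Psi>(2) near(2) in auto)
      then show ?thesis using True by (simp add: gpsi_def)
    next
      case False
      note x0 = far[OF False]
      have "((\<lambda>r. \<Psi> (\<theta> r)) has_real_derivative H (\<theta> (norm x)) * d x) (at (norm x))"
        unfolding d_def by (rule DERIV_chain2[OF \<Psi>(1)[OF \<theta>(2)[OF x x0]] \<theta>(1)[OF x x0]])
      from has_derivative_compose_norm[OF x0 this] show ?thesis using False by (simp add: gpsi_def)
    qed
    show "(X has_derivative X' x) (at x)" if x: "x \<in> \<Omega>" for x
    proof (cases "norm x < \<delta>")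
      case True
      have "(X has_derivative (\<lambda>_. 0)) (at x)"
        by (rule has_derivative_transform_within_open[OF has_derivative_const[of 0] near_open])
           (use True w_0 in \<open>auto simp: X_def\<close>)
      moreover have "X' x = (\<lambda>_. 0)" using True by (simp add: X'_def fun_eq_iff)
      ultimately show ?thesis by simp
    next
      case False
      note x0 = far[OF False]
      have "(X has_derivative (\<lambda>v. w (norm x) *\<^sub>R v + (((w' x / norm x) *\<^sub>R x) \<bullet> v) *\<^sub>R x)) (at x)"
        unfolding X_def
        by (intro has_derivative_scaleR has_derivative_compose_norm x0 w_deriv x has_derivative_ident)
      moreover have "X' x = (\<lambda>v. w (norm x) *\<^sub>R v + (((w' x / norm x) *\<^sub>R x) \<bullet> v) *\<^sub>R x)"
        using False by (simp add: X'_def fun_eq_iff)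
      ultimately show ?thesis by simp
    qed
    show "X x = q x *\<^sub>R gpsi x" if x: "x \<in> \<Omega>" for x
    proof (cases "norm x < \<delta>")
      case True
      then show ?thesis by (simp add: X_def gpsi_def w_0)
    next
      case False
      note x0 = far[OF False]
      define u v where "u = norm x ^ (?n - 1)" and "v = P x ^ (?n - 2)"
      have pos: "u > 0" "v > 0" "P x > 0" using x0 P(2)[OF x] by (auto simp: u_def v_def)
      have "P x ^ ?n = P x * (P x * v)" unfolding pw[of "P x"] pw2[of "P x"] v_def ..
      moreover have "(norm x * P x) ^ (?n - 1) = u * (P x * v)"
        unfolding power_mult_distrib pw2[of "P x"] u_def v_def ..
      ultimately have "q x * (H (\<theta> (norm x)) * d x / norm x) = w (norm x)"
        unfolding q(1)[OF x] H[OF x x0] d_def w_def pw[of "norm x"] u_def[symmetric] v_def[symmetric]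
        using pos x0 m by (simp add: field_simps power2_eq_square)
      then show ?thesis using False by (simp add: X_def gpsi_def)
    qed
    fix b :: 'a assume b: "b \<in> Basis"
    have opn: "open (\<Omega> - {0})" using \<Omega> by (intro open_Diff) auto
    have c\<theta>: "continuous_on (\<Omega> - {0}) (\<lambda>x. \<theta> (norm x))"
      by (intro continuous_at_imp_continuous_on ballI has_derivative_continuous[OF has_derivative_compose_norm[OF _ \<theta>(1)]]) auto
    have cG: "continuous_on {0<..} G"
      by (intro continuous_at_imp_continuous_on ballI DERIV_isCont[OF G(1)]) simp
    have c1: "continuous_on (\<Omega> - {0}) (\<lambda>x. G (\<theta> (norm x)))"
      by (rule continuous_on_compose2[OF cG c\<theta>]) (use \<theta>(2) in auto)
    have c2: "continuous_on (\<Omega> - {0}) (\<lambda>x. G' (\<theta> (norm x)))"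
      by (rule continuous_on_compose2[OF G(2) c\<theta>]) (use \<theta>(2) in auto)
    have c3: "continuous_on (\<Omega> - {0}) P" by (rule continuous_on_subset[OF P(1)]) auto
    have "continuous_on (\<Omega> - {0}) (\<lambda>x. w (norm x) * (b \<bullet> b) + w' x / norm x * (x \<bullet> b) * (x \<bullet> b))"
      unfolding w_def w'_def d_def using m by (intro continuous_intros c1 c2 c3) auto
    then have "continuous_on (\<Omega> - {0}) (\<lambda>x. X' x b \<bullet> b)"
      by (rule continuous_on_eq) (auto simp: X'_def w_0 w'_0 inner_add_left)
    moreover have "continuous_on (\<Omega> \<inter> {x. norm x < \<delta>}) (\<lambda>x. X' x b \<bullet> b)"
      by (rule continuous_on_eq[of _ "\<lambda>_. 0"]) (auto simp: X'_def)
    ultimately have "continuous_on ((\<Omega> - {0}) \<union> (\<Omega> \<inter> {x. norm x < \<delta>})) (\<lambda>x. X' x b \<bullet> b)"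
      by (intro continuous_on_open_Un opn open_Int \<Omega> near_open)
    moreover have "(\<Omega> - {0}) \<union> (\<Omega> \<inter> {x. norm x < \<delta>}) = \<Omega>" using near(1) by auto
    ultimately show "continuous_on \<Omega> (\<lambda>x. X' x b \<bullet> b)" by simp
  qed
  also have "\<dots> = (\<integral>x. G' (\<theta> (norm x)) * P x ^ ?n * \<phi> x \<partial>lebesgue)"
  proof (intro Bochner_Integration.integral_cong refl)
    fix x :: 'a
    obtain K where K: "K \<subseteq> \<Omega>" "\<And>x. x \<notin> K \<Longrightarrow> \<phi> x = 0" using test_functionD[OF \<phi>] by metis
    show "(\<Sum>b\<in>Basis. X' x b \<bullet> b) * \<phi> x = G' (\<theta> (norm x)) * P x ^ ?n * \<phi> x"
    proof (cases "x \<in> \<Omega>")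
      case False
      then show ?thesis using K by auto
    next
      case x: True
      have "(\<Sum>b\<in>Basis. X' x b \<bullet> b) = G' (\<theta> (norm x)) * P x ^ ?n"
      proof (cases "norm x < \<delta>")
        case True
        then show ?thesis using G(4)[OF near(2)[OF True]] by (simp add: X'_def)
      next
        case False
        note x0 = far[OF False]
        define u where "u = norm x ^ (?n - 1)"
        have u: "u > 0" using x0 by (simp add: u_def)
        have "(\<Sum>b\<in>Basis. X' x b \<bullet> b) = (\<Sum>b\<in>Basis. w (norm x) + w' x / norm x * ((x \<bullet> b) * (x \<bullet> b)))"
          using False by (intro sum.cong refl) (simp add: X'_def inner_add_left inner_Basis)
        also have "\<dots> = real ?n * w (norm x) + w' x / norm x * (\<Sum>b\<in>Basis. (x \<bullet> b) * (x \<bullet> b))"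
          by (simp add: sum.distrib sum_distrib_left)
        also have "(\<Sum>b\<in>Basis. (x \<bullet> b) * (x \<bullet> b)) = norm x * norm x"
          by (simp only: euclidean_inner[of x x, symmetric] power2_norm_eq_inner[symmetric] power2_eq_square)
        also have "real ?n * w (norm x) + w' x / norm x * (norm x * norm x) = G' (\<theta> (norm x)) * P x ^ ?n"
          unfolding w_def w'_def d_def pw[of "norm x"] u_def[symmetric]
          using x0 u m by (simp add: field_simps)
        finally show ?thesis .
      qed
      then show ?thesis by simp
    qed
  qed
  finally show ?thesis .
qed

section \<open>Solutions as functions on hyperbolic and on Euclidean space\<close>

locale hyp_space =
  fixes space_type :: "'a::euclidean_space itself"
  assumes dim: "4 \<le> DIM('a)"
begin

sublocale volume_profile "DIM('a)" "unit_ball_vol (real DIM('a))" "hyp_sinh DIM('a) (unit_ball_vol (real DIM('a)))"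
  by (rule hyp_profile[OF dim unit_ball_vol_nat_pos])

lemma dim2: "2 \<le> DIM('a)" using dim by simp

lemma sg_pos: "(unit_ball_vol (real DIM('a))) > 0" by (rule unit_ball_vol_nat_pos)

lemma hyp_sinh_vol:
  assumes "0 \<le> r" "r < 1"
  shows "hyp_sinh DIM('a) (unit_ball_vol (real DIM('a))) (hyp_vol DIM('a) (unit_ball_vol (real DIM('a))) r) = r * (2 / (1 - r\<^sup>2))"
  using hyp_rad_vol[OF dim2 sg_pos assms] by (simp add: hyp_sinh_def)

lemma A_eq: "t > 0 \<Longrightarrow> A t = (real DIM('a) * (unit_ball_vol (real DIM('a))) * hyp_sinh DIM('a) (unit_ball_vol (real DIM('a))) t ^ (DIM('a) - 1))\<^sup>2"
proof -
  assume t: "t > 0"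
  have "hyp_sinh DIM('a) (unit_ball_vol (real DIM('a))) t ^ DIM('a) = hyp_sinh DIM('a) (unit_ball_vol (real DIM('a))) t * hyp_sinh DIM('a) (unit_ball_vol (real DIM('a))) t ^ (DIM('a) - 1)"
    using dim by (simp flip: power_Suc)
  then show ?thesis using S_pos[OF t] by (simp add: A_def W_def)
qed

text \<open>Since \<open>conf\<close> has gradient \<open>conf\<^sup>2 x\<close>, the product
  \<open>conf ^ n * hyp_laplacian \<phi>\<close> is the Euclidean divergence of
  \<open>conf ^ (n - 2) grad \<phi>\<close>, and \<open>conf ^ n\<close> is the volume density. This
  is the case \<open>q = conf ^ (n - 2)\<close>, \<open>G = F\<close> of
  \<open>radial_Green\<close>.\<close>

lemma hyp_Green:
  fixes \<phi> :: "'a \<Rightarrow> real"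
  assumes sol: "solution a b f F \<Psi>" and \<phi>: "\<phi> \<in> test_functions (ball 0 1)"
  shows "(\<integral>x. \<phi> x * f (hvol x) \<partial>hyp_measure) = (\<integral>x. \<Psi> (hvol x) * hyp_laplacian \<phi> x \<partial>hyp_measure)"
proof -
  let ?q = "\<lambda>x::'a. conf x ^ (DIM('a) - 2)" and ?gq = "\<lambda>x::'a. ((real DIM('a) - 2) * conf x ^ (DIM('a) - 1)) *\<^sub>R x"
  note s = solutionD[OF sol]
  obtain p0 where p0: "\<forall>t\<le>a. \<Psi> t = p0" using s(8) ..
  \<comment> \<open>The Euclidean radius of the ball of volume \<open>a\<close>, inside which the
    solution is constant.\<close>
  obtain \<delta> where \<delta>: "0 \<le> \<delta>" "\<delta> < 1" "hyp_vol DIM('a) (unit_ball_vol (real DIM('a))) \<delta> = a"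
    using hyp_vol_surj[OF dim2 sg_pos less_imp_le[OF s(1)]] by blast
  have \<delta>0: "\<delta> > 0" using \<delta> s(1) by (cases "\<delta> = 0") auto
  have npos: "1 - (norm x)\<^sup>2 > 0" if "x \<in> ball 0 1" for x :: 'a
    using power2_less_1[of "norm x"] that by simp
  have conf_cont: "continuous_on (ball 0 1) (conf :: 'a \<Rightarrow> real)"
    unfolding conf_def using npos by (intro continuous_intros) force
  have conf_deriv: "(conf has_derivative (\<lambda>v. ((conf x)\<^sup>2 *\<^sub>R x) \<bullet> v)) (at x)" if x: "x \<in> ball 0 1" for x :: 'a
  proof -
    have 1: "((\<lambda>x. x \<bullet> x) has_derivative (\<lambda>v. x \<bullet> v + v \<bullet> x)) (at x)"
      by (intro has_derivative_inner has_derivative_ident)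
    have d: "((\<lambda>r. 2 / (1 - r)) has_real_derivative 2 / (1 - x \<bullet> x)\<^sup>2) (at (x \<bullet> x))"
      using DERIV_divide[OF DERIV_const DERIV_diff[OF DERIV_const DERIV_ident], of 1 "x \<bullet> x" 2] npos[OF x]
      by (simp add: power2_eq_square flip: power2_norm_eq_inner)
    have "((\<lambda>x. 2 / (1 - x \<bullet> x)) has_derivative (\<lambda>v. 2 / (1 - x \<bullet> x)\<^sup>2 * (x \<bullet> v + v \<bullet> x))) (at x)"
      by (rule has_derivative_compose[OF 1 d[unfolded has_field_derivative_def]])
    moreover have "(\<lambda>x::'a. 2 / (1 - x \<bullet> x)) = conf" by (simp add: conf_def power2_norm_eq_inner fun_eq_iff)
    moreover have "2 / (1 - x \<bullet> x)\<^sup>2 * (x \<bullet> v + v \<bullet> x) = ((conf x)\<^sup>2 *\<^sub>R x) \<bullet> v" for v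
      by (simp add: conf_def power2_norm_eq_inner power_divide inner_commute)
    ultimately show ?thesis by simp
  qed
  have Green: "(\<integral>x. \<Psi> (hyp_vol DIM('a) (unit_ball_vol (real DIM('a))) (norm x)) * (?q x * laplacian \<phi> x + ?gq x \<bullet> gradient \<phi> x) \<partial>lebesgue) =
    (\<integral>x. f (hyp_vol DIM('a) (unit_ball_vol (real DIM('a))) (norm x)) * conf x ^ DIM('a) * \<phi> x \<partial>lebesgue)"
  proof (rule radial_Green[where a = a and pc = p0 and G = F and H = "\<lambda>t. F t / A t" and
        m = "real DIM('a) * (unit_ball_vol (real DIM('a)))" and \<delta> = \<delta>, OF \<phi> open_ball dim2])
    fix x :: 'a assume x: "x \<in> ball 0 1"
    then show "conf x > 0" by (rule conf_pos)
    show "(?q has_derivative (\<lambda>v. ?gq x \<bullet> v)) (at x)"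
    proof -
      have d: "((\<lambda>r. r ^ (DIM('a) - 2)) has_real_derivative real (DIM('a) - 2) * conf x ^ (DIM('a) - 2 - 1)) (at (conf x))"
        using DERIV_pow[of "DIM('a) - 2" "conf x"] by simp
      have "(?q has_derivative (\<lambda>v. real (DIM('a) - 2) * conf x ^ (DIM('a) - 2 - 1) * (((conf x)\<^sup>2 *\<^sub>R x) \<bullet> v))) (at x)"
        by (rule has_derivative_compose[OF conf_deriv[OF x] d[unfolded has_field_derivative_def]])
      moreover have "conf x ^ (DIM('a) - 2 - 1) * (conf x)\<^sup>2 = conf x ^ (DIM('a) - 1)"
      proof -
        have "DIM('a) - 1 = DIM('a) - 2 - 1 + 2" using dim by simp
        then show ?thesis by (simp only: power_add)
      qed
      then have "real (DIM('a) - 2) * conf x ^ (DIM('a) - 2 - 1) * (((conf x)\<^sup>2 *\<^sub>R x) \<bullet> v) = ?gq x \<bullet> v" for v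
        using dim by (simp add: of_nat_diff mult.assoc[symmetric])
      ultimately show ?thesis by (simp only:)
    qed
    assume x0: "x \<noteq> 0"
    show "(hyp_vol DIM('a) (unit_ball_vol (real DIM('a))) has_real_derivative real DIM('a) * (unit_ball_vol (real DIM('a))) * norm x ^ (DIM('a) - 1) * conf x ^ DIM('a)) (at (norm x))"
      using hyp_vol_deriv[of "norm x" "DIM('a)" "unit_ball_vol (real DIM('a))"] x x0 by (simp add: hyp_density_def conf_def)
    show v: "0 < hyp_vol DIM('a) (unit_ball_vol (real DIM('a))) (norm x)"
      using hyp_vol_less[of "DIM('a)" "unit_ball_vol (real DIM('a))" 0 "norm x"] x x0 sg_pos by simp
    have "hyp_sinh DIM('a) (unit_ball_vol (real DIM('a))) (hyp_vol DIM('a) (unit_ball_vol (real DIM('a))) (norm x)) = norm x * conf x"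
      unfolding conf_def using x by (intro hyp_sinh_vol) auto
    then show "F (hyp_vol DIM('a) (unit_ball_vol (real DIM('a))) (norm x)) / A (hyp_vol DIM('a) (unit_ball_vol (real DIM('a))) (norm x)) =
        F (hyp_vol DIM('a) (unit_ball_vol (real DIM('a))) (norm x)) / (real DIM('a) * (unit_ball_vol (real DIM('a))) * (norm x * conf x) ^ (DIM('a) - 1))\<^sup>2"
      using A_eq[OF v] by simp
  next
    show "continuous_on (ball 0 1) ?gq" by (intro continuous_intros conf_cont)
    show "hyp_vol DIM('a) (unit_ball_vol (real DIM('a))) (norm x) < a" if "norm x < \<delta>" for x :: 'a
      using that \<delta> hyp_vol_less[of "DIM('a)" "unit_ball_vol (real DIM('a))" "norm x" \<delta>] sg_pos by simp
    show "continuous_on {0<..} f" by (rule continuous_on_subset[OF s(3)]) simp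
    show "0 < real DIM('a) * (unit_ball_vol (real DIM('a)))" using sg_pos by simp
  qed (use \<delta>0 conf_cont s p0 in auto)
  have f_borel: "f \<in> borel_measurable borel" and P_borel: "\<Psi> \<in> borel_measurable borel"
    using solution_continuous[OF sol] by (auto intro: borel_measurable_continuous_onI)
  note C2 = test_function_C2[OF \<phi>]
  have sub: "continuous_on (ball 0 1) g" if "continuous_on UNIV g" for g :: "'a \<Rightarrow> real"
    by (rule continuous_on_subset[OF that]) simp
  have "\<phi> \<in> borel_measurable hyp_measure"
    unfolding measurable_hyp by (rule continuous_imp_measurable_on_sets_lebesgue[OF sub[OF C2(3)]]) simp
  then have m1: "(\<lambda>x. \<phi> x * f (hvol x)) \<in> borel_measurable hyp_measure"
    using f_borel by measurable
  have "continuous_on (ball 0 1) (hyp_laplacian \<phi>)"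
    unfolding hyp_laplacian_def laplacian_def gradient_def
    by (intro continuous_intros sub[OF C2(4)] sub[OF C2(5)]) auto
  then have "hyp_laplacian \<phi> \<in> borel_measurable hyp_measure"
    unfolding measurable_hyp by (rule continuous_imp_measurable_on_sets_lebesgue) simp
  then have m2: "(\<lambda>x. \<Psi> (hvol x) * hyp_laplacian \<phi> x) \<in> borel_measurable hyp_measure"
    using P_borel by measurable
  obtain K where K: "K \<subseteq> ball 0 1" and zero: "\<And>x. x \<notin> K \<Longrightarrow> \<phi> x = 0"
    "\<And>x b. x \<notin> K \<Longrightarrow> partial_deriv b \<phi> x = 0"
    "\<And>x b c. x \<notin> K \<Longrightarrow> partial_deriv c (partial_deriv b \<phi>) x = 0"
    using test_functionD[OF \<phi>] by metis
  have lap0: "laplacian \<phi> x = 0" "gradient \<phi> x = 0" if "x \<notin> ball 0 1" for x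
  proof -
    have "x \<notin> K" using that K by blast
    then show "laplacian \<phi> x = 0" "gradient \<phi> x = 0"
      by (auto simp: laplacian_def gradient_def zero)
  qed
  have "(\<integral>x. \<phi> x * f (hvol x) \<partial>hyp_measure) = (\<integral>x. f (hyp_vol DIM('a) (unit_ball_vol (real DIM('a))) (norm x)) * conf x ^ DIM('a) * \<phi> x \<partial>lebesgue)"
    unfolding integral_hyp[OF m1]
  proof (intro Bochner_Integration.integral_cong refl)
    fix x :: 'a
    have "\<phi> x = 0" if "x \<notin> ball 0 1" using that K zero by blast
    then show "indicator (ball 0 1) x * (conf x ^ DIM('a) * (\<phi> x * f (hvol x))) =
        f (hyp_vol DIM('a) (unit_ball_vol (real DIM('a))) (norm x)) * conf x ^ DIM('a) * \<phi> x"
      by (cases "x \<in> ball 0 1") (auto simp: hvol_def)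
  qed
  also have "\<dots> = (\<integral>x. \<Psi> (hyp_vol DIM('a) (unit_ball_vol (real DIM('a))) (norm x)) * (?q x * laplacian \<phi> x + ?gq x \<bullet> gradient \<phi> x) \<partial>lebesgue)"
    by (rule Green[symmetric])
  also have "\<dots> = (\<integral>x. \<Psi> (hvol x) * hyp_laplacian \<phi> x \<partial>hyp_measure)"
    unfolding integral_hyp[OF m2]
  proof (intro Bochner_Integration.integral_cong refl)
    fix x :: 'a
    show "\<Psi> (hyp_vol DIM('a) (unit_ball_vol (real DIM('a))) (norm x)) * (?q x * laplacian \<phi> x + ?gq x \<bullet> gradient \<phi> x) =
      indicator (ball 0 1) x * (conf x ^ DIM('a) * (\<Psi> (hvol x) * hyp_laplacian \<phi> x))"
    proof (cases "x \<in> ball 0 1")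
      case True
      define c where "c = conf x"
      have c: "c > 0" using conf_pos[OF True] c_def by simp
      have i: "(1 - (norm x)\<^sup>2) / 2 = 1 / c" by (simp add: c_def conf_def)
      have e: "1 + (DIM('a) - 1) = DIM('a)" "2 + (DIM('a) - 2) = DIM('a)" using dim by auto
      have c1: "c ^ DIM('a) = c * c ^ (DIM('a) - 1)" "c ^ DIM('a) = c\<^sup>2 * c ^ (DIM('a) - 2)"
        using power_add[of c 1 "DIM('a) - 1"] power_add[of c 2 "DIM('a) - 2"]
        unfolding e power_one_right by auto
      have "c ^ DIM('a) * hyp_laplacian \<phi> x = c ^ DIM('a) * (1 / c)\<^sup>2 * laplacian \<phi> x + (real DIM('a) - 2) * (c ^ DIM('a) * (1 / c)) * (x \<bullet> gradient \<phi> x)"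
        unfolding hyp_laplacian_def i by (simp add: algebra_simps)
      also have "c ^ DIM('a) * (1 / c)\<^sup>2 = c ^ (DIM('a) - 2)" unfolding c1(2) using c by (simp add: power_divide)
      also have "c ^ DIM('a) * (1 / c) = c ^ (DIM('a) - 1)" unfolding c1(1) using c by simp
      finally show ?thesis using True by (simp add: hvol_def c_def[symmetric])
    qed (simp add: lap0)
  qed
  finally show ?thesis .
qed

text \<open>The ratio of weights is the ratio of the squared areas of the Euclidean and the
  hyperbolic sphere enclosing the same volume.\<close>

lemma k_evol:
  assumes "r > 0"
  shows "k ((unit_ball_vol (real DIM('a))) * r ^ DIM('a)) = (r / hyp_sinh DIM('a) (unit_ball_vol (real DIM('a))) ((unit_ball_vol (real DIM('a))) * r ^ DIM('a))) ^ (2 * (DIM('a) - 1))"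
proof -
  define h where "h = hyp_sinh DIM('a) (unit_ball_vol (real DIM('a))) ((unit_ball_vol (real DIM('a))) * r ^ DIM('a))"
  have h: "h > 0" using S_pos[of "(unit_ball_vol (real DIM('a))) * r ^ DIM('a)"] sg_pos assms by (simp add: h_def)
  have "k ((unit_ball_vol (real DIM('a))) * r ^ DIM('a)) = ((r / h) ^ DIM('a)) powr (2 * c)"
    using less_imp_neq[OF sg_pos] by (simp add: k_def W_def h_def power_divide)
  also have "\<dots> = (r / h) powr (real DIM('a) * (2 * c))"
    using h assms by (simp add: powr_powr flip: powr_realpow)
  also have "real DIM('a) * (2 * c) = real (2 * (DIM('a) - 1))"
    using c_bounds(3) dim by (simp add: of_nat_diff mult.commute)
  also have "(r / h) powr \<dots> = (r / h) ^ (2 * (DIM('a) - 1))"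
    using h assms by (intro powr_realpow) simp
  finally show ?thesis by (simp add: h_def)
qed

text \<open>The case of conformal factor 1. The Euclidean weight is \<open>k A\<close> and the
  solution has derivative \<open>F / A\<close>, so the flux is \<open>k F\<close>, with derivative
  \<open>euclid f F\<close>.\<close>

lemma euclidean_Green:
  fixes \<phi> :: "'a \<Rightarrow> real"
  assumes sol: "solution a b f F \<Psi>" and \<phi>: "\<phi> \<in> test_functions UNIV"
  shows "(\<integral>x. \<Psi> (evol x) * laplacian \<phi> x \<partial>lebesgue) = (\<integral>x. euclid f F (evol x) * \<phi> x \<partial>lebesgue)"
proof -
  note s = solutionD[OF sol]
  obtain p0 where p0: "\<forall>t\<le>a. \<Psi> t = p0" using s(8) ..
  define \<delta> where "\<delta> = root DIM('a) (a / (unit_ball_vol (real DIM('a))))"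
  have \<delta>: "\<delta> > 0" "(unit_ball_vol (real DIM('a))) * \<delta> ^ DIM('a) = a" using s(1) sg_pos less_imp_neq[OF sg_pos] by (auto simp: \<delta>_def)
  have "(\<integral>x. \<Psi> ((unit_ball_vol (real DIM('a))) * norm x ^ DIM('a)) * (1 * laplacian \<phi> x + (0::'a) \<bullet> gradient \<phi> x) \<partial>lebesgue) =
    (\<integral>x. euclid f F ((unit_ball_vol (real DIM('a))) * norm x ^ DIM('a)) * 1 ^ DIM('a) * \<phi> x \<partial>lebesgue)"
  proof (rule radial_Green[where a = a and pc = p0 and G = "\<lambda>t. k t * F t" and H = "\<lambda>t. F t / A t" and
        m = "real DIM('a) * (unit_ball_vol (real DIM('a)))" and \<delta> = \<delta> and \<theta> = "\<lambda>r. (unit_ball_vol (real DIM('a))) * r ^ DIM('a)", OF \<phi> open_UNIV dim2])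
    show "((\<lambda>r. (unit_ball_vol (real DIM('a))) * r ^ DIM('a)) has_real_derivative real DIM('a) * (unit_ball_vol (real DIM('a))) * norm x ^ (DIM('a) - 1) * 1 ^ DIM('a)) (at (norm x))" for x :: 'a
      using DERIV_cmult[OF DERIV_pow[of "DIM('a)" "norm x"], of "unit_ball_vol (real DIM('a))"] by (simp add: mult_ac)
    show "0 < (unit_ball_vol (real DIM('a))) * norm x ^ DIM('a)" if "x \<noteq> 0" for x :: 'a using that sg_pos by simp
    show "(unit_ball_vol (real DIM('a))) * norm x ^ DIM('a) < a" if "norm x < \<delta>" for x :: 'a
      unfolding \<delta>(2)[symmetric] using that sg_pos by (intro mult_strict_left_mono power_strict_mono) auto
    show "((\<lambda>t. k t * F t) has_real_derivative euclid f F t) (at t)" if "t > 0" for t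
      using DERIV_mult[OF k_deriv[OF that] s(5)] by (rule DERIV_cong) (use that in \<open>simp add: euclid_def\<close>)
    show "continuous_on {0<..} (euclid f F)" by (rule euclid_continuous[OF sol])
    show "k t * F t = 0" if "t < a" for t using s(6) that by simp
    show "euclid f F t = 0" if "t < a" for t using s(4)[of t] s(6)[of t] that by (simp add: euclid_def)
    fix x :: 'a assume x: "x \<noteq> 0"
    define h where "h = hyp_sinh DIM('a) (unit_ball_vol (real DIM('a))) ((unit_ball_vol (real DIM('a))) * norm x ^ DIM('a))"
    have t: "0 < (unit_ball_vol (real DIM('a))) * norm x ^ DIM('a)" using x sg_pos by simp
    have h: "h > 0" using S_pos[OF t] by (simp add: h_def)
    have "k ((unit_ball_vol (real DIM('a))) * norm x ^ DIM('a)) / (real DIM('a) * (unit_ball_vol (real DIM('a))) * norm x ^ (DIM('a) - 1))\<^sup>2 = 1 / A ((unit_ball_vol (real DIM('a))) * norm x ^ DIM('a))"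
    proof -
      define u z where "u = norm x ^ (DIM('a) - 1)" and "z = h ^ (DIM('a) - 1)"
      have uz: "u > 0" "z > 0" using x h by (auto simp: u_def z_def)
      have "(norm x / h) ^ (2 * (DIM('a) - 1)) = (u / z)\<^sup>2"
        by (simp add: u_def z_def power_divide mult.commute flip: power_mult)
      then show ?thesis
        unfolding A_eq[OF t] k_evol[OF zero_less_norm_iff[THEN iffD2, OF x]]
          h_def[symmetric] u_def[symmetric] z_def[symmetric]
        using uz less_imp_neq[OF sg_pos] by (simp add: power_divide power_mult_distrib)
    qed
    moreover have "z / p = w * z / d" if "w / d = 1 / p" for z p w d :: real
    proof -
      have "w * z / d = z * (w / d)" by simp
      then show ?thesis unfolding that by simp
    qed
    ultimately show "F ((unit_ball_vol (real DIM('a))) * norm x ^ DIM('a)) / A ((unit_ball_vol (real DIM('a))) * norm x ^ DIM('a)) =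
        k ((unit_ball_vol (real DIM('a))) * norm x ^ DIM('a)) * F ((unit_ball_vol (real DIM('a))) * norm x ^ DIM('a)) / (real DIM('a) * (unit_ball_vol (real DIM('a))) * (norm x * 1) ^ (DIM('a) - 1))\<^sup>2"
      unfolding mult_1_right by blast
  qed (use \<delta> s p0 sg_pos in auto)
  then show ?thesis by (simp add: evol_def)
qed

end

section \<open>Radial functions and null sets\<close>

lemma AE_lebesgue_iff_negligible: "(AE x in lebesgue. P x) \<longleftrightarrow> negligible {x::'a::euclidean_space. \<not> P x}"
  by (simp add: completion.AE_iff_null_sets negligible_iff_null_sets)

text \<open>Inner regularity: up to measure \<open>e\<close> the set is closed, and a closed set is
  a countable union of compact ones.\<close>

lemma negligible_if_compact_subsets:
  fixes E :: "'a::euclidean_space set"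
  assumes E: "E \<in> sets lebesgue" and K: "\<And>K. compact K \<Longrightarrow> K \<subseteq> E \<Longrightarrow> negligible K"
  shows "negligible E"
proof -
  have le: "emeasure lebesgue E \<le> ennreal e" if e: "e > 0" for e
  proof -
    obtain T where T: "closed T" "T \<subseteq> E" "E - T \<in> lmeasurable" "emeasure lebesgue (E - T) < ennreal e"
      using sets_lebesgue_inner_closed[OF E e] by blast
    have "T = (\<Union>j::nat. T \<inter> cball 0 (real j))"
      using real_arch_simple by auto
    moreover have "negligible (\<Union>j::nat. T \<inter> cball 0 (real j))"
    proof (rule negligible_countable_Union)
      fix S assume "S \<in> range (\<lambda>j::nat. T \<inter> cball 0 (real j))"
      then obtain j :: nat where S: "S = T \<inter> cball 0 (real j)" by blast
      show "negligible S"
        unfolding S by (rule K) (use T closed_Int_compact[OF T(1) compact_cball] in auto)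
    qed simp
    ultimately have "negligible T" by simp
    then have "emeasure lebesgue T = 0" by (simp add: negligible_iff_null_sets null_setsD1)
    have "emeasure lebesgue E = emeasure lebesgue (T \<union> (E - T))"
      using T(2) by (simp add: Un_absorb1)
    also have "\<dots> \<le> emeasure lebesgue T + emeasure lebesgue (E - T)"
      by (rule emeasure_subadditive) (use T fmeasurableD in auto)
    also have "\<dots> \<le> ennreal e" using T(4) \<open>emeasure lebesgue T = 0\<close> by simp
    finally show ?thesis .
  qed
  have "emeasure lebesgue E \<le> 0"
    by (rule ennreal_le_epsilon) (use le in simp)
  then have "E \<in> null_sets lebesgue" using E by (auto simp: null_sets_def)
  then show ?thesis by (simp add: negligible_iff_null_sets)
qed

text \<open>For compact \<open>K\<close> these functions decrease to the indicator of
  \<open>K\<close> as \<open>m\<close> grows, so \<open>bump K \<delta> 0\<close> dominates all of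
  them. The width \<open>\<delta>\<close> keeps the supports away from 0.\<close>

definition bump where
  "bump K \<delta> m t = max 0 (1 - real (Suc m) * (infdist t K / \<delta>))"

lemma bump_bounds: "\<delta> > 0 \<Longrightarrow> 0 \<le> bump K \<delta> m t" "\<delta> > 0 \<Longrightarrow> bump K \<delta> m t \<le> bump K \<delta> 0 t"
proof -
  assume d: "\<delta> > 0"
  show "0 \<le> bump K \<delta> m t" by (simp add: bump_def)
  have "infdist t K / \<delta> \<le> real (Suc m) * (infdist t K / \<delta>)"
    using d infdist_nonneg[of t K] mult_right_mono[of 1 "real (Suc m)" "infdist t K / \<delta>"] by simp
  then show "bump K \<delta> m t \<le> bump K \<delta> 0 t" by (auto simp: bump_def)
qed

lemma bump_Cc_pos:
  assumes "compact K" "K \<noteq> {}" "K \<subseteq> {\<alpha>..\<beta>}" "\<delta> > 0" "\<alpha> > \<delta>"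
  shows "bump K \<delta> m \<in> Cc_pos"
proof -
  have "continuous_on UNIV (bump K \<delta> m)"
    unfolding bump_def using assms(4) by (intro continuous_intros) auto
  moreover have "bump K \<delta> m t = 0" if t: "t \<notin> {\<alpha> - \<delta>..\<beta> + \<delta>}" for t
  proof -
    have "\<delta> \<le> infdist t K"
      unfolding infdist_notempty[OF assms(2)]
    proof (rule cINF_greatest[OF assms(2)])
      fix s assume "s \<in> K"
      then have "\<alpha> \<le> s" "s \<le> \<beta>" using assms(3) by auto
      then show "\<delta> \<le> dist t s" using t by (auto simp: dist_real_def)
    qed
    then have "1 \<le> infdist t K / \<delta>" using assms(4) by simp
    then have "1 * 1 \<le> real (Suc m) * (infdist t K / \<delta>)" by (intro mult_mono) auto
    then show ?thesis by (simp add: bump_def)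
  qed
  moreover have "\<alpha> \<le> \<beta>" using assms(2,3) by fastforce
  ultimately show ?thesis
    unfolding Cc_pos_def using assms(4,5)
    by (intro CollectI conjI exI[of _ "\<alpha> - \<delta>"] exI[of _ "\<beta> + \<delta>"]) auto
qed

lemma bump_tendsto:
  assumes "compact K" "K \<noteq> {}" "\<delta> > 0"
  shows "(\<lambda>m. bump K \<delta> m t) \<longlonglongrightarrow> indicator K t"
proof (cases "t \<in> K")
  case True
  then show ?thesis by (simp add: bump_def)
next
  case False
  define z where "z = infdist t K / \<delta>"
  have z: "z > 0"
    using infdist_pos_not_in_closed[OF compact_imp_closed[OF assms(1)] assms(2) False] assms(3)
    by (simp add: z_def)
  obtain i where i: "1 < real i * z" using ex_less_of_nat_mult[OF z] by blast
  have "bump K \<delta> m t = 0" if "m \<ge> i" for m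
  proof -
    have "real i * z \<le> real (Suc m) * z" using that z by (intro mult_right_mono) auto
    then show ?thesis using i by (simp add: bump_def z_def[symmetric])
  qed
  then have "\<forall>\<^sub>F m in sequentially. bump K \<delta> m t = 0" by (auto simp: eventually_sequentially)
  then show ?thesis using False by (simp add: tendsto_eventually)
qed

context hyp_space
begin

lemma hvol_pos: "x \<in> ball (0::'a) 1 \<Longrightarrow> x \<noteq> 0 \<Longrightarrow> hvol x > 0"
  using hyp_vol_less[of "DIM('a)" "unit_ball_vol (real DIM('a))" 0 "norm x"] sg_pos
  by (simp add: hvol_def)

lemma Cc_pos_hvol_L2: "f \<in> Cc_pos \<Longrightarrow> (\<lambda>x::'a. f (hvol x)) \<in> L2 hyp_measure"
  by (rule L2_transport[OF distr_hvol[OF dim2] hvol_measurable Cc_pos_L2])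

text \<open>No measurability of \<open>d\<close> is available, so the set where \<open>d\<close> is
  positive cannot be tested on the half-line. Instead a compact \<open>K\<close> of points with
  \<open>d (hvol x) > 0\<close> is mapped to the compact \<open>Kc\<close>. As \<open>d > 0\<close>
  on all of \<open>Kc\<close>, \<open>D\<close> is almost everywhere positive on the preimage of
  \<open>Kc\<close>, but orthogonality, extended from bumps to the indicator of \<open>Kc\<close>,
  makes its integral there 0. The preimage is therefore null, and it contains
  \<open>K\<close>.\<close>

lemma radial_orthogonal_nonpos:
  fixes D :: "'a \<Rightarrow> real"
  assumes D: "D \<in> L2 hyp_measure" and d: "AE x in hyp_measure. D x = d (hvol x)"
    and orth: "\<And>f. f \<in> Cc_pos \<Longrightarrow> (\<integral>x. D x * f (hvol x) \<partial>hyp_measure) = 0"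
  shows "AE x in hyp_measure. \<not> D x > 0"
proof -
  define E where "E = {x \<in> ball (0::'a) 1 - {0}. d (hvol x) > 0}"
  define Z where "Z = insert 0 {x. \<not> (x \<in> ball (0::'a) 1 \<longrightarrow> D x = d (hvol x))}"
  have "negligible {x. \<not> (x \<in> ball (0::'a) 1 \<longrightarrow> D x = d (hvol x))}"
    using d unfolding AE_hyp_iff AE_lebesgue_iff_negligible .
  then have Z: "negligible Z" by (simp add: Z_def)
  define E0 where "E0 = {x \<in> ball (0::'a) 1. D x > 0}"
  have "D \<in> borel_measurable (lebesgue_on (ball 0 1))" using D by (simp add: L2_def measurable_hyp)
  then have "{x \<in> space (lebesgue_on (ball 0 1)). D x > 0} \<in> sets (lebesgue_on (ball 0 1))"
    by measurable
  then have "E0 \<in> sets lebesgue" by (simp add: E0_def sets_restrict_space_iff)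
  \<comment> \<open>\<open>E\<close> is measurable because it differs from the measurable
    \<open>E0\<close> only inside the null set \<open>Z\<close>.\<close>
  moreover have "E = (E0 - Z) \<union> (E \<inter> Z)" by (auto simp: E_def E0_def Z_def)
  moreover have "negligible (E \<inter> Z)" using Z negligible_subset by blast
  ultimately have E: "E \<in> sets lebesgue"
    using Z by (metis negligible_imp_sets sets.Diff sets.Un)
  have "negligible E"
  proof (rule negligible_if_compact_subsets[OF E])
    fix K assume K: "compact K" "K \<subseteq> E"
    show "negligible K"
    proof (cases "K = {}")
      case False
      define Kc where "Kc = hvol ` K"
      have "K \<subseteq> ball 0 1" using K by (auto simp: E_def)
      then have Kc: "compact Kc" "Kc \<noteq> {}"
        unfolding Kc_def using K False
        by (auto intro!: compact_continuous_image continuous_on_subset[OF hvol_continuous])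
      obtain \<alpha> where \<alpha>: "\<alpha> \<in> Kc" "\<And>t. t \<in> Kc \<Longrightarrow> \<alpha> \<le> t" using compact_attains_inf[OF Kc] by blast
      obtain \<beta> where \<beta>: "\<beta> \<in> Kc" "\<And>t. t \<in> Kc \<Longrightarrow> t \<le> \<beta>" using compact_attains_sup[OF Kc] by blast
      have "\<alpha> > 0" using \<alpha>(1) K hvol_pos by (auto simp: Kc_def E_def)
      define \<delta> where "\<delta> = \<alpha> / 2"
      have \<delta>: "\<delta> > 0" "\<alpha> > \<delta>" using \<open>\<alpha> > 0\<close> by (auto simp: \<delta>_def)
      have bump: "bump Kc \<delta> m \<in> Cc_pos" for m
        by (rule bump_Cc_pos[OF Kc _ \<delta>]) (use \<alpha> \<beta> in auto)
      have Dm: "D \<in> borel_measurable hyp_measure" using D by (simp add: L2_def)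
      have lim: "(\<lambda>m. \<integral>x. D x * bump Kc \<delta> m (hvol x) \<partial>hyp_measure) \<longlonglongrightarrow>
          (\<integral>x. D x * indicator Kc (hvol x) \<partial>hyp_measure)"
        and int: "integrable hyp_measure (\<lambda>x. D x * indicator Kc (hvol x))"
      proof -
        have m1: "(\<lambda>x. D x * indicator Kc (hvol x)) \<in> borel_measurable hyp_measure"
          using Dm Kc(1) by (intro borel_measurable_times) (auto intro!: measurable_compose[OF hvol_measurable] borel_measurable_indicator borel_compact)
        have m2: "(\<lambda>x. D x * bump Kc \<delta> m (hvol x)) \<in> borel_measurable hyp_measure" for m
          by (intro borel_measurable_times Dm measurable_compose[OF hvol_measurable] Cc_pos_borel bump)
        have w: "integrable hyp_measure (\<lambda>x. norm (D x * bump Kc \<delta> 0 (hvol x)))"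
          by (intro integrable_norm L2_integrable_mult D Cc_pos_hvol_L2 bump)
        have 1: "AE x in hyp_measure. (\<lambda>m. D x * bump Kc \<delta> m (hvol x)) \<longlonglongrightarrow> D x * indicator Kc (hvol x)"
          by (intro AE_I2 tendsto_mult tendsto_const bump_tendsto Kc \<delta>)
        have 2: "AE x in hyp_measure. norm (D x * bump Kc \<delta> m (hvol x)) \<le> norm (D x * bump Kc \<delta> 0 (hvol x))" for m
          using bump_bounds[OF \<delta>(1), of Kc] by (auto simp: abs_mult intro!: AE_I2 mult_left_mono)
        show "(\<lambda>m. \<integral>x. D x * bump Kc \<delta> m (hvol x) \<partial>hyp_measure) \<longlonglongrightarrow>
          (\<integral>x. D x * indicator Kc (hvol x) \<partial>hyp_measure)"
          by (rule integral_dominated_convergence[OF m1 m2 w 1 2])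
        show "integrable hyp_measure (\<lambda>x. D x * indicator Kc (hvol x))"
          by (rule integrable_dominated_convergence[OF m1 m2 w 1 2])
      qed
      have "(\<integral>x. D x * indicator Kc (hvol x) \<partial>hyp_measure) = 0"
        using lim unfolding orth[OF bump] by (simp add: LIMSEQ_const_iff)
      moreover have pos: "d t > 0" if "t \<in> Kc" for t
        using that K by (auto simp: Kc_def E_def)
      have "AE x in hyp_measure. 0 \<le> D x * indicator Kc (hvol x)"
        using d
      proof eventually_elim
        case (elim x)
        then show ?case using pos[of "hvol x"] by (auto simp: indicator_def)
      qed
      ultimately have "AE x in hyp_measure. D x * indicator Kc (hvol x) = 0"
        using integral_nonneg_eq_0_iff_AE[OF int] by blast
      then have "AE x in hyp_measure. hvol (x::'a) \<notin> Kc"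
        using d
      proof eventually_elim
        case (elim x)
        then show ?case using pos[of "hvol x"] by (auto simp: indicator_def split: if_splits)
      qed
      then have "negligible {x. \<not> (x \<in> ball (0::'a) 1 \<longrightarrow> hvol x \<notin> Kc)}"
        unfolding AE_hyp_iff AE_lebesgue_iff_negligible .
      then show ?thesis
        by (rule negligible_subset) (use K in \<open>auto simp: Kc_def E_def\<close>)
    qed simp
  qed
  then have "negligible (E \<union> Z)" using Z by simp
  then show ?thesis
    unfolding AE_hyp_iff AE_lebesgue_iff_negligible
    by (rule negligible_subset) (auto simp: E_def Z_def)
qed

text \<open>For arbitrary \<open>Q\<close> the two image measures say nothing about the exceptional
  sets, which need not come from Borel sets of volumes. The volume-preserving radial map
  \<open>\<Phi>\<close> is differentiable away from the origin and so sends null sets to null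
  sets.\<close>

lemma AE_evol_of_AE_hvol:
  assumes "AE x in hyp_measure. Q (hvol (x::'a))"
  shows "AE y in lebesgue. Q (evol (y::'a))"
proof -
  let ?n = "DIM('a)" and ?s = "unit_ball_vol (real DIM('a))"
  define S where "S = {x. x \<in> ball (0::'a) 1 \<and> x \<noteq> 0 \<and> \<not> Q (hvol x)}"
  \<comment> \<open>Moves \<open>x\<close> along its ray to the point with
    \<open>evol (\<Phi> x) = hvol x\<close>.\<close>
  define \<Phi> where "\<Phi> x = (root ?n (hyp_vol ?n ?s (norm x) / ?s) / norm x) *\<^sub>R x" for x :: 'a
  have "negligible {x. \<not> (x \<in> ball (0::'a) 1 \<longrightarrow> Q (hvol x))}"
    using assms unfolding AE_hyp_iff AE_lebesgue_iff_negligible .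
  then have "negligible S" by (rule negligible_subset) (auto simp: S_def)
  moreover have "\<Phi> differentiable_on S"
  proof (unfold differentiable_on_def, intro ballI)
    fix x assume "x \<in> S"
    then have x: "x \<noteq> 0" "0 < norm x" "norm x < 1" by (auto simp: S_def)
    have p: "0 < hyp_vol ?n ?s (norm x) / ?s"
      using hyp_vol_less[of ?n ?s 0 "norm x"] x sg_pos by simp
    have "((\<lambda>r. hyp_vol ?n ?s r / ?s) has_real_derivative hyp_density ?n ?s (norm x) / ?s) (at (norm x))"
      by (intro DERIV_cdivide hyp_vol_deriv x)
    from DERIV_chain2[OF DERIV_real_root[OF DIM_positive p] this]
    obtain g' where "((\<lambda>r. root ?n (hyp_vol ?n ?s r / ?s)) has_real_derivative g') (at (norm x))" by blast
    from DERIV_divide[OF this DERIV_ident] x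
    obtain g where "((\<lambda>r. root ?n (hyp_vol ?n ?s r / ?s) / r) has_real_derivative g) (at (norm x))" by fastforce
    from has_derivative_scaleR[OF has_derivative_compose_norm[OF x(1) this] has_derivative_ident]
    have "\<Phi> differentiable (at x)" unfolding \<Phi>_def differentiable_def by blast
    then show "\<Phi> differentiable (at x within S)" by (rule differentiable_at_withinI)
  qed
  ultimately have "negligible (\<Phi> ` S)" by (intro negligible_differentiable_image_negligible) auto
  then have "negligible (insert 0 (\<Phi> ` S))" by simp
  then show ?thesis
    unfolding AE_lebesgue_iff_negligible
  proof (rule negligible_subset, intro subsetI)
    fix y :: 'a assume "y \<in> {y. \<not> Q (evol y)}"
    then have Q: "\<not> Q (evol y)" by simp
    show "y \<in> insert 0 (\<Phi> ` S)"
    proof (cases "y = 0")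
      case False
      then have e: "evol y > 0" using sg_pos by (simp add: evol_def)
      define s where "s = hyp_rad ?n ?s (evol y)"
      have s: "0 < s" "s < 1" "hyp_vol ?n ?s s = evol y"
        using hyp_rad[OF dim2 sg_pos less_imp_le[OF e]] hyp_rad_pos[OF dim2 sg_pos e] by (auto simp: s_def)
      define x where "x = (s / norm y) *\<^sub>R y"
      have nx: "norm x = s" using False s by (simp add: x_def)
      have hx: "hvol x = evol y" using s by (simp add: hvol_def nx)
      have "root ?n (evol y / ?s) = norm y"
        using less_imp_neq[OF sg_pos] by (simp add: evol_def real_root_power_cancel)
      then have "\<Phi> x = y" unfolding \<Phi>_def nx s(3) using s False by (simp add: x_def)
      moreover have "x \<in> S" using nx s hx Q by (auto simp: S_def)
      ultimately show ?thesis by blast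
    qed simp
  qed
qed

end

section \<open>The inequality\<close>

lemma L2_lebesgue_locally_integrable:
  fixes f :: "'a::euclidean_space \<Rightarrow> real"
  assumes f: "f \<in> L2 lebesgue"
  shows "locally_integrable f"
  unfolding locally_integrable_def set_integrable_def
proof (intro allI impI)
  fix K :: "'a set" assume K: "compact K"
  have Km: "K \<in> lmeasurable" using K by (rule lmeasurable_compact)
  show "integrable lebesgue (\<lambda>x. indicator K x *\<^sub>R f x)"
  proof (rule Bochner_Integration.integrable_bound)
    show "integrable lebesgue (\<lambda>x. (f x)\<^sup>2 + indicator K x)"
      using f Km by (auto simp: L2_def fmeasurable_def)
    show "(\<lambda>x. indicator K x *\<^sub>R f x) \<in> borel_measurable lebesgue"
      using L2_measurable[OF f] fmeasurableD[OF Km] by measurable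
    have "\<bar>y\<bar> \<le> y\<^sup>2 + 1" for y :: real
      using zero_le_power2[of "\<bar>y\<bar> - 1"] abs_ge_zero[of y] by (simp add: power2_eq_square algebra_simps)
    then show "AE x in lebesgue. norm (indicator K x *\<^sub>R f x) \<le> norm ((f x)\<^sup>2 + indicator K x)"
      by (auto simp: indicator_def intro!: AE_I2)
  qed
qed

lemma continuous_compact_support_L2:
  fixes g :: "'a::euclidean_space \<Rightarrow> real"
  assumes "continuous_on UNIV g" "compact K" "\<And>x. x \<notin> K \<Longrightarrow> g x = 0"
  shows "g \<in> L2 lebesgue"
proof (rule L2I)
  have g: "g \<in> borel_measurable borel" using assms(1) by (rule borel_measurable_continuous_onI)
  then show "g \<in> borel_measurable lebesgue" by (intro measurable_completion) simp
  have "continuous_on UNIV (\<lambda>x. (g x)\<^sup>2)" by (intro continuous_intros assms(1))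
  then have "integrable lborel (\<lambda>x. (g x)\<^sup>2)"
    by (rule continuous_zero_outside(2)[OF open_UNIV assms(2) subset_UNIV]) (simp add: assms(3))
  then show "integrable lebesgue (\<lambda>x. (g x)\<^sup>2)"
    using g by (subst integrable_completion) auto
qed

lemma test_function_L2:
  assumes "\<phi> \<in> test_functions (UNIV :: 'a::euclidean_space set)"
  shows "\<phi> \<in> L2 lebesgue" "laplacian \<phi> \<in> L2 lebesgue"
proof -
  obtain K where K: "compact K" "\<And>x. x \<notin> K \<Longrightarrow> \<phi> x = 0"
    "\<And>x b c. x \<notin> K \<Longrightarrow> partial_deriv c (partial_deriv b \<phi>) x = 0"
    using test_functionD[OF assms] by metis
  note C2 = test_function_C2[OF assms]
  show "\<phi> \<in> L2 lebesgue" by (rule continuous_compact_support_L2[OF C2(3) K(1,2)])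
  show "laplacian \<phi> \<in> L2 lebesgue"
  proof (rule continuous_compact_support_L2[OF _ K(1)])
    show "continuous_on UNIV (laplacian \<phi>)"
      unfolding laplacian_def by (intro continuous_on_sum C2(5))
    show "laplacian \<phi> x = 0" if "x \<notin> K" for x using K(3)[OF that] by (simp add: laplacian_def)
  qed
qed

section \<open>Approximation of the radial function by solutions\<close>

lemma L2_Cauchy_dominated:
  assumes f: "L2_tendsto M f g" and h: "\<And>k. h k \<in> L2 M'" and c: "c > 0"
    and le: "\<And>i j. c * (\<integral>x. (h i x - h j x)\<^sup>2 \<partial>M') \<le> (\<integral>x. (f i x - f j x)\<^sup>2 \<partial>M)"
  obtains l where "L2_tendsto M' h l"
proof -
  have "\<exists>N. \<forall>i\<ge>N. \<forall>j\<ge>N. (\<integral>x. (h i x - h j x)\<^sup>2 \<partial>M') \<le> e" if e: "e > 0" for e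
  proof -
    have "c * e > 0" using e c by simp
    from L2_tendsto_Cauchy[OF f this] obtain N
      where N: "\<forall>i\<ge>N. \<forall>j\<ge>N. (\<integral>x. (f i x - f j x)\<^sup>2 \<partial>M) \<le> c * e" ..
    have "(\<integral>x. (h i x - h j x)\<^sup>2 \<partial>M') \<le> e" if "i \<ge> N" "j \<ge> N" for i j
      using order_trans[OF le[of i j] N[rule_format, OF that]] c by simp
    then show ?thesis by blast
  qed
  from L2_complete[OF h this] show ?thesis using that by blast
qed

context hyp_space
begin

text \<open>Green's identity asks radiality only of the solution, so it applies to every
  approximating test function, and both sides pass to the limit as inner products with fixed
  square-integrable functions.\<close>

lemma solution_pairing:
  fixes u w :: "'a \<Rightarrow> real"
  assumes w: "has_hyp_laplacian u w" and sol: "solution a b f F P"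
  shows "(\<integral>x. u x * f (hvol x) \<partial>hyp_measure) = (\<integral>x. w x * P (hvol x) \<partial>hyp_measure)"
proof -
  obtain \<phi> where \<phi>: "\<And>k. \<phi> k \<in> test_functions (ball 0 1)" "L2_tendsto hyp_measure \<phi> u"
    "L2_tendsto hyp_measure (\<lambda>k. hyp_laplacian (\<phi> k)) w"
    using w unfolding has_hyp_laplacian_def by blast
  have "(\<lambda>k. \<integral>x. \<phi> k x * f (hvol x) \<partial>hyp_measure) \<longlonglongrightarrow> (\<integral>x. u x * f (hvol x) \<partial>hyp_measure)"
    by (rule L2_tendsto_inner[OF \<phi>(2) Cc_pos_hvol_L2[OF solution_Cc_pos[OF sol]]])
  moreover have "(\<lambda>k. \<integral>x. hyp_laplacian (\<phi> k) x * P (hvol x) \<partial>hyp_measure) \<longlonglongrightarrow> (\<integral>x. w x * P (hvol x) \<partial>hyp_measure)"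
    by (rule L2_tendsto_inner[OF \<phi>(3) L2_transport[OF distr_hvol[OF dim2] hvol_measurable solution_energy(2)[OF sol]]])
  ultimately show ?thesis
    using hyp_Green[OF sol \<phi>(1)] by (simp add: mult.commute LIMSEQ_unique)
qed

text \<open>The \<open>g\<close> obtained here is the spherical mean of \<open>w\<close>, as a function of the enclosed volume.\<close>

lemma radial_part:
  fixes w :: "'a \<Rightarrow> real"
  assumes w: "w \<in> L2 hyp_measure"
  obtains f g where "\<And>j. f j \<in> Cc_pos" "L2_tendsto half_line f g"
    "\<And>h. h \<in> Cc_pos \<Longrightarrow> (\<integral>x. w x * h (hvol x) \<partial>hyp_measure) = (\<integral>t. h t * g t \<partial>half_line)"
    "(\<integral>t. (g t)\<^sup>2 \<partial>half_line) \<le> (\<integral>x. (w x)\<^sup>2 \<partial>hyp_measure)"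
proof (rule L2_Riesz[of Cc_pos half_line "\<lambda>h. \<integral>x. w x * h (hvol x) \<partial>hyp_measure" "\<integral>x. (w x)\<^sup>2 \<partial>hyp_measure"])
  show "Cc_pos \<subseteq> L2 half_line" using Cc_pos_L2 by blast
  have "(\<lambda>_. 0) \<in> Cc_pos" by (auto simp: Cc_pos_def intro!: exI[of _ 1])
  then show "Cc_pos \<noteq> {}" by blast
  show "(\<lambda>t. f t + s * g t) \<in> Cc_pos" if "f \<in> Cc_pos" "g \<in> Cc_pos" for f g s
    using that by (rule Cc_pos_lincomb)
  have int: "integrable hyp_measure (\<lambda>x. w x * f (hvol x))" if "f \<in> Cc_pos" for f
    by (intro L2_integrable_mult w Cc_pos_hvol_L2 that)
  show "(\<integral>x. w x * (f (hvol x) + s * g (hvol x)) \<partial>hyp_measure) =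
      (\<integral>x. w x * f (hvol x) \<partial>hyp_measure) + s * (\<integral>x. w x * g (hvol x) \<partial>hyp_measure)"
    if "f \<in> Cc_pos" "g \<in> Cc_pos" for f g s
  proof -
    have "(\<integral>x. w x * (f (hvol x) + s * g (hvol x)) \<partial>hyp_measure) =
        (\<integral>x. w x * f (hvol x) + s * (w x * g (hvol x)) \<partial>hyp_measure)"
      by (intro Bochner_Integration.integral_cong refl) (simp add: algebra_simps)
    also have "\<dots> = (\<integral>x. w x * f (hvol x) \<partial>hyp_measure) + (\<integral>x. s * (w x * g (hvol x)) \<partial>hyp_measure)"
      by (intro Bochner_Integration.integral_add integrable_mult_right int that)
    finally show ?thesis by simp
  qed
  show "(\<integral>x. w x * f (hvol x) \<partial>hyp_measure)\<^sup>2 \<le> (\<integral>x. (w x)\<^sup>2 \<partial>hyp_measure) * (\<integral>t. (f t)\<^sup>2 \<partial>half_line)"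
    if f: "f \<in> Cc_pos" for f
  proof -
    have "(\<integral>x. (f (hvol (x::'a)))\<^sup>2 \<partial>hyp_measure) = (\<integral>t. (f t)\<^sup>2 \<partial>half_line)"
      by (rule integral_transport(1)[OF distr_hvol[OF dim2] hvol_measurable])
         (intro borel_measurable_power L2_measurable Cc_pos_L2 f)
    then show ?thesis using L2_Cauchy_Schwarz[OF w Cc_pos_hvol_L2[OF f]] by simp
  qed
qed (use that in auto)

text \<open>The representation \<open>rep\<close> holds for compact support in the open half-line,
  whereas a solution is constant near 0 and decays like \<open>1 / t\<close>. Multiplication by
  \<open>cutoff m\<close> closes the gap, by dominated convergence on both sides.\<close>

lemma pairing_extend:
  fixes w :: "'a \<Rightarrow> real"
  assumes w: "w \<in> L2 hyp_measure" and g: "g \<in> L2 half_line"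
    and rep: "\<And>h. h \<in> Cc_pos \<Longrightarrow> (\<integral>x. w x * h (hvol x) \<partial>hyp_measure) = (\<integral>t. h t * g t \<partial>half_line)"
    and P: "continuous_on UNIV P" "P \<in> L2 half_line"
  shows "(\<integral>x. w x * P (hvol x) \<partial>hyp_measure) = (\<integral>t. P t * g t \<partial>half_line)"
proof -
  have PT: "(\<lambda>x::'a. P (hvol x)) \<in> L2 hyp_measure"
    by (rule L2_transport[OF distr_hvol[OF dim2] hvol_measurable P(2)])
  have cutoff_m: "cutoff m \<in> borel_measurable borel" for m
    unfolding cutoff_def by measurable
  have bound: "norm (cutoff m t * z) \<le> norm z" for m t and z :: real
    using cutoff_bounds[of m t] by (simp add: abs_mult mult_left_le_one_le)
  have "(\<lambda>m. \<integral>x. cutoff m (hvol x) * (P (hvol x) * w x) \<partial>hyp_measure) \<longlonglongrightarrow> (\<integral>x. P (hvol x) * w x \<partial>hyp_measure)"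
  proof (rule integral_dominated_convergence[where w = "\<lambda>x. norm (P (hvol x) * w x)"])
    have i: "integrable hyp_measure (\<lambda>x. P (hvol x) * w x)" by (intro L2_integrable_mult PT w)
    then show "integrable hyp_measure (\<lambda>x. norm (P (hvol x) * w x))" by (rule integrable_norm)
    show m: "(\<lambda>x. P (hvol x) * w x) \<in> borel_measurable hyp_measure" using i by simp
    show "(\<lambda>x. cutoff m (hvol x) * (P (hvol x) * w x)) \<in> borel_measurable hyp_measure" for m
      by (intro borel_measurable_times measurable_compose[OF hvol_measurable cutoff_m] m)
    \<comment> \<open>The cutoffs tend to 1 only at positive volumes; the exception is the
      origin.\<close>
    have "AE x in hyp_measure. hvol (x::'a) > 0"
    proof -
      have "negligible {x. \<not> (x \<in> ball (0::'a) 1 \<longrightarrow> hvol x > 0)}"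
        by (rule negligible_subset[of "{0}"]) (use hvol_pos in auto)
      then show ?thesis unfolding AE_hyp_iff AE_lebesgue_iff_negligible .
    qed
    then show "AE x in hyp_measure. (\<lambda>m. cutoff m (hvol x) * (P (hvol x) * w x)) \<longlonglongrightarrow> P (hvol x) * w x"
    proof eventually_elim
      case (elim x)
      have "(\<lambda>m. cutoff m (hvol x) * (P (hvol x) * w x)) \<longlonglongrightarrow> 1 * (P (hvol x) * w x)"
        by (intro tendsto_mult tendsto_const cutoff_tendsto elim)
      then show ?case by simp
    qed
  qed (use bound in auto)
  moreover have "(\<lambda>m. \<integral>t. cutoff m t * (P t * g t) \<partial>half_line) \<longlonglongrightarrow> (\<integral>t. P t * g t \<partial>half_line)"
  proof (rule integral_dominated_convergence[where w = "\<lambda>t. norm (P t * g t)"])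
    have i: "integrable half_line (\<lambda>t. P t * g t)" by (intro L2_integrable_mult P(2) g)
    then show "integrable half_line (\<lambda>t. norm (P t * g t))" by (rule integrable_norm)
    show m: "(\<lambda>t. P t * g t) \<in> borel_measurable half_line" using i by simp
    show "(\<lambda>t. cutoff m t * (P t * g t)) \<in> borel_measurable half_line" for m
      by (rule borel_measurable_times[OF _ m]) (simp add: measurable_cong_sets[OF sets_half_line refl] cutoff_m)
    show "AE t in half_line. (\<lambda>m. cutoff m t * (P t * g t)) \<longlonglongrightarrow> P t * g t"
      using AE_half_line
    proof eventually_elim
      case (elim t)
      have "(\<lambda>m. cutoff m t * (P t * g t)) \<longlonglongrightarrow> 1 * (P t * g t)"
        by (intro tendsto_mult tendsto_const cutoff_tendsto elim)
      then show ?case by simp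
    qed
  qed (use bound in auto)
  moreover have "(\<integral>x. cutoff m (hvol x) * (P (hvol x) * w x) \<partial>hyp_measure) = (\<integral>t. cutoff m t * (P t * g t) \<partial>half_line)" for m
    using rep[OF cutoff_Cc_pos[OF P(1), of m]] by (simp add: mult_ac)
  ultimately have "(\<integral>x. P (hvol x) * w x \<partial>hyp_measure) = (\<integral>t. P t * g t \<partial>half_line)"
    by (simp add: LIMSEQ_unique)
  then show ?thesis by (simp add: mult.commute)
qed

text \<open>\<open>P j\<close> solves the equation for \<open>f j\<close>, where \<open>f j\<close>
  tends to the radial part \<open>g\<close> of \<open>w\<close>. By linearity the energy inequality
  for differences makes \<open>P j\<close> and their Euclidean Laplacians Cauchy. The inequality
  survives the limit with \<open>g\<close> on the right, whose norm is at most that of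
  \<open>w\<close>. It remains to see that the limit \<open>V\<close> is \<open>u\<close>, which is
  where the pairing enters.\<close>

lemma approximation:
  fixes u w :: "'a \<Rightarrow> real"
  assumes w: "has_hyp_laplacian u w"
    and rad: "AE x in hyp_measure. u x = v (hvol x)"
  obtains h P V H where
    "\<And>j \<phi>. \<phi> \<in> test_functions (UNIV :: 'a set) \<Longrightarrow>
      (\<integral>x. P j (evol x) * laplacian \<phi> x \<partial>lebesgue) = (\<integral>x. h j (evol x) * \<phi> x \<partial>lebesgue)"
    "L2_tendsto half_line P V" "L2_tendsto half_line h H"
    "AE x in hyp_measure. u x = V (hvol x)"
    "(\<integral>t. (H t)\<^sup>2 \<partial>half_line) + \<kappa> * (\<integral>t. (V t)\<^sup>2 \<partial>half_line) \<le> (\<integral>x. (w x)\<^sup>2 \<partial>hyp_measure)"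
proof -
  have uL2: "u \<in> L2 hyp_measure" and wL2: "w \<in> L2 hyp_measure"
    using w unfolding has_hyp_laplacian_def L2_tendsto_def by blast+
  obtain f g where f: "\<And>j. f j \<in> Cc_pos" and fg: "L2_tendsto half_line f g"
    and rep: "\<And>h. h \<in> Cc_pos \<Longrightarrow> (\<integral>x. w x * h (hvol x) \<partial>hyp_measure) = (\<integral>t. h t * g t \<partial>half_line)"
    and gw: "(\<integral>t. (g t)\<^sup>2 \<partial>half_line) \<le> (\<integral>x. (w x)\<^sup>2 \<partial>hyp_measure)"
    using radial_part[OF wL2] by blast
  have gL2: "g \<in> L2 half_line" using fg by (simp add: L2_tendsto_iff)
  have "\<forall>j. \<exists>a b F P. solution a b (f j) F P" using solution_exists[OF f] by metis
  then obtain a b F P where sol: "\<And>j. solution (a j) (b j) (f j) (F j) (P j)" by metis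
  define h where "h j = euclid (f j) (F j)" for j
  note energy = solution_energy[OF sol]
  have diff: "(\<integral>t. (h i t - h j t)\<^sup>2 \<partial>half_line) + \<kappa> * (\<integral>t. (P i t - P j t)\<^sup>2 \<partial>half_line)
      \<le> (\<integral>t. (f i t - f j t)\<^sup>2 \<partial>half_line)" for i j
  proof -
    have "euclid (\<lambda>t. f i t - f j t) (\<lambda>t. F i t - F j t) t = h i t - h j t" for t
      by (simp add: euclid_def h_def algebra_simps)
    then show ?thesis using solution_energy(3)[OF solution_diff[OF sol[of i] sol[of j]]] by simp
  qed
  have hL2: "h j \<in> L2 half_line" for j unfolding h_def by (rule energy(1))
  obtain V where V: "L2_tendsto half_line P V"
  proof (rule L2_Cauchy_dominated[OF fg energy(2) \<kappa>_pos])
    show "\<kappa> * (\<integral>t. (P i t - P j t)\<^sup>2 \<partial>half_line) \<le> (\<integral>t. (f i t - f j t)\<^sup>2 \<partial>half_line)" for i j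
      by (rule order_trans[OF _ diff]) (use \<kappa>_pos in simp)
  qed
  obtain H where H: "L2_tendsto half_line h H"
  proof (rule L2_Cauchy_dominated[OF fg hL2 zero_less_one])
    show "1 * (\<integral>t. (h i t - h j t)\<^sup>2 \<partial>half_line) \<le> (\<integral>t. (f i t - f j t)\<^sup>2 \<partial>half_line)" for i j
      by (rule order_trans[OF _ diff]) (use \<kappa>_pos in simp)
  qed
  have VL2: "V \<in> L2 half_line" using V by (simp add: L2_tendsto_iff)
  have VT: "(\<lambda>x::'a. V (hvol x)) \<in> L2 hyp_measure"
    by (rule L2_transport[OF distr_hvol[OF dim2] hvol_measurable VL2])
  \<comment> \<open>With \<open>P'\<close> the solution for \<open>e\<close>, the pairing of
    \<open>u\<close> with \<open>e\<close> equals that of \<open>w\<close> with \<open>P'\<close>,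
    hence that of \<open>g\<close> with \<open>P'\<close>. The latter is the limit of the pairings
    of \<open>f j\<close> with \<open>P'\<close>, which by symmetry are those of \<open>P j\<close>
    with \<open>e\<close>.\<close>
  have orth: "(\<integral>x. (u x - V (hvol x)) * e (hvol x) \<partial>hyp_measure) = 0" if e: "e \<in> Cc_pos" for e
  proof -
    obtain a' b' F' P' where s: "solution a' b' e F' P'" using solution_exists[OF e] by blast
    have "(\<integral>x. u x * e (hvol x) \<partial>hyp_measure) = (\<integral>x. w x * P' (hvol x) \<partial>hyp_measure)"
      by (rule solution_pairing[OF w s])
    also have "\<dots> = (\<integral>t. P' t * g t \<partial>half_line)"
      by (rule pairing_extend[OF wL2 gL2 rep solution_continuous(3)[OF s] solution_energy(2)[OF s]])
    also have "\<dots> = (\<integral>t. V t * e t \<partial>half_line)"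
    proof (rule LIMSEQ_unique)
      show "(\<lambda>j. \<integral>t. f j t * P' t \<partial>half_line) \<longlonglongrightarrow> (\<integral>t. P' t * g t \<partial>half_line)"
        using L2_tendsto_inner[OF fg solution_energy(2)[OF s]] by (simp add: mult.commute)
      show "(\<lambda>j. \<integral>t. f j t * P' t \<partial>half_line) \<longlonglongrightarrow> (\<integral>t. V t * e t \<partial>half_line)"
        using L2_tendsto_inner[OF V Cc_pos_L2[OF e]] by (simp add: solution_symmetric[OF sol s])
    qed
    also have "\<dots> = (\<integral>x. V (hvol (x::'a)) * e (hvol x) \<partial>hyp_measure)"
      by (rule integral_transport(1)[OF distr_hvol[OF dim2] hvol_measurable, symmetric])
         (intro borel_measurable_times L2_measurable VL2 Cc_pos_L2 e)
    finally show ?thesis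
      by (simp add: left_diff_distrib L2_integrable_mult uL2 VT Cc_pos_hvol_L2[OF e])
  qed
  \<comment> \<open>The lemma is one-sided and is applied to the difference and to its
    negative.\<close>
  have "AE x in hyp_measure. \<not> u x - V (hvol x) > 0"
  proof (rule radial_orthogonal_nonpos[where d = "\<lambda>t. v t - V t", OF L2_diff[OF uL2 VT] _ orth])
    show "AE x in hyp_measure. u x - V (hvol x) = v (hvol x) - V (hvol x)"
      using rad by eventually_elim simp
  qed
  moreover have "AE x in hyp_measure. \<not> V (hvol x) - u x > 0"
  proof (rule radial_orthogonal_nonpos[where d = "\<lambda>t. V t - v t", OF L2_diff[OF VT uL2]])
    show "AE x in hyp_measure. V (hvol x) - u x = V (hvol x) - v (hvol x)"
      using rad by eventually_elim simp
    show "(\<integral>x. (V (hvol x) - u x) * e (hvol x) \<partial>hyp_measure) = 0" if e: "e \<in> Cc_pos" for e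
      using orth[OF e] by (simp add: left_diff_distrib L2_integrable_mult uL2 VT Cc_pos_hvol_L2[OF e])
  qed
  ultimately have AE: "AE x in hyp_measure. u x = V (hvol x)"
    by eventually_elim simp
  have "(\<lambda>j. (\<integral>t. (h j t)\<^sup>2 \<partial>half_line) + \<kappa> * (\<integral>t. (P j t)\<^sup>2 \<partial>half_line)) \<longlonglongrightarrow>
      (\<integral>t. (H t)\<^sup>2 \<partial>half_line) + \<kappa> * (\<integral>t. (V t)\<^sup>2 \<partial>half_line)"
    by (intro tendsto_intros L2_tendsto_norm H V)
  from LIMSEQ_le[OF this L2_tendsto_norm[OF fg]] energy(3)
  have "(\<integral>t. (H t)\<^sup>2 \<partial>half_line) + \<kappa> * (\<integral>t. (V t)\<^sup>2 \<partial>half_line) \<le> (\<integral>t. (g t)\<^sup>2 \<partial>half_line)"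
    unfolding h_def by blast
  then have le: "(\<integral>t. (H t)\<^sup>2 \<partial>half_line) + \<kappa> * (\<integral>t. (V t)\<^sup>2 \<partial>half_line) \<le> (\<integral>x. (w x)\<^sup>2 \<partial>hyp_measure)"
    using gw by linarith
  have G: "(\<integral>x. P j (evol x) * laplacian \<phi> x \<partial>lebesgue) = (\<integral>x. h j (evol x) * \<phi> x \<partial>lebesgue)"
    if "\<phi> \<in> test_functions (UNIV :: 'a set)" for j \<phi>
    unfolding h_def by (rule euclidean_Green[OF sol that])
  show ?thesis by (rule that[OF G V H AE le])
qed

end

text \<open>At first \<open>u_e\<close> has a Laplacian only as a distribution, so its being a
  square-integrable function \<open>h\<close> is part of the claim. The witness is
  \<open>h y = H (evol y)\<close>, with \<open>H\<close> the limit of the Euclidean Laplacians of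
  the solutions.\<close>

theorem theorem1p4:
  fixes u w u_e :: "'a::euclidean_space \<Rightarrow> real" and v :: "real \<Rightarrow> real"
  assumes "DIM('a) \<ge> 4"
    and "u \<in> hyp_W22"
    and "has_hyp_laplacian u w"
    and "hyp_radial u"
    and "AE x in hyp_measure. u x = v (measure hyp_measure (hyp_ball0 (hyp_dist0 x) :: 'a set))"
    and "\<And>y. u_e y = v (unit_ball_vol (real DIM('a)) * norm y ^ DIM('a))"
  shows "\<exists>h. has_weak_laplacian u_e h \<and> h \<in> L2 lebesgue \<and>
           (\<integral>x. (w x)\<^sup>2 \<partial>hyp_measure)
             - (real DIM('a) - 1) ^ 4 / 16 * (\<integral>x. (u x)\<^sup>2 \<partial>hyp_measure)
           \<ge> (\<integral>y. (h y)\<^sup>2 \<partial>lebesgue)"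
proof -
  interpret hyp_space "TYPE('a)" by standard (rule assms(1))
  have "AE x in hyp_measure. x \<in> ball (0::'a) 1" by (auto simp: AE_hyp_iff)
  with assms(5) have rad: "AE x in hyp_measure. u x = v (hvol x)"
    by eventually_elim (simp add: measure_hyp_ball0)
  obtain h P V H where Green: "\<And>j \<phi>. \<phi> \<in> test_functions (UNIV :: 'a set) \<Longrightarrow>
      (\<integral>x. P j (evol x) * laplacian \<phi> x \<partial>lebesgue) = (\<integral>x. h j (evol x) * \<phi> x \<partial>lebesgue)"
    and V: "L2_tendsto half_line P V" and H: "L2_tendsto half_line h H"
    and uV: "AE x in hyp_measure. u x = V (hvol x)"
    and energy: "(\<integral>t. (H t)\<^sup>2 \<partial>half_line) + \<kappa> * (\<integral>t. (V t)\<^sup>2 \<partial>half_line) \<le> (\<integral>x. (w x)\<^sup>2 \<partial>hyp_measure)"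
    by (rule approximation[OF assms(3) rad]) (rule that)
  have VL2: "V \<in> L2 half_line" and HL2: "H \<in> L2 half_line"
    using V H by (auto simp: L2_tendsto_iff)
  note T = distr_hvol[OF dim2] hvol_measurable and T' = distr_evol[where 'a = 'a] evol_measurable
  have "AE x in hyp_measure. v (hvol (x::'a)) = V (hvol x)"
    using rad uV by eventually_elim simp
  \<comment> \<open>Here an almost-everywhere identity for an arbitrary \<open>v\<close> passes to
    Euclidean space; measurability of \<open>u_e\<close> is a consequence of it.\<close>
  from AE_evol_of_AE_hvol[OF this] have ueV: "AE y in lebesgue. V (evol y) = u_e y"
    by (rule AE_mp) (auto simp: assms(6) evol_def)
  have VE: "(\<lambda>y::'a. V (evol y)) \<in> L2 lebesgue" and HE: "(\<lambda>y::'a. H (evol y)) \<in> L2 lebesgue"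
    by (rule L2_transport[OF T' VL2], rule L2_transport[OF T' HL2])
  have "u_e \<in> borel_measurable lebesgue"
    by (rule borel_measurable_AE[OF L2_measurable[OF VE] ueV])
  then have ue: "u_e \<in> L2 lebesgue" by (rule L2_AE_cong[OF VE _ ueV])
  have weak: "(\<integral>x. u_e x * laplacian \<phi> x \<partial>lebesgue) = (\<integral>x. H (evol x) * \<phi> x \<partial>lebesgue)"
    if \<phi>: "\<phi> \<in> test_functions UNIV" for \<phi>
  proof -
    note \<phi>L2 = test_function_L2[OF \<phi>]
    have "(\<integral>x. u_e x * laplacian \<phi> x \<partial>lebesgue) = (\<integral>x. V (evol x) * laplacian \<phi> x \<partial>lebesgue)"
    proof (rule integral_cong_AE)
      show "AE x in lebesgue. u_e x * laplacian \<phi> x = V (evol x) * laplacian \<phi> x"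
        using ueV by eventually_elim simp
    qed (intro borel_measurable_times L2_measurable ue VE \<phi>L2)+
    \<comment> \<open>Both sides are limits of one sequence, because \<open>\<phi>\<close> and its
      Laplacian are square-integrable and Green's identity holds for each
      \<open>P j\<close>.\<close>
    also have "\<dots> = (\<integral>x. H (evol x) * \<phi> x \<partial>lebesgue)"
    proof (rule LIMSEQ_unique)
      show "(\<lambda>j. \<integral>x. P j (evol x) * laplacian \<phi> x \<partial>lebesgue) \<longlonglongrightarrow> (\<integral>x. V (evol x) * laplacian \<phi> x \<partial>lebesgue)"
        by (rule L2_tendsto_inner[OF L2_tendsto_transport[OF T' V] \<phi>L2(2)])
      show "(\<lambda>j. \<integral>x. P j (evol x) * laplacian \<phi> x \<partial>lebesgue) \<longlonglongrightarrow> (\<integral>x. H (evol x) * \<phi> x \<partial>lebesgue)"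
        unfolding Green[OF \<phi>] by (rule L2_tendsto_inner[OF L2_tendsto_transport[OF T' H] \<phi>L2(1)])
    qed
    finally show ?thesis .
  qed
  have uV2: "(\<integral>x. (u x)\<^sup>2 \<partial>hyp_measure) = (\<integral>t. (V t)\<^sup>2 \<partial>half_line)"
  proof -
    have "(\<integral>x. (u x)\<^sup>2 \<partial>hyp_measure) = (\<integral>x. (V (hvol (x::'a)))\<^sup>2 \<partial>hyp_measure)"
    proof (rule integral_cong_AE)
      have "u \<in> L2 hyp_measure"
        using assms(3) unfolding has_hyp_laplacian_def L2_tendsto_def by blast
      then show "(\<lambda>x. (u x)\<^sup>2) \<in> borel_measurable hyp_measure"
        by (intro borel_measurable_power L2_measurable)
      show "(\<lambda>x::'a. (V (hvol x))\<^sup>2) \<in> borel_measurable hyp_measure"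
        by (intro borel_measurable_power L2_measurable L2_transport[OF T VL2])
      show "AE x in hyp_measure. (u x)\<^sup>2 = (V (hvol x))\<^sup>2" using uV by eventually_elim simp
    qed
    also have "\<dots> = (\<integral>t. (V t)\<^sup>2 \<partial>half_line)"
      by (rule integral_transport(1)[OF T]) (intro borel_measurable_power L2_measurable VL2)
    finally show ?thesis .
  qed
  have H2: "(\<integral>y. (H (evol (y::'a)))\<^sup>2 \<partial>lebesgue) = (\<integral>t. (H t)\<^sup>2 \<partial>half_line)"
    by (rule integral_transport(1)[OF T']) (intro borel_measurable_power L2_measurable HL2)
  have "has_weak_laplacian u_e (\<lambda>y. H (evol y))"
    unfolding has_weak_laplacian_def
    using L2_lebesgue_locally_integrable[OF ue] L2_lebesgue_locally_integrable[OF HE] weak by blast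
  moreover have "(\<integral>x. (w x)\<^sup>2 \<partial>hyp_measure) - (real DIM('a) - 1) ^ 4 / 16 * (\<integral>x. (u x)\<^sup>2 \<partial>hyp_measure)
      \<ge> (\<integral>y. (H (evol (y::'a)))\<^sup>2 \<partial>lebesgue)"
    using energy unfolding uV2 H2 \<kappa>_def by linarith
  ultimately show ?thesis using HE by blast
qed

end
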